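(* For every $\alpha\in\mathbb R$, the invariant probability measure $\pi$ of the transition semigroup $\{P_t\}_{t\ge0}$ of the stochastic Cahn–Hilliard equation on $H_\alpha$ is unique.
   Context: Let $\mathcal O=(0,\pi)$, $H=L^2(\mathcal O)$. Let $\phi_0\equiv\pi^{-1/2}$, $\phi_j(x)=\sqrt{2/\pi}\cos(jx)$ ($j\ge1$), $\lambda_j=j^2$, eigenpairs of the Neumann Laplacian $A=\Delta$ ($-A\phi_j=\lambda_j\phi_j$); $e^{-A^2t}v=\sum_{j\ge0}e^{-\lambda_j^2t}\langle v,\phi_j\rangle\phi_j$. Assume $f(x)=a_0x^3+a_1x^2+a_2x+a_3$ with $a_0>0$, $a_i\in\mathbb R$, and $L_f:=\sup_{x\in\mathbb R}(-f'(x))<\lambda_1=1$; $F(v)(x)=f(v(x))$. Let $\{\beta_j\}_{j\ge1}$ be independent standard Brownian motions on a filtered probability space, $\sigma\in\mathbb R$, $W(t)=\sum_{j\ge1}\phi_j\beta_j(t)$ and $\mathscr O_t=\sigma\sum_{j\ge1}\int_0^te^{-\lambda_j^2(t-s)}\phi_j\,d\beta_j(s)$. The stochastic Cahn–Hilliard equation is $du+A^2u\,dt=AF(u)\,dt+\sigma\,dW$ (i.e. $\partial_tu+\Delta^2u=\Delta f(u)+\sigma\dot W$ with $\partial_nu=\partial_n\Delta u=0$ on $\partial\mathcal O$); for an initial value $u_0$ it has a unique mild solution $u(u_0;t)=e^{-A^2t}u_0+\int_0^tAe^{-A^2(t-s)}F(u(u_0;s))ds+\mathscr O_t$, which preserves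 the spatial mean. The transition semigroup is $P_t\phi(u_0)=\mathbb E[\phi(u(u_0;t))]$. For $\alpha\in\mathbb R$, $H_\alpha:=\{v\in H:\frac1\pi\int_{\mathcal O}v\,dx=\alpha\}$ with the $L^2$ metric. A probability measure $\pi$ on the Borel sets of $H_\alpha$ is invariant if $\int_{H_\alpha}P_t\phi\,d\pi=\int_{H_\alpha}\phi\,d\pi$ for all bounded Borel $\phi$ on $H_\alpha$ and all $t\ge0$. *)

theory Defs
  imports "HOL-Probability.Probability"
begin

text \<open>Elements of H are represented by Borel measurable functions real to real that are
square integrable on (0,pi); two representatives that agree a.e. are at L2 distance 0.
The Borel sigma-algebra of H_alpha (L2 metric) consists of saturated sets, so measures on it
correspond exactly to Borel measures on the quotient space.\<close>

definition L2fun :: "(real \<Rightarrow> real) \<Rightarrow> bool" where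
  "L2fun v \<longleftrightarrow> v \<in> borel_measurable lborel \<and>
     set_integrable lborel {0<..<pi} (\<lambda>x. (v x)^2)"

definition L2inner :: "(real \<Rightarrow> real) \<Rightarrow> (real \<Rightarrow> real) \<Rightarrow> real" where
  "L2inner v w = set_lebesgue_integral lborel {0<..<pi} (\<lambda>x. v x * w x)"

definition L2dist :: "(real \<Rightarrow> real) \<Rightarrow> (real \<Rightarrow> real) \<Rightarrow> real" where
  "L2dist v w = sqrt (set_lebesgue_integral lborel {0<..<pi} (\<lambda>x. (v x - w x)^2))"

definition spatial_mean :: "(real \<Rightarrow> real) \<Rightarrow> real" where
  "spatial_mean v = (1 / pi) * set_lebesgue_integral lborel {0<..<pi} v"

definition Hspace :: "real \<Rightarrow> (real \<Rightarrow> real) set" where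
  "Hspace \<alpha> = {v. L2fun v \<and> spatial_mean v = \<alpha>}"

definition Hopen :: "real \<Rightarrow> (real \<Rightarrow> real) set \<Rightarrow> bool" where
  "Hopen \<alpha> U \<longleftrightarrow> U \<subseteq> Hspace \<alpha> \<and>
     (\<forall>v\<in>U. \<exists>e>0. \<forall>w\<in>Hspace \<alpha>. L2dist v w < e \<longrightarrow> w \<in> U)"

definition Hmeas :: "real \<Rightarrow> (real \<Rightarrow> real) measure" where
  "Hmeas \<alpha> = sigma (Hspace \<alpha>) {U. Hopen \<alpha> U}"

definition phi :: "nat \<Rightarrow> real \<Rightarrow> real" where
  "phi j x = (if j = 0 then 1 / sqrt pi else sqrt (2 / pi) * cos (real j * x))"

definition lam :: "nat \<Rightarrow> real" where
  "lam j = (real j)^2"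

definition std_brownian_motion :: "'w measure \<Rightarrow> (real \<Rightarrow> 'w \<Rightarrow> real) \<Rightarrow> bool" where
  "std_brownian_motion M b \<longleftrightarrow>
     (\<forall>t. b t \<in> borel_measurable M) \<and>
     (AE \<omega> in M. b 0 \<omega> = 0) \<and>
     (AE \<omega> in M. continuous_on {0..} (\<lambda>t. b t \<omega>)) \<and>
     (\<forall>s t. 0 \<le> s \<longrightarrow> s < t \<longrightarrow>
        distributed M lborel (\<lambda>\<omega>. b t \<omega> - b s \<omega>) (normal_density 0 (sqrt (t - s)))) \<and>
     (\<forall>(ts :: nat \<Rightarrow> real) n. 0 \<le> ts 0 \<longrightarrow> (\<forall>i<n. ts i < ts (Suc i)) \<longrightarrow>
        prob_space.indep_vars M (\<lambda>_. borel) (\<lambda>i \<omega>. b (ts (Suc i)) \<omega> - b (ts i) \<omega>) {..<n})"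

text \<open>Wiener integral int_0^t exp(-mu (t-s)) db(s), defined pathwise via integration by
parts (the integrand is deterministic and C^1): it equals
b(t) - mu * int_0^t exp(-mu (t-s)) b(s) ds  (using b(0) = 0).\<close>
definition wiener_conv :: "real \<Rightarrow> (real \<Rightarrow> 'w \<Rightarrow> real) \<Rightarrow> real \<Rightarrow> 'w \<Rightarrow> real" where
  "wiener_conv \<mu> b t \<omega> =
     b t \<omega> - \<mu> * set_lebesgue_integral lborel {0..t} (\<lambda>s. exp (- \<mu> * (t - s)) * b s \<omega>)"

definition cubic :: "real \<Rightarrow> real \<Rightarrow> real \<Rightarrow> real \<Rightarrow> real \<Rightarrow> real" where
  "cubic a0 a1 a2 a3 x = a0 * x^3 + a1 * x^2 + a2 * x + a3"

text \<open>u u0 t \<omega> is the mild solution started at u0, written in the eigenbasis: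
<u(t),phi_j> = e^{-lam_j^2 t}<u0,phi_j> + int_0^t (-lam_j) e^{-lam_j^2 (t-s)} <F(u(s)),phi_j> ds
              + <O_t,phi_j>,  with <O_t,phi_0> = 0 and
<O_t,phi_j> = sigma int_0^t e^{-lam_j^2 (t-s)} d beta_j(s) for j >= 1.\<close>
definition mild_solution ::
  "'w measure \<Rightarrow> (nat \<Rightarrow> real \<Rightarrow> 'w \<Rightarrow> real) \<Rightarrow> real \<Rightarrow> (real \<Rightarrow> real)
   \<Rightarrow> ((real \<Rightarrow> real) \<Rightarrow> real \<Rightarrow> 'w \<Rightarrow> (real \<Rightarrow> real)) \<Rightarrow> bool" where
  "mild_solution M \<beta> \<sigma> f u \<longleftrightarrow>
     (\<forall>u0. L2fun u0 \<longrightarrow> (AE \<omega> in M.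
        (\<forall>t\<ge>0. L2fun (u u0 t \<omega>)) \<and>
        (\<forall>t\<ge>0. ((\<lambda>s. L2dist (u u0 s \<omega>) (u u0 t \<omega>)) \<longlongrightarrow> 0) (at t within {0..})) \<and>
        (\<forall>t>0. set_integrable lborel {0<..<pi} (\<lambda>x. f (u u0 t \<omega> x))) \<and>
        (\<forall>t\<ge>0. \<forall>j. set_integrable lborel {0..t}
            (\<lambda>s. - lam j * exp (- ((lam j)^2 * (t - s))) * L2inner (\<lambda>x. f (u u0 s \<omega> x)) (phi j)) \<and>
          L2inner (u u0 t \<omega>) (phi j) =
            exp (- ((lam j)^2 * t)) * L2inner u0 (phi j)
            + set_lebesgue_integral lborel {0..t}
                (\<lambda>s. - lam j * exp (- ((lam j)^2 * (t - s))) * L2inner (\<lambda>x. f (u u0 s \<omega> x)) (phi j))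
            + (if j = 0 then 0 else \<sigma> * wiener_conv ((lam j)^2) (\<beta> j) t \<omega>))))"

definition trans_sg ::
  "'w measure \<Rightarrow> ((real \<Rightarrow> real) \<Rightarrow> real \<Rightarrow> 'w \<Rightarrow> (real \<Rightarrow> real)) \<Rightarrow> real
   \<Rightarrow> ((real \<Rightarrow> real) \<Rightarrow> real) \<Rightarrow> (real \<Rightarrow> real) \<Rightarrow> real" where
  "trans_sg M u t \<phi> u0 = (\<integral>\<omega>. \<phi> (u u0 t \<omega>) \<partial>M)"

definition invariant_measure ::
  "'w measure \<Rightarrow> ((real \<Rightarrow> real) \<Rightarrow> real \<Rightarrow> 'w \<Rightarrow> (real \<Rightarrow> real)) \<Rightarrow> real
   \<Rightarrow> (real \<Rightarrow> real) measure \<Rightarrow> bool" where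
  "invariant_measure M u \<alpha> \<mu> \<longleftrightarrow>
     prob_space \<mu> \<and> sets \<mu> = sets (Hmeas \<alpha>) \<and>
     (\<forall>\<phi> t. \<phi> \<in> borel_measurable (Hmeas \<alpha>) \<longrightarrow> (\<exists>B. \<forall>v\<in>space (Hmeas \<alpha>). \<bar>\<phi> v\<bar> \<le> B) \<longrightarrow>
        0 \<le> t \<longrightarrow>
        (\<integral>v. trans_sg M u t \<phi> v \<partial>\<mu>) = (\<integral>v. \<phi> v \<partial>\<mu>))"

end

theory Submission
  imports Defs
begin

text \<open>
Two solutions \<open>u\<close>, \<open>v\<close> of equal mean driven by the same noise have a noise-free difference \<open>w\<close>, and
formally \<open>d/dt |w|\<^sub>-\<^sub>1\<^sup>2 = - 2 |w'|\<^sup>2 - 2 \<langle>f(u) - f(v), w\<rangle> \<le> - 2 (1 - L) |w|\<^sup>2\<close> in the dual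
norm of weight \<open>1 / j\<^sup>2\<close>, because \<open>- f' \<le> L < 1\<close> and the first eigenvalue is 1. Hence every cosine
coefficient of \<open>w(t)\<close> decays exponentially, \<open>P\<^sub>t \<phi>(v\<^sub>1) - P\<^sub>t \<phi>(v\<^sub>2)\<close> tends to 0 for bounded Lipschitz
functions \<open>\<phi>\<close> of finitely many coefficients, and these functions separate measures.

The energy identity needs \<open>t \<mapsto> \<parallel>f(u(t))\<parallel>\<close> (in \<open>L\<^sup>1\<close>) to be square integrable in time, while the notion of
mild solution only provides \<open>f(u(t)) \<in> L\<^sup>1\<close> for each \<open>t > 0\<close> and integrability in time of each
coefficient. Let \<open>p(t)\<close> be the integral of \<open>|u(t)|\<^sup>3\<close>, which is lower semicontinuous and finite for
\<open>t > 0\<close>. If \<open>p\<^sup>2\<close> is integrable on a short interval, Duhamel's formula bounds its integral there by a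
constant, and by a multiple of the length if \<open>p\<close> is bounded at the left endpoint. Were the closed set
of times near which \<open>p\<^sup>2\<close> is not integrable nonempty, then by Baire \<open>p\<close> would be bounded on a portion
of it, and summing over the complementary gaps would make \<open>p\<^sup>2\<close> integrable around that portion.
\<close>

section \<open>The cosine basis of the L2 space on an interval\<close>


text \<open>The obstacle is closing an estimate for a cubic term. Along a path the L2 norm is
  bounded, and two of the three powers in an L3 cube can be spent on it, so \<open>p\<close> is only
  linear in the absolute sum of the cosine coefficients; each coefficient of f(u) is in turn at most
  its L1 norm. Duhamel's formula thus becomes a linear inequality for \<open>p\<close> whose kernel,
  the sum of j^2 exp(-j^4 t), is integrable near t = 0. On short intervals Young's inequality makes
  its factor small, but a term can be absorbed only once it is known to be finite. The two bounds
  measure the semigroup term differently. From L2 data its coefficient sum is merely square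
  integrable in time, which gives a constant. A bound proportional to the length, needed to add up
  infinitely many gaps, requires the semigroup to be bounded on L3 uniformly in time, hence the
  explicit kernel majorant. The noise coefficients must be summable uniformly in time, hence Hoelder
  bounds with controlled growth in the mode. Finally, square integrability in time dominates the
  energy series by a product of two L2 functions of time.\<close>

definition lebI :: "real measure" where
  "lebI = restrict_space lborel {0<..<pi}"

abbreviation cf :: "(real \<Rightarrow> real) \<Rightarrow> nat \<Rightarrow> real" where
  "cf v j \<equiv> L2inner v (phi j)"

lemma space_lebI [simp]: "space lebI = {0<..<pi}"
  by (simp add: lebI_def space_restrict_space)

lemma borel_measurable_lebI: "f \<in> borel_measurable borel \<Longrightarrow> f \<in> borel_measurable lebI"
  unfolding lebI_def by (simp add: measurable_restrict_space1)

lemma measurable_lebI: "f \<in> borel \<rightarrow>\<^sub>M N \<Longrightarrow> f \<in> lebI \<rightarrow>\<^sub>M N"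
  unfolding lebI_def by (simp add: measurable_restrict_space1)

lemma set_integral_lebI: fixes f :: "real \<Rightarrow> real" shows "set_lebesgue_integral lborel {0<..<pi} f = integral\<^sup>L lebI f"
  unfolding lebI_def set_lebesgue_integral_def by (subst integral_restrict_space) auto

lemma set_integrable_lebI: fixes f :: "real \<Rightarrow> real" shows "set_integrable lborel {0<..<pi} f \<longleftrightarrow> integrable lebI f"
  unfolding lebI_def set_integrable_def by (subst integrable_restrict_space) auto

lemma nn_integral_lebI: "nn_integral lebI f = (\<integral>\<^sup>+x. f x * indicator {0<..<pi} x \<partial>lborel)"
  unfolding lebI_def by (subst nn_integral_restrict_space) auto

lemma finite_lebI: "finite_measure lebI"
  unfolding lebI_def
  by (rule finite_measureI) (simp add: emeasure_restrict_space space_restrict_space)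

interpretation lebI: finite_measure lebI by (rule finite_lebI)

lemma emeasure_lebI_space: "emeasure lebI {0<..<pi} = ennreal pi"
  unfolding lebI_def by (subst emeasure_restrict_space) auto

lemma measure_lebI_space: "measure lebI {0<..<pi} = pi"
  unfolding measure_def by (simp add: emeasure_lebI_space)

lemma integral_lebI_const: "(\<integral>x. c \<partial>lebI) = pi * (c::real)"
  by (simp add: measure_lebI_space)

lemma L2inner_lebI: "L2inner v w = (\<integral>x. v x * w x \<partial>lebI)"
  by (simp add: L2inner_def set_integral_lebI)

lemma L2dist_lebI: "L2dist v w = sqrt (\<integral>x. (v x - w x)^2 \<partial>lebI)"
  by (simp add: L2dist_def set_integral_lebI)

lemma L2fun_iff: "L2fun v \<longleftrightarrow> v \<in> borel_measurable borel \<and> integrable lebI (\<lambda>x. (v x)^2)"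
  by (simp add: L2fun_def set_integrable_lebI)

lemma L2fun_borel: "L2fun v \<Longrightarrow> v \<in> borel_measurable borel"
  by (simp add: L2fun_iff)

lemma L2fun_meas [measurable_dest]: "L2fun v \<Longrightarrow> v \<in> borel_measurable lebI"
  by (simp add: L2fun_iff borel_measurable_lebI)

lemma L2fun_sq: "L2fun v \<Longrightarrow> integrable lebI (\<lambda>x. (v x)^2)"
  by (simp add: L2fun_iff)

lemma L2fun_mult:
  assumes "L2fun v" "L2fun w" shows "integrable lebI (\<lambda>x. v x * w x)"
proof (rule Bochner_Integration.integrable_bound)
  show "integrable lebI (\<lambda>x. (v x)^2 + (w x)^2)"
    using assms by (intro Bochner_Integration.integrable_add L2fun_sq)
  show "(\<lambda>x. v x * w x) \<in> borel_measurable lebI"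
    using assms by (intro borel_measurable_times L2fun_meas)
  have "\<bar>v x * w x\<bar> \<le> (v x)^2 + (w x)^2" for x
  proof -
    have "\<bar>v x\<bar> * \<bar>w x\<bar> \<le> 2 * \<bar>v x\<bar> * \<bar>w x\<bar>" by simp
    also have "\<dots> \<le> (v x)^2 + (w x)^2" using sum_squares_bound[of "\<bar>v x\<bar>" "\<bar>w x\<bar>"] by simp
    finally show ?thesis by (simp add: abs_mult)
  qed
  then show "AE x in lebI. norm (v x * w x) \<le> norm ((v x)^2 + (w x)^2)" by simp
qed

lemma L2fun_bounded:
  assumes "v \<in> borel_measurable borel" "\<And>x. x \<in> {0<..<pi} \<Longrightarrow> \<bar>v x\<bar> \<le> B" shows "L2fun v"
proof -
  have "integrable lebI (\<lambda>x. (v x)^2)"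
  proof (rule lebI.integrable_const_bound[where B="B^2"])
    show "AE x in lebI. norm ((v x)^2) \<le> B^2"
      using assms(2) by (intro AE_I2) (fastforce simp: abs_le_square_iff[symmetric] intro: order.trans)
  qed (use assms(1) in \<open>auto intro!: borel_measurable_power borel_measurable_lebI\<close>)
  with assms(1) show ?thesis by (simp add: L2fun_iff)
qed

lemma L2fun_add: assumes "L2fun v" "L2fun w" shows "L2fun (\<lambda>x. v x + w x)"
proof -
  have "integrable lebI (\<lambda>x. (v x)^2 + (w x)^2 + 2 * (v x * w x))"
    using assms by (intro Bochner_Integration.integrable_add integrable_mult_right L2fun_sq L2fun_mult)
  moreover have "(\<lambda>x. v x + w x) \<in> borel_measurable borel"
    using assms by (intro borel_measurable_add L2fun_borel)
  ultimately show ?thesis by (simp add: L2fun_iff power2_sum mult.assoc)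
qed

lemma L2fun_scale: "L2fun v \<Longrightarrow> L2fun (\<lambda>x. c * v x)"
  by (auto simp: L2fun_iff power_mult_distrib intro!: borel_measurable_times)

lemma L2fun_diff: assumes "L2fun v" "L2fun w" shows "L2fun (\<lambda>x. v x - w x)"
  using L2fun_add[OF assms(1) L2fun_scale[OF assms(2), of "-1"]] by simp

lemma L2fun_const: "L2fun (\<lambda>x. c)"
  by (rule L2fun_bounded[of _ "\<bar>c\<bar>"]) auto

lemma L2fun_sum: "(\<And>i. i \<in> I \<Longrightarrow> L2fun (f i)) \<Longrightarrow> L2fun (\<lambda>x. \<Sum>i\<in>I. f i x)"
  by (induction I rule: infinite_finite_induct) (auto intro: L2fun_add L2fun_const)

lemma L2fun_integrable: "L2fun v \<Longrightarrow> integrable lebI v"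
  using L2fun_mult[OF _ L2fun_const[of 1], of v] by simp

lemma continuous_phi: "continuous_on S (phi j)"
  unfolding phi_def by (cases "j = 0") (auto intro!: continuous_intros)

lemma phi_meas: "phi j \<in> borel_measurable borel"
  by (intro borel_measurable_continuous_onI continuous_phi)

lemma abs_phi_le: "\<bar>phi j x\<bar> \<le> 1"
proof (cases "j = 0")
  case True
  have "sqrt pi \<ge> 1" using pi_gt3 by (simp add: real_le_rsqrt)
  then show ?thesis using True by (simp add: phi_def)
next
  case False
  have "sqrt (2 / pi) \<le> 1" using pi_gt3 by simp
  then have "sqrt (2 / pi) * \<bar>cos (real j * x)\<bar> \<le> 1 * 1"
    by (intro mult_mono) auto
  then show ?thesis using False by (simp add: phi_def abs_mult)
qed

lemma L2fun_phi: "L2fun (phi j)"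
  by (rule L2fun_bounded[OF phi_meas, of _ 1]) (rule abs_phi_le)

text \<open>The frequency is an integer because the product formula \<open>cos_prod\<close> produces
  \<open>i - j\<close>, which may be negative.\<close>

lemma integral_lebI_cos:
  fixes k :: int assumes "k \<noteq> 0" shows "(\<integral>x. cos (of_int k * x) \<partial>lebI) = 0"
proof -
  have "(LBINT x=ereal 0..ereal pi. cos (of_int k * x)) = sin (of_int k * pi) / of_int k - sin (of_int k * 0) / of_int k"
    using assms
    by (intro interval_integral_FTC_finite)
       (auto intro!: continuous_intros derivative_eq_intros simp: has_real_derivative_iff_has_vector_derivative[symmetric])
  also have "sin (of_int k * pi) = 0"
    using sin_integer_2pi sin_zero_iff_int2 by (metis)
  finally show ?thesis
    by (simp add: interval_lebesgue_integral_def einterval_def set_integral_lebI[symmetric] greaterThanLessThan_def greaterThan_def lessThan_def Int_def)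
qed

lemma cos_prod: "cos (real i * x) * cos (real j * x) =
   (cos (of_int (int i + int j) * x) + cos (of_int (int i - int j) * x)) / 2"
proof -
  have "real i * x + real j * x = of_int (int i + int j) * x" "real i * x - real j * x = of_int (int i - int j) * x"
    by (auto simp: algebra_simps)
  then show ?thesis using cos_times_cos[of "real i * x" "real j * x"] by (simp add: add.commute)
qed

lemma integrable_lebI_cos: "integrable lebI (\<lambda>x. cos (c * x))"
  by (rule lebI.integrable_const_bound[of _ 1])
     (auto intro!: borel_measurable_lebI borel_measurable_continuous_onI continuous_intros)

lemma integral_cos_cos:
  "(\<integral>x. cos (real i * x) * cos (real j * x) \<partial>lebI) =
     (if i = j then (if i = 0 then pi else pi / 2) else 0)"
proof -
  have "(\<integral>x. cos (real i * x) * cos (real j * x) \<partial>lebI) =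
    ((\<integral>x. cos (of_int (int i + int j) * x) \<partial>lebI) + (\<integral>x. cos (of_int (int i - int j) * x) \<partial>lebI)) / 2"
    unfolding cos_prod using integrable_lebI_cos[of "of_int (int i + int j)"] integrable_lebI_cos[of "of_int (int i - int j)"]
    by (simp del: of_int_add of_int_diff)
  also have "\<dots> = (if i = j then (if i = 0 then pi else pi / 2) else 0)"
    using integral_lebI_cos[of "int i + int j"] integral_lebI_cos[of "int i - int j"]
    by (auto simp: measure_lebI_space)
  finally show ?thesis .
qed

lemma phi_alt: "phi j x = (if j = 0 then 1 / sqrt pi else sqrt (2 / pi)) * cos (real j * x)"
  by (simp add: phi_def)

lemma integral_phi_phi: "L2inner (phi i) (phi j) = (if i = j then 1 else 0)"
proof -
  let ?a = "\<lambda>j::nat. (if j = 0 then 1 / sqrt pi else sqrt (2 / pi))"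
  have "L2inner (phi i) (phi j) = (\<integral>x. (?a i * ?a j) * (cos (real i * x) * cos (real j * x)) \<partial>lebI)"
    unfolding L2inner_lebI phi_alt by (simp add: ac_simps)
  also have "\<dots> = (?a i * ?a j) * (if i = j then (if i = 0 then pi else pi / 2) else 0)"
    by (simp only: integral_mult_right_zero integral_cos_cos)
  also have "\<dots> = (if i = j then 1 else 0)"
    by auto
  finally show ?thesis .
qed

lemma L2inner_add_left: "L2fun v \<Longrightarrow> L2fun w \<Longrightarrow> L2fun z \<Longrightarrow> L2inner (\<lambda>x. v x + w x) z = L2inner v z + L2inner w z"
  by (simp add: L2inner_lebI distrib_right L2fun_mult)

lemma L2inner_diff_left: "L2fun v \<Longrightarrow> L2fun w \<Longrightarrow> L2fun z \<Longrightarrow> L2inner (\<lambda>x. v x - w x) z = L2inner v z - L2inner w z"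
  by (simp add: L2inner_lebI left_diff_distrib L2fun_mult)

lemma L2inner_scale_left: "L2inner (\<lambda>x. c * v x) z = c * L2inner v z"
  by (simp add: L2inner_lebI mult.assoc)

lemma L2inner_commute: "L2inner v w = L2inner w v"
  by (simp add: L2inner_lebI mult.commute)

lemma L2inner_sum_left:
  assumes "\<And>i. i \<in> I \<Longrightarrow> L2fun (f i)" "L2fun z"
  shows "L2inner (\<lambda>x. \<Sum>i\<in>I. f i x) z = (\<Sum>i\<in>I. L2inner (f i) z)"
  using assms by (simp add: L2inner_lebI sum_distrib_right L2fun_mult)

lemma L2inner_self: "L2inner v v = (\<integral>x. (v x)^2 \<partial>lebI)"
  by (simp add: L2inner_lebI power2_eq_square)

text \<open>Pythagoras for an arbitrary cosine polynomial: the error splits into the tail of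
  \<open>v\<close> and the errors of the coefficients. Bessel's inequality, Parseval's identity and
  the distance from \<open>v\<close> to \<open>proj m v\<close> are all read off from it.\<close>

lemma integral_diff_trig:
  assumes "L2fun v"
  shows "(\<integral>x. (v x - (\<Sum>j<n. c j * phi j x))^2 \<partial>lebI) =
     (\<integral>x. (v x)^2 \<partial>lebI) - (\<Sum>j<n. (cf v j)^2) + (\<Sum>j<n. (c j - cf v j)^2)"
proof -
  define p where "p x = (\<Sum>j<n. c j * phi j x)" for x
  have p: "L2fun p" unfolding p_def by (intro L2fun_sum L2fun_scale L2fun_phi)
  have vp: "L2inner v p = (\<Sum>j<n. c j * cf v j)"
    unfolding p_def L2inner_commute[of v]
    by (subst L2inner_sum_left) (auto intro: L2fun_scale L2fun_phi assms simp: L2inner_scale_left)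
  have pphi: "L2inner p (phi j) = (if j < n then c j else 0)" for j
    unfolding p_def
    by (subst L2inner_sum_left) (auto intro: L2fun_scale L2fun_phi simp: L2inner_scale_left integral_phi_phi if_distrib sum.delta cong: if_cong)
  have pp: "L2inner p p = (\<Sum>j<n. (c j)^2)"
  proof -
    have "L2inner p p = (\<Sum>j<n. c j * L2inner (phi j) p)"
      using L2inner_sum_left[of "{..<n}" "\<lambda>j x. c j * phi j x" p] p
      by (simp add: p_def[abs_def, symmetric] L2inner_scale_left L2fun_scale L2fun_phi)
    then show ?thesis by (simp add: L2inner_commute[of "phi j" p for j] pphi power2_eq_square)
  qed
  have "(\<integral>x. (v x - p x)^2 \<partial>lebI) = L2inner v v - 2 * L2inner v p + L2inner p p"
  proof -
    have "(\<integral>x. (v x - p x)^2 \<partial>lebI) = (\<integral>x. v x * v x - 2 * (v x * p x) + p x * p x \<partial>lebI)"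
      by (intro Bochner_Integration.integral_cong) (auto simp: power2_eq_square algebra_simps)
    also have "\<dots> = L2inner v v - 2 * L2inner v p + L2inner p p"
      unfolding L2inner_lebI using assms p by (simp add: L2fun_mult)
    finally show ?thesis .
  qed
  also have "\<dots> = (\<integral>x. (v x)^2 \<partial>lebI) - (\<Sum>j<n. (cf v j)^2) + (\<Sum>j<n. (c j - cf v j)^2)"
    unfolding vp pp unfolding L2inner_self power2_diff
    by (simp add: sum.distrib sum_subtractf sum_distrib_left mult.assoc)
  finally show ?thesis unfolding p_def .
qed

lemma bessel: assumes "L2fun v" shows "(\<Sum>j<n. (cf v j)^2) \<le> (\<integral>x. (v x)^2 \<partial>lebI)"
proof -
  have "0 \<le> (\<integral>x. (v x - (\<Sum>j<n. cf v j * phi j x))^2 \<partial>lebI)" by (rule integral_nonneg_AE) auto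
  then show ?thesis unfolding integral_diff_trig[OF assms] by simp
qed

section \<open>Density of cosine polynomials and Parseval's identity\<close>

inductive trig :: "(real \<Rightarrow> real) \<Rightarrow> bool" where
  trig_phi: "trig (phi j)"
| trig_scale: "trig p \<Longrightarrow> trig (\<lambda>x. c * p x)"
| trig_add: "trig p \<Longrightarrow> trig q \<Longrightarrow> trig (\<lambda>x. p x + q x)"

lemma trig_cos: "trig (\<lambda>x. cos (real j * x))"
  using trig_scale[OF trig_phi[of j], of "1 / (if j = 0 then 1 / sqrt pi else sqrt (2 / pi))"]
  by (cases "j = 0") (auto simp: phi_alt)

lemma trig_cos_int: "trig (\<lambda>x. cos (of_int k * x))"
proof -
  have "cos (of_int k * x) = cos (real (nat \<bar>k\<bar>) * x)" for x
    by (cases "k \<ge> 0") (auto)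
  then show ?thesis using trig_cos[of "nat \<bar>k\<bar>"] by simp
qed

lemma trig_const: "trig (\<lambda>x. c)"
  using trig_scale[OF trig_cos[of 0], of c] by simp

text \<open>The product-to-sum formula turns a product of two basis functions into cosines of
  frequencies \<open>i + j\<close> and \<open>i - j\<close>; a nested induction extends this to both
  factors. The span is therefore an algebra, as Stone-Weierstrass requires.\<close>

lemma trig_mult: assumes "trig p" "trig q" shows "trig (\<lambda>x. p x * q x)"
  using assms
proof (induction arbitrary: q)
  case (trig_phi i)
  from trig_phi.prems show ?case
  proof induction
    case (trig_phi j)
    let ?a = "\<lambda>j::nat. (if j = 0 then 1 / sqrt pi else sqrt (2 / pi))"
    have "trig (\<lambda>x. (?a i * ?a j / 2) * (cos (of_int (int i + int j) * x) + cos (of_int (int i - int j) * x)))"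
      by (intro trig_scale trig_add trig_cos_int)
    also have "(\<lambda>x. (?a i * ?a j / 2) * (cos (of_int (int i + int j) * x) + cos (of_int (int i - int j) * x))) = (\<lambda>x. phi i x * phi j x)"
      unfolding phi_alt using cos_prod[of i _ j] by (auto simp: fun_eq_iff mult.assoc simp del: of_int_add of_int_diff)
    finally show ?case .
  next
    case (trig_scale p c)
    then show ?case using trig.trig_scale[of "\<lambda>x. phi i x * p x" c] by (simp add: mult.left_commute)
  next
    case (trig_add p q)
    then show ?case using trig.trig_add by (auto simp: distrib_left)
  qed
next
  case (trig_scale p c)
  then show ?case using trig.trig_scale[of "\<lambda>x. p x * q x" c] by (simp add: mult.assoc)
next
  case (trig_add p p')
  then show ?case using trig.trig_add by (auto simp: distrib_right)
qed

lemma trig_continuous: "trig p \<Longrightarrow> continuous_on S p"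
  by (induction rule: trig.induct) (auto intro!: continuous_intros continuous_phi)

lemma trig_L2: "trig p \<Longrightarrow> L2fun p"
  by (induction rule: trig.induct) (auto intro: L2fun_phi L2fun_scale L2fun_add)

lemma trig_expansion: assumes "trig p" shows "\<exists>n c. \<forall>x. p x = (\<Sum>j<n. c j * phi j x)"
  using assms
proof induction
  case (trig_phi j)
  have "phi j x = (\<Sum>i<Suc j. (if i = j then 1 else 0) * phi i x)" for x
    by (simp add: if_distrib[of "\<lambda>c. c * _"] cong: if_cong)
  then show ?case by (intro exI[of _ "Suc j"] exI[of _ "\<lambda>i. if i = j then 1 else 0"]) blast
next
  case (trig_scale p c)
  then obtain n d where "\<forall>x. p x = (\<Sum>j<n. d j * phi j x)" by blast
  then have "\<forall>x. c * p x = (\<Sum>j<n. (c * d j) * phi j x)" by (simp add: sum_distrib_left mult.assoc)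
  then show ?case by (intro exI[of _ n] exI[of _ "\<lambda>j. c * d j"])
next
  case (trig_add p q)
  then obtain n d m e where pq: "\<forall>x. p x = (\<Sum>j<n. d j * phi j x)" "\<forall>x. q x = (\<Sum>j<m. e j * phi j x)" by blast
  have ext: "(\<Sum>j<n. d j * phi j x) = (\<Sum>j<max n m. (if j < n then d j else 0) * phi j x)"
    "(\<Sum>j<m. e j * phi j x) = (\<Sum>j<max n m. (if j < m then e j else 0) * phi j x)" for x
    by (rule sum.mono_neutral_cong_left; auto)+
  have "\<forall>x. p x + q x = (\<Sum>j<max n m. ((if j < n then d j else 0) + (if j < m then e j else 0)) * phi j x)"
    unfolding distrib_right sum.distrib using pq ext by simp
  then show ?case
    by (intro exI[of _ "max n m"] exI[of _ "\<lambda>j. (if j < n then d j else 0) + (if j < m then e j else 0)"])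
qed

definition trig_approx :: "(real \<Rightarrow> real) \<Rightarrow> bool" where
  "trig_approx v \<longleftrightarrow> (\<forall>e>0. \<exists>p. trig p \<and> (\<integral>x. (v x - p x)^2 \<partial>lebI) < e)"

lemma integral_square_triangle:
  assumes "L2fun v" "L2fun w" "L2fun z"
  shows "(\<integral>x. (v x - z x)^2 \<partial>lebI) \<le> 2 * (\<integral>x. (v x - w x)^2 \<partial>lebI) + 2 * (\<integral>x. (w x - z x)^2 \<partial>lebI)"
proof -
  have "(\<integral>x. (v x - z x)^2 \<partial>lebI) \<le> (\<integral>x. 2 * (v x - w x)^2 + 2 * (w x - z x)^2 \<partial>lebI)"
  proof (rule integral_mono)
    show "(v x - z x)^2 \<le> 2 * (v x - w x)^2 + 2 * (w x - z x)^2" for x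
      using sum_squares_bound[of "v x - w x" "w x - z x"] power2_sum[of "v x - w x" "w x - z x"] by simp
  qed (use assms in \<open>auto intro!: Bochner_Integration.integrable_add integrable_mult_right L2fun_sq L2fun_diff\<close>)
  also have "\<dots> = 2 * (\<integral>x. (v x - w x)^2 \<partial>lebI) + 2 * (\<integral>x. (w x - z x)^2 \<partial>lebI)"
    using assms by (subst Bochner_Integration.integral_add) (auto intro!: integrable_mult_right L2fun_sq L2fun_diff)
  finally show ?thesis .
qed

lemma trig_approx_close:
  assumes "L2fun v" "\<And>e. e > 0 \<Longrightarrow> \<exists>w. L2fun w \<and> trig_approx w \<and> (\<integral>x. (v x - w x)^2 \<partial>lebI) < e"
  shows "trig_approx v"
  unfolding trig_approx_def
proof (intro allI impI)
  fix e :: real assume e: "e > 0"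
  then obtain w where w: "L2fun w" "trig_approx w" "(\<integral>x. (v x - w x)^2 \<partial>lebI) < e/4"
    using assms(2)[of "e/4"] by auto
  then obtain p where p: "trig p" "(\<integral>x. (w x - p x)^2 \<partial>lebI) < e/4"
    unfolding trig_approx_def using e by (meson divide_pos_pos zero_less_numeral)
  have "(\<integral>x. (v x - p x)^2 \<partial>lebI) < e"
    using integral_square_triangle[OF assms(1) w(1) trig_L2[OF p(1)]] w(3) p(2) by simp
  with p(1) show "\<exists>p. trig p \<and> (\<integral>x. (v x - p x)^2 \<partial>lebI) < e" by blast
qed

lemma trig_approx_lim:
  assumes "L2fun v" "\<And>i. L2fun (w i)" "\<And>i. trig_approx (w i)" "L2fun B"
    and "\<And>i x. x \<in> {0<..<pi} \<Longrightarrow> \<bar>v x - w i x\<bar> \<le> B x"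
    and "\<And>x. x \<in> {0<..<pi} \<Longrightarrow> (\<lambda>i. w i x) \<longlonglongrightarrow> v x"
  shows "trig_approx v"
proof (rule trig_approx_close[OF assms(1)])
  fix e :: real assume e: "e > 0"
  have "(\<lambda>i. \<integral>x. (v x - w i x)^2 \<partial>lebI) \<longlonglongrightarrow> (\<integral>x. 0 \<partial>lebI)"
  proof (rule integral_dominated_convergence[where w="\<lambda>x. (B x)^2"])
    show "integrable lebI (\<lambda>x. (B x)^2)" using assms(4) by (rule L2fun_sq)
    show "AE x in lebI. (\<lambda>i. (v x - w i x)^2) \<longlonglongrightarrow> 0"
    proof (rule AE_I2)
      fix x assume "x \<in> space lebI"
      then have "(\<lambda>i. (v x - w i x)^2) \<longlonglongrightarrow> (v x - v x)^2"
        using assms(6)[of x] by (intro tendsto_intros) auto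
      then show "(\<lambda>i. (v x - w i x)^2) \<longlonglongrightarrow> 0" by simp
    qed
    show "AE x in lebI. norm ((v x - w i x)^2) \<le> (B x)^2" for i
    proof (rule AE_I2)
      fix x assume "x \<in> space lebI"
      then have "\<bar>v x - w i x\<bar> \<le> \<bar>B x\<bar>" using assms(5)[of x i] by auto
      then show "norm ((v x - w i x)^2) \<le> (B x)^2" by (simp add: abs_le_square_iff)
    qed
  qed (use assms(1,2) in \<open>auto intro!: borel_measurable_power borel_measurable_diff L2fun_meas\<close>)
  then have "eventually (\<lambda>i. (\<integral>x. (v x - w i x)^2 \<partial>lebI) < e) sequentially"
    using e by (intro order_tendstoD(2)) auto
  then obtain i where "(\<integral>x. (v x - w i x)^2 \<partial>lebI) < e"
    by (meson eventually_happens' sequentially_bot)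
  then show "\<exists>w. L2fun w \<and> trig_approx w \<and> (\<integral>x. (v x - w x)^2 \<partial>lebI) < e"
    using assms(2,3) by blast
qed

lemma trig_approx_trig: "trig p \<Longrightarrow> trig_approx p"
  unfolding trig_approx_def by (intro allI impI exI[of _ p]) simp

lemma trig_approx_add:
  assumes "L2fun v" "L2fun w" "trig_approx v" "trig_approx w" shows "trig_approx (\<lambda>x. v x + w x)"
  unfolding trig_approx_def
proof (intro allI impI)
  fix e :: real assume e: "e > 0"
  obtain p where p: "trig p" "(\<integral>x. (v x - p x)^2 \<partial>lebI) < e/4"
    using assms(3) e unfolding trig_approx_def by (meson divide_pos_pos zero_less_numeral)
  obtain q where q: "trig q" "(\<integral>x. (w x - q x)^2 \<partial>lebI) < e/4"
    using assms(4) e unfolding trig_approx_def by (meson divide_pos_pos zero_less_numeral)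
  have "(\<integral>x. ((v x + w x) - (p x + q x))^2 \<partial>lebI) \<le>
     2 * (\<integral>x. ((v x + w x) - (p x + w x))^2 \<partial>lebI) + 2 * (\<integral>x. ((p x + w x) - (p x + q x))^2 \<partial>lebI)"
    by (intro integral_square_triangle L2fun_add assms trig_L2 p q)
  also have "\<dots> < e" using p(2) q(2) by simp
  finally show "\<exists>p. trig p \<and> (\<integral>x. (v x + w x - p x)^2 \<partial>lebI) < e"
    using trig_add[OF p(1) q(1)] by blast
qed

lemma trig_approx_scale:
  assumes "trig_approx v" shows "trig_approx (\<lambda>x. c * v x)"
  unfolding trig_approx_def
proof (intro allI impI)
  fix e :: real assume e: "e > 0"
  then have "e / (c^2 + 1) > 0" by (simp add: add_nonneg_pos)
  then obtain p where p: "trig p" "(\<integral>x. (v x - p x)^2 \<partial>lebI) < e / (c^2 + 1)"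
    using assms unfolding trig_approx_def by blast
  have "(\<integral>x. (c * v x - c * p x)^2 \<partial>lebI) = c^2 * (\<integral>x. (v x - p x)^2 \<partial>lebI)"
    by (simp add: right_diff_distrib[symmetric] power_mult_distrib)
  also have "\<dots> \<le> c^2 * (e / (c^2 + 1))" using p(2) by (intro mult_left_mono) auto
  also have "\<dots> < e"
  proof -
    have "0 < c^2 + 1" by (simp add: add_nonneg_pos)
    then show ?thesis using e by (simp add: divide_less_eq algebra_simps)
  qed
  finally show "\<exists>p. trig p \<and> (\<integral>x. (c * v x - p x)^2 \<partial>lebI) < e"
    using trig_scale[OF p(1)] by blast
qed

text \<open>Stone-Weierstrass on the compact interval \<open>{0..pi}\<close>: \<open>cos\<close>
  alone is injective there, so it separates the points.\<close>

lemma trig_approx_continuous: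
  assumes "continuous_on UNIV v" shows "trig_approx v"
  unfolding trig_approx_def
proof (intro allI impI)
  fix e :: real assume e: "e > 0"
  \<comment> \<open>The interval has length \<open>pi < 4\<close>, so a uniform error
    \<open>d\<close> costs at most \<open>pi * e / 8 < e\<close> in the squared L2 norm.\<close>
  define d where "d = sqrt (e / 8)"
  have d: "d > 0" "d^2 = e / 8" using e by (auto simp: d_def)
  have "\<exists>g. trig g \<and> (\<forall>x \<in> {0..pi}. \<bar>v x - g x\<bar> < d)"
  proof (rule Stone_Weierstrass_HOL[where P=trig])
    fix x y :: real assume "x \<in> {0..pi} \<and> y \<in> {0..pi} \<and> x \<noteq> y"
    then have "cos x \<noteq> cos y" using cos_inj_pi[of x y] by auto
    then show "\<exists>f. trig f \<and> f x \<noteq> f y" using trig_cos[of 1] by (intro exI[of _ "\<lambda>x. cos (real 1 * x)"]) simp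
  qed (use d assms in \<open>auto intro: trig_const trig_continuous trig_add trig_mult continuous_on_subset\<close>)
  then obtain g where g: "trig g" "\<And>x. x \<in> {0..pi} \<Longrightarrow> \<bar>v x - g x\<bar> < d" by blast
  have "(\<integral>x. (v x - g x)^2 \<partial>lebI) \<le> (\<integral>x. d^2 \<partial>lebI)"
  proof (rule integral_mono_AE)
    show "AE x in lebI. (v x - g x)^2 \<le> d^2"
    proof (rule AE_I2)
      fix x assume "x \<in> space lebI"
      then have "\<bar>v x - g x\<bar> \<le> \<bar>d\<bar>" using g(2)[of x] d by auto
      then show "(v x - g x)^2 \<le> d^2" by (simp only: abs_le_square_iff)
    qed
    have "v \<in> borel_measurable borel" "g \<in> borel_measurable borel"
      using assms trig_continuous[OF g(1)] by (auto intro!: borel_measurable_continuous_onI)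
    then have "L2fun (\<lambda>x. v x - g x)"
      using g(2) by (intro L2fun_bounded[of _ d]) (auto intro: less_imp_le)
    then show "integrable lebI (\<lambda>x. (v x - g x)^2)" by (rule L2fun_sq)
  qed auto
  also have "\<dots> = pi * (e / 8)" unfolding integral_lebI_const d(2) ..
  also have "\<dots> < e" using pi_less_4 e by simp
  finally show "\<exists>p. trig p \<and> (\<integral>x. (v x - p x)^2 \<partial>lebI) < e" using g(1) by blast
qed

lemma L2fun_indicator: "A \<in> sets borel \<Longrightarrow> L2fun (indicat_real A)"
  by (rule L2fun_bounded[of _ 1]) (auto simp: indicator_def)

text \<open>Dynkin's argument: half-lines are stable under intersection and generate the Borel sets,
  and approximability passes to complements and to disjoint countable unions.\<close>

lemma trig_approx_indicator:
  assumes "A \<in> sets borel" shows "trig_approx (indicat_real A)"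
proof -
  have b: "(borel :: real measure) = sigma UNIV (range greaterThan)" using borel_Ioi[where 'a=real] by simp
  have A: "A \<in> sigma_sets UNIV (range (greaterThan :: real \<Rightarrow> real set))"
    using assms unfolding b by simp
  have sb: "\<And>A. A \<in> sigma_sets UNIV (range (greaterThan :: real \<Rightarrow> real set)) \<Longrightarrow> A \<in> sets borel"
    unfolding b by simp
  have int: "Int_stable (range (greaterThan :: real \<Rightarrow> real set))"
  proof (rule Int_stableI)
    fix a b :: "real set" assume "a \<in> range greaterThan" "b \<in> range greaterThan"
    then obtain x y where "a = {x<..}" "b = {y<..}" by auto
    then have "a \<inter> b = {max x y<..}" by auto
    then show "a \<inter> b \<in> range greaterThan" by auto
  qed
  show ?thesis
  proof (rule sigma_sets_induct_disjoint[where P="\<lambda>A. trig_approx (indicat_real A)", OF int _ A])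
    show "range (greaterThan :: real \<Rightarrow> real set) \<subseteq> Pow UNIV" by simp
  next
    fix A :: "real set" assume "A \<in> range greaterThan"
    then obtain a where a: "A = {a<..}" by auto
    \<comment> \<open>Ramps of slope \<open>i\<close> that start at \<open>a\<close>. They vanish at
      \<open>a\<close> itself, which matches the open half-line.\<close>
    define w where "w = (\<lambda>(i::nat) x. min 1 (max 0 (real i * (x - a))))"
    show "trig_approx (indicat_real A)"
    proof (rule trig_approx_lim[where w=w and B="\<lambda>_. 1"])
      show "L2fun (indicat_real A)" using a by (intro L2fun_indicator) auto
      have c: "continuous_on UNIV (w i)" for i
        unfolding w_def by (intro continuous_intros)
      show "L2fun (w i)" for i
        by (rule L2fun_bounded[of _ 1]) (auto simp: w_def intro!: borel_measurable_continuous_onI c[unfolded w_def])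
      show "trig_approx (w i)" for i using c by (rule trig_approx_continuous)
      show "\<bar>indicat_real A x - w i x\<bar> \<le> 1" for x i by (auto simp: w_def indicator_def)
      show "(\<lambda>i. w i x) \<longlonglongrightarrow> indicat_real A x" for x
      proof (cases "x > a")
        case True
        then have "eventually (\<lambda>i. real i * (x - a) \<ge> 1) sequentially"
          by (intro eventually_sequentiallyI[of "nat \<lceil>1 / (x - a)\<rceil>"]) (simp add: field_simps nat_le_iff ceiling_le_iff)
        then have "eventually (\<lambda>i. w i x = indicat_real A x) sequentially"
          by eventually_elim (use True a in \<open>auto simp: w_def\<close>)
        then show ?thesis by (rule tendsto_eventually)
      next
        case False
        then have "real i * (x - a) \<le> 0" for i by (intro mult_nonneg_nonpos) auto
        then have "w i x = 0" for i by (simp add: w_def max_absorb1)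
        then show ?thesis using False a by simp
      qed
    qed (rule L2fun_const)
  next
    show "trig_approx (indicat_real {})" using trig_approx_trig[OF trig_const[of 0]] by (simp add: indicator_def[abs_def])
  next
    fix A :: "real set" assume A: "A \<in> sigma_sets UNIV (range greaterThan)" and t: "trig_approx (indicat_real A)"
    have "trig_approx (\<lambda>x. 1 + (-1) * indicat_real A x)"
      by (intro trig_approx_add trig_approx_scale t trig_approx_trig trig_const L2fun_const L2fun_scale L2fun_indicator sb A)
    also have "(\<lambda>x. 1 + (-1) * indicat_real A x) = indicat_real (UNIV - A)"
      by (auto simp: indicator_def)
    finally show "trig_approx (indicat_real (UNIV - A))" .
  next
    fix A :: "nat \<Rightarrow> real set"
    assume dis: "disjoint_family A" and A: "range A \<subseteq> sigma_sets UNIV (range greaterThan)"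
      and t: "\<And>i. trig_approx (indicat_real (A i))"
    have Ai: "A i \<in> sets borel" for i using A sb by auto
    define w where "w = (\<lambda>n x. \<Sum>i<n. indicat_real (A i) x)"
    have weq: "w n x = indicat_real (\<Union>i<n. A i) x" for n x
      unfolding w_def using dis by (subst indicator_UN_disjoint) (auto intro: disjoint_family_on_mono)
    show "trig_approx (indicat_real (\<Union>(range A)))"
    proof (rule trig_approx_lim[where w=w and B="\<lambda>_. 1"])
      show "L2fun (indicat_real (\<Union>(range A)))" using Ai by (intro L2fun_indicator) auto
      show L: "L2fun (w i)" for i unfolding w_def by (intro L2fun_sum L2fun_indicator Ai)
      show "trig_approx (w i)" for i
      proof (induction i)
        case 0 then show ?case using trig_approx_trig[OF trig_const[of 0]] by (simp add: w_def)
      next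
        case (Suc i)
        have "trig_approx (\<lambda>x. w i x + indicat_real (A i) x)"
          by (intro trig_approx_add L Suc t L2fun_indicator Ai)
        then show ?case by (simp add: w_def)
      qed
      show "\<bar>indicat_real (\<Union>(range A)) x - w i x\<bar> \<le> 1" for x i by (auto simp: weq indicator_def)
      show "(\<lambda>i. w i x) \<longlonglongrightarrow> indicat_real (\<Union>(range A)) x" for x
      proof (cases "x \<in> \<Union>(range A)")
        case True
        then obtain k where k: "x \<in> A k" by auto
        have "eventually (\<lambda>i. w i x = indicat_real (\<Union>(range A)) x) sequentially"
          unfolding weq using k by (intro eventually_sequentiallyI[of "Suc k"]) (auto simp: indicator_def)
        then show ?thesis by (rule tendsto_eventually)
      next
        case False
        then have "w i x = 0" for i by (auto simp: weq)
        then show ?thesis using False by simp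
      qed
    qed (rule L2fun_const)
  qed
qed

text \<open>Induction over nonnegative measurable functions. Square integrability stands inside the
  induction formula because summands and lower approximants have to inherit it, which they do by
  domination.\<close>

lemma trig_approx_nonneg:
  assumes "v \<in> borel_measurable borel" "\<And>x. 0 \<le> v x"
  shows "L2fun v \<longrightarrow> trig_approx v"
  using assms
proof (induction rule: borel_measurable_induct_real)
  case (set A)
  then show ?case by (auto intro: trig_approx_indicator)
next
  case (mult u c)
  show ?case
  proof (cases "c = 0")
    case True then show ?thesis using trig_approx_trig[OF trig_const[of 0]] by simp
  next
    case False
    show ?thesis
    proof
      assume "L2fun (\<lambda>x. c * u x)"
      from L2fun_scale[OF this, of "1/c"] have "L2fun u" using False by simp
      then show "trig_approx (\<lambda>x. c * u x)" using mult by (intro trig_approx_scale) auto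
    qed
  qed
next
  case (add u v)
  show ?case
  proof
    assume "L2fun (\<lambda>x. v x + u x)"
    then have i: "integrable lebI (\<lambda>x. (v x + u x)^2)" by (rule L2fun_sq)
    have "integrable lebI (\<lambda>x. (u x)^2)" "integrable lebI (\<lambda>x. (v x)^2)"
      by (rule Bochner_Integration.integrable_bound[OF i];
          use add in \<open>auto intro!: borel_measurable_lebI AE_I2 borel_measurable_power power_mono\<close>)+
    with add have "L2fun u" "L2fun v" by (auto simp: L2fun_iff)
    then show "trig_approx (\<lambda>x. v x + u x)" using add by (intro trig_approx_add) auto
  qed
next
  case (seq U)
  show ?case
  proof
    assume v: "L2fun v"
    have le: "U i x \<le> v x" for i x
      using seq(4,3) by (metis incseq_def incseq_le le_fun_def UNIV_I space_borel)
    have "integrable lebI (\<lambda>x. (U i x)^2)" for i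
      by (rule Bochner_Integration.integrable_bound[OF L2fun_sq[OF v]])
         (use seq le in \<open>auto intro!: borel_measurable_lebI AE_I2 borel_measurable_power power_mono\<close>)
    then have U: "L2fun (U i)" for i using seq(1) by (simp add: L2fun_iff)
    show "trig_approx v"
    proof (rule trig_approx_lim[OF v U _ v])
      show "\<bar>v x - U i x\<bar> \<le> v x" for i x using le[of i x] seq(2)[of i x] by auto
    qed (use seq U in auto)
  qed
qed

lemma trig_dense:
  assumes "L2fun v" shows "trig_approx v"
proof -
  have "L2fun (\<lambda>x. max 0 (c * v x))" for c
  proof -
    have m: "(\<lambda>x. max 0 (c * v x)) \<in> borel_measurable borel" using L2fun_borel[OF assms] by measurable
    have "integrable lebI (\<lambda>x. (max 0 (c * v x))^2)"
      by (rule Bochner_Integration.integrable_bound[OF L2fun_sq[OF L2fun_scale[OF assms, of c]]])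
         (use m in \<open>auto intro!: borel_measurable_lebI AE_I2 borel_measurable_power simp: max_def\<close>)
    with m show ?thesis by (simp add: L2fun_iff)
  qed
  note L = this
  have T: "trig_approx (\<lambda>x. max 0 (c * v x))" for c
    using trig_approx_nonneg[OF L2fun_borel[OF L[of c]]] L[of c] by auto
  have "trig_approx (\<lambda>x. max 0 (1 * v x) + (-1) * max 0 (-1 * v x))"
    by (intro trig_approx_add L L2fun_scale trig_approx_scale T)
  moreover have "(\<lambda>x. max 0 (1 * v x) + (-1) * max 0 (-1 * v x)) = v" by (auto simp: max_def)
  ultimately show ?thesis by simp
qed

text \<open>Density provides a cosine polynomial within \<open>e\<close> of \<open>v\<close>. The
  partial sum of the same length is at least as close by Pythagoras, longer partial sums only
  improve, and Bessel bounds them from the other side.\<close>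

lemma parseval:
  assumes "L2fun v" shows "(\<lambda>j. (cf v j)^2) sums (\<integral>x. (v x)^2 \<partial>lebI)"
  unfolding sums_def
proof (rule LIMSEQ_I)
  fix e :: real assume e: "e > 0"
  obtain p where p: "trig p" "(\<integral>x. (v x - p x)^2 \<partial>lebI) < e"
    using trig_dense[OF assms] e unfolding trig_approx_def by blast
  obtain n c where c: "\<And>x. p x = (\<Sum>j<n. c j * phi j x)" using trig_expansion[OF p(1)] by blast
  have "(\<integral>x. (v x)^2 \<partial>lebI) - (\<Sum>j<n. (cf v j)^2) < e"
    using p(2) sum_nonneg[of "{..<n}" "\<lambda>j. (c j - cf v j)^2"]
    unfolding c integral_diff_trig[OF assms] by simp
  moreover have "(\<Sum>j<n. (cf v j)^2) \<le> (\<Sum>j<m. (cf v j)^2)" if "m \<ge> n" for m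
    using that by (intro sum_mono2) auto
  ultimately show "\<exists>no. \<forall>m\<ge>no. norm ((\<Sum>j<m. (cf v j)^2) - (\<integral>x. (v x)^2 \<partial>lebI)) < e"
    using bessel[OF assms] by (intro exI[of _ n]) (smt (verit) real_norm_def)
qed

lemma cf_zero_imp_AE_zero:
  assumes "L2fun v" "\<And>j. cf v j = 0" shows "AE x in lebI. v x = 0"
proof -
  have "(\<integral>x. (v x)^2 \<partial>lebI) = 0"
    using parseval[OF assms(1)] assms(2) sums_unique2[OF _ sums_zero] by fastforce
  then have "AE x in lebI. (v x)^2 = 0"
    using integral_nonneg_eq_0_iff_AE[OF L2fun_sq[OF assms(1)]] by simp
  then show ?thesis by simp
qed

section \<open>Absolutely convergent cosine series\<close>

definition cseries :: "(nat \<Rightarrow> real) \<Rightarrow> real \<Rightarrow> real" where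
  "cseries c x = (\<Sum>j. c j * phi j x)"

lemma summable_phi:
  assumes "summable (\<lambda>j. \<bar>c j\<bar>)" shows "summable (\<lambda>j. \<bar>c j * phi j x\<bar>)"
proof (rule summable_comparison_test'[OF assms, of 0])
  fix j show "norm \<bar>c j * phi j x\<bar> \<le> \<bar>c j\<bar>"
    using mult_left_mono[OF abs_phi_le[of j x], of "\<bar>c j\<bar>"] by (simp add: abs_mult)
qed

lemma cseries_meas [measurable]: "cseries c \<in> borel_measurable borel"
  unfolding cseries_def[abs_def] using phi_meas by measurable

lemma abs_cseries_le:
  assumes "summable (\<lambda>j. \<bar>c j\<bar>)" shows "\<bar>cseries c x\<bar> \<le> (\<Sum>j. \<bar>c j\<bar>)"
proof -
  have "\<bar>cseries c x\<bar> \<le> (\<Sum>j. \<bar>c j * phi j x\<bar>)"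
    unfolding cseries_def by (rule summable_rabs[OF summable_phi[OF assms]])
  also have "\<dots> \<le> (\<Sum>j. \<bar>c j\<bar>)"
    using mult_left_mono[OF abs_phi_le[of _ x], of "\<bar>c _\<bar>"]
    by (intro suminf_le summable_phi assms) (simp add: abs_mult)
  finally show ?thesis .
qed

text \<open>The series is bounded, so \<open>g\<close> only has to be integrable. This allows f(u) -
  f(v), known merely to lie in L1, to be paired with the difference of two solutions.\<close>

lemma cseries_integral:
  assumes c: "summable (\<lambda>j. \<bar>c j\<bar>)" and g: "integrable lebI g"
  shows "(\<lambda>j. c j * (\<integral>x. g x * phi j x \<partial>lebI)) sums (\<integral>x. g x * cseries c x \<partial>lebI)"
proof -
  have i: "integrable lebI (\<lambda>x. g x * phi j x)" for j
    by (rule Bochner_Integration.integrable_bound[OF g])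
       (use g abs_phi_le in \<open>auto intro!: borel_measurable_times borel_measurable_lebI[OF phi_meas] AE_I2 simp: abs_mult mult_left_le\<close>)
  have "(\<lambda>j. \<integral>x. c j * (g x * phi j x) \<partial>lebI) sums (\<integral>x. (\<Sum>j. c j * (g x * phi j x)) \<partial>lebI)"
  proof (rule sums_integral)
    show "integrable lebI (\<lambda>x. c j * (g x * phi j x))" for j using i by simp
    have s: "summable (\<lambda>j. norm (c j * (g x * phi j x)))" for x
      using summable_mult[OF summable_phi[OF c, of x], of "\<bar>g x\<bar>"] by (simp add: abs_mult ac_simps)
    then show "AE x in lebI. summable (\<lambda>j. norm (c j * (g x * phi j x)))" by simp
    show "summable (\<lambda>j. \<integral>x. norm (c j * (g x * phi j x)) \<partial>lebI)"
    proof (rule summable_comparison_test'[OF summable_mult[OF c, of "\<integral>x. \<bar>g x\<bar> \<partial>lebI"], of 0])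
      fix j
      have "(\<integral>x. norm (c j * (g x * phi j x)) \<partial>lebI) \<le> (\<integral>x. \<bar>c j\<bar> * \<bar>g x\<bar> \<partial>lebI)"
      proof (rule integral_mono)
        show "norm (c j * (g x * phi j x)) \<le> \<bar>c j\<bar> * \<bar>g x\<bar>" for x
          using abs_phi_le[of j x] by (simp add: abs_mult mult_left_le mult_left_mono)
      qed (use i g in auto)
      also have "\<dots> = (\<integral>x. \<bar>g x\<bar> \<partial>lebI) * \<bar>c j\<bar>" by simp
      finally show "norm (\<integral>x. norm (c j * (g x * phi j x)) \<partial>lebI) \<le> (\<integral>x. \<bar>g x\<bar> \<partial>lebI) * \<bar>c j\<bar>"
        by (simp add: integral_nonneg_AE)
    qed
  qed
  also have "(\<lambda>j. \<integral>x. c j * (g x * phi j x) \<partial>lebI) = (\<lambda>j. c j * (\<integral>x. g x * phi j x \<partial>lebI))" by simp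
  also have eq: "(\<lambda>x. \<Sum>j. c j * (g x * phi j x)) = (\<lambda>x. g x * cseries c x)"
  proof
    fix x show "(\<Sum>j. c j * (g x * phi j x)) = g x * cseries c x"
    unfolding cseries_def using summable_rabs_cancel[OF summable_phi[OF c, of x]]
    by (subst suminf_mult[symmetric]) (auto simp: ac_simps)
  qed
  finally show ?thesis .
qed

lemma L2fun_cseries: "summable (\<lambda>j. \<bar>c j\<bar>) \<Longrightarrow> L2fun (cseries c)"
  by (rule L2fun_bounded[OF cseries_meas]) (rule abs_cseries_le)

lemma cf_cseries: assumes "summable (\<lambda>j. \<bar>c j\<bar>)" shows "cf (cseries c) i = c i"
proof -
  have "(\<lambda>j. c j * L2inner (phi i) (phi j)) sums L2inner (phi i) (cseries c)"
    unfolding L2inner_lebI by (rule cseries_integral[OF assms L2fun_integrable[OF L2fun_phi]])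
  moreover have "(\<lambda>j. c j * L2inner (phi i) (phi j)) sums c i"
    using sums_single[of i c] by (auto simp: integral_phi_phi if_distrib eq_commute cong: if_cong)
  ultimately show ?thesis using sums_unique2 L2inner_commute by metis
qed

text \<open>Both sides have the same coefficients, and completeness of the basis does the rest. It
  converts a bound on the coefficient sum into a pointwise bound, the role usually played by a
  Sobolev embedding.\<close>

lemma AE_eq_cseries:
  assumes "L2fun v" "summable (\<lambda>j. \<bar>cf v j\<bar>)" shows "AE x in lebI. v x = cseries (cf v) x"
proof -
  have "AE x in lebI. v x - cseries (cf v) x = 0"
    using assms by (intro cf_zero_imp_AE_zero)
      (auto intro!: L2fun_diff L2fun_cseries simp: L2inner_diff_left L2fun_cseries L2fun_phi cf_cseries)
  then show ?thesis by simp
qed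

section \<open>The Neumann biharmonic heat kernel\<close>


text \<open>The mean value theorem twice: for the symmetric sum \<open>g (x + z) + g (x - z)\<close>
  in \<open>z\<close>, then for \<open>g'\<close>. Second differences arise below when the kernel
  series is summed by parts.\<close>

lemma second_difference_bound:
  fixes g g' g'' :: "real \<Rightarrow> real"
  assumes "\<And>x. (g has_real_derivative g' x) (at x)" "\<And>x. (g' has_real_derivative g'' x) (at x)"
    and B: "\<And>y. \<bar>y - x\<bar> \<le> 1 \<Longrightarrow> \<bar>g'' y\<bar> \<le> B"
  shows "\<bar>2 * g x - g (x + 1) - g (x - 1)\<bar> \<le> 2 * B"
proof -
  have "\<exists>z. 0 < z \<and> z < 1 \<and> (g (x + 1) + g (x - 1)) - (g (x + 0) + g (x - 0)) = (1 - 0) * (g' (x + z) - g' (x - z))"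
    by (rule MVT2[where f="\<lambda>z. g (x + z) + g (x - z)"])
       (auto intro!: derivative_eq_intros assms(1)[THEN DERIV_chain2] )
  then obtain z where z: "0 < z" "z < 1" "(g (x + 1) + g (x - 1)) - 2 * g x = g' (x + z) - g' (x - z)" by auto
  have "\<exists>y. x - z < y \<and> y < x + z \<and> g' (x + z) - g' (x - z) = ((x + z) - (x - z)) * g'' y"
    by (rule MVT2) (use z assms(2) in auto)
  then obtain y where y: "x - z < y" "y < x + z" "g' (x + z) - g' (x - z) = 2 * z * g'' y" by auto
  have "\<bar>2 * g x - g (x + 1) - g (x - 1)\<bar> = 2 * (z * \<bar>g'' y\<bar>)"
  proof -
    have "2 * g x - g (x + 1) - g (x - 1) = - (2 * z * g'' y)" using z(3) y(3) by linarith
    then show ?thesis using z by (simp add: abs_mult)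
  qed
  also have "\<dots> \<le> 2 * (1 * B)"
    using z y B[of y] by (intro mult_left_mono mult_mono) auto
  finally show ?thesis by simp
qed

text \<open>With \<open>\<delta>\<close> the fourth root of the time, this is the multiplier of the
  biharmonic semigroup at frequency \<open>x\<close>.\<close>

definition gx :: "real \<Rightarrow> real \<Rightarrow> real" where "gx \<delta> x = exp (- ((x * \<delta>)^4))"

text \<open>In terms of \<open>y = (x * \<delta>)^2\<close> the left side is
  \<open>\<delta>^2\<close> times \<open>|16 y^3 - 12 y| exp (- y^2)\<close>. After multiplication
  by \<open>1 + y\<close> the polynomial has degree 4, so a multiple of the quadratic Taylor
  polynomial of \<open>exp (y^2)\<close> dominates it; the factor 48 is dictated by the coefficient
  of \<open>y^4\<close>.\<close>

lemma gx_second_derivative_bound: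
  assumes "0 < \<delta>"
  shows "\<bar>(16 * \<delta>^8 * x^6 - 12 * \<delta>^4 * x^2) * gx \<delta> x\<bar> \<le> 48 * \<delta>^2 / (1 + (x * \<delta>)^2)"
proof -
  define y where "y = (x * \<delta>)^2"
  have y0: "0 \<le> y" by (simp add: y_def)
  have e: "gx \<delta> x = exp (- (y^2))" by (simp add: gx_def y_def power_mult[symmetric])
  have pos: "0 < 1 + y^2 + y^4 / 2" using zero_le_power2[of y] zero_le_power[OF y0, of 4] by linarith
  have ge: "1 + y^2 + y^4 / 2 \<le> exp (y^2)"
    using exp_lower_Taylor_quadratic[of "y^2"] by (simp add: power_mult[symmetric])
  have "(12 * y + 16 * y^3) * (1 + y) \<le> 48 * (1 + y^2 + y^4 / 2)"
  proof -
    have 1: "2 * y \<le> 1 + y^2" using sum_squares_bound[of 1 y] by simp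
    have 2: "2 * y^3 \<le> y^2 + y^4"
      using sum_squares_bound[of y "y^2"] by (simp add: power2_eq_square power3_eq_cube power4_eq_xxxx algebra_simps)
    have "(12 * y + 16 * y^3) * (1 + y) = 6 * (2 * y) + 12 * y^2 + 8 * (2 * y^3) + 16 * y^4"
      by (simp add: algebra_simps power2_eq_square power3_eq_cube power4_eq_xxxx)
    also have "\<dots> \<le> 6 * (1 + y^2) + 12 * y^2 + 8 * (y^2 + y^4) + 16 * y^4" by (intro add_mono mult_left_mono order_refl 1 2) simp_all
    also have "\<dots> \<le> 48 * (1 + y^2 + y^4 / 2)" by simp
    finally show ?thesis .
  qed
  also have "\<dots> \<le> 48 * exp (y^2)" using ge by simp
  finally have A: "(12 * y + 16 * y^3) * (1 + y) * exp (- (y^2)) \<le> 48"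
    by (simp add: exp_minus field_simps)
  have "\<bar>16 * \<delta>^8 * x^6 - 12 * \<delta>^4 * x^2\<bar> \<le> 16 * \<delta>^8 * x^6 + 12 * \<delta>^4 * x^2"
  proof -
    have "0 \<le> 16 * \<delta>^8 * x^6" "0 \<le> 12 * \<delta>^4 * x^2" using assms by auto
    then show ?thesis by linarith
  qed
  also have "\<dots> = \<delta>^2 * (12 * y + 16 * y^3)"
    unfolding y_def by (simp add: power_mult_distrib algebra_simps power_mult[symmetric] power_add[symmetric])
  finally have "\<bar>(16 * \<delta>^8 * x^6 - 12 * \<delta>^4 * x^2) * gx \<delta> x\<bar> \<le> \<delta>^2 * (12 * y + 16 * y^3) * exp (- (y^2))"
    unfolding abs_mult e by (simp add: mult_right_mono)
  also have "\<dots> \<le> 48 * \<delta>^2 / (1 + y)"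
  proof -
    have "\<delta>^2 * ((12 * y + 16 * y^3) * (1 + y) * exp (- (y^2))) \<le> \<delta>^2 * 48"
      using A by (intro mult_left_mono) auto
    then show ?thesis using y0 by (simp add: field_simps)
  qed
  finally show ?thesis unfolding y_def .
qed

text \<open>288 is 48 from the second derivative, times 3 for moving the weight from
  \<open>y\<close> to \<open>x\<close>, times 2 from the second difference.\<close>

lemma gx_second_difference:
  assumes d: "0 < \<delta>" "\<delta> \<le> 1"
  shows "\<bar>2 * gx \<delta> x - gx \<delta> (x + 1) - gx \<delta> (x - 1)\<bar> \<le> 288 * \<delta>^2 / (1 + (x * \<delta>)^2)"
proof -
  have "\<bar>2 * gx \<delta> x - gx \<delta> (x + 1) - gx \<delta> (x - 1)\<bar> \<le> 2 * (144 * \<delta>^2 / (1 + (x * \<delta>)^2))"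
  proof (rule second_difference_bound)
    show "(gx \<delta> has_real_derivative - 4 * \<delta>^4 * x^3 * gx \<delta> x) (at x)" for x
      unfolding gx_def[abs_def] by (auto intro!: derivative_eq_intros simp: power_mult_distrib)
    then show "((\<lambda>x. - 4 * \<delta>^4 * x^3 * gx \<delta> x) has_real_derivative (16 * \<delta>^8 * x^6 - 12 * \<delta>^4 * x^2) * gx \<delta> x) (at x)" for x
      by (auto intro!: derivative_eq_intros) (simp add: algebra_simps eval_nat_numeral)
    fix y :: real assume y: "\<bar>y - x\<bar> \<le> 1"
    \<comment> \<open>A shift of the argument by at most 1 moves \<open>x * \<delta>\<close> by at
      most \<open>\<delta> \<le> 1\<close>, which changes the weight by a factor of at most
      3.\<close>
    have "1 + (x * \<delta>)^2 \<le> 3 * (1 + (y * \<delta>)^2)"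
    proof -
      have "x * \<delta> = y * \<delta> + (x - y) * \<delta>" by (simp add: algebra_simps)
      then have "(x * \<delta>)^2 \<le> 2 * (y * \<delta>)^2 + 2 * ((x - y) * \<delta>)^2"
        using sum_squares_bound[of "y * \<delta>" "(x - y) * \<delta>"] by (simp add: power2_sum)
      moreover have "((x - y) * \<delta>)^2 \<le> 1"
      proof -
        have "\<bar>(x - y) * \<delta>\<bar> \<le> 1 * 1" unfolding abs_mult using y d by (intro mult_mono) auto
        then show ?thesis by (simp add: abs_square_le_1)
      qed
      moreover have "0 \<le> (y * \<delta>)^2" by simp
      ultimately show ?thesis by argo
    qed
    then have "48 * \<delta>^2 / (1 + (y * \<delta>)^2) \<le> 144 * \<delta>^2 / (1 + (x * \<delta>)^2)"
    proof -
      assume a: "1 + (x * \<delta>)^2 \<le> 3 * (1 + (y * \<delta>)^2)"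
      have p: "0 < 1 + (x * \<delta>)^2" "0 < 1 + (y * \<delta>)^2" by (simp_all add: add_pos_nonneg)
      have "48 * \<delta>^2 * (1 + (x * \<delta>)^2) \<le> 48 * \<delta>^2 * (3 * (1 + (y * \<delta>)^2))" using a by (intro mult_left_mono) auto
      then show ?thesis using p by (simp add: frac_le_eq divide_le_eq le_divide_eq ac_simps)
    qed
    with gx_second_derivative_bound[OF d(1), of y]
    show "\<bar>(16 * \<delta>^8 * y^6 - 12 * \<delta>^4 * y^2) * gx \<delta> y\<bar> \<le> 144 * \<delta>^2 / (1 + (x * \<delta>)^2)" by linarith
  qed
  then show ?thesis by simp
qed

text \<open>For \<open>j \<ge> 1\<close> each term is at most the increment of \<open>arctan\<close>
  over a step of length \<open>\<delta>\<close>, so these terms telescope to less than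
  \<open>pi / 2 < 2\<close>; the term \<open>j = 0\<close> is
  \<open>\<delta> \<le> 1\<close>.\<close>

lemma sum_inverse_quadratic:
  assumes d: "0 < \<delta>" "\<delta> \<le> 1"
  shows "(\<Sum>j\<le>N. \<delta> / (1 + (real j * \<delta>)^2)) \<le> 3"
proof -
  have "(\<Sum>j\<le>N. \<delta> / (1 + (real j * \<delta>)^2)) \<le> 1 + arctan (real N * \<delta>)"
  proof (induction N)
    case 0 then show ?case using d by simp
  next
    case (Suc N)
    have "\<exists>z. real N * \<delta> < z \<and> z < real (Suc N) * \<delta> \<and>
       arctan (real (Suc N) * \<delta>) - arctan (real N * \<delta>) = (real (Suc N) * \<delta> - real N * \<delta>) * inverse (1 + z^2)"
      by (rule MVT2) (use d in \<open>auto intro: DERIV_arctan simp: mult_strict_right_mono\<close>)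
    then obtain z where z: "real N * \<delta> < z" "z < real (Suc N) * \<delta>"
      "arctan (real (Suc N) * \<delta>) - arctan (real N * \<delta>) = \<delta> * inverse (1 + z^2)" by (auto simp: algebra_simps)
    have "0 \<le> z" using z(1) d by (smt (verit) mult_nonneg_nonneg of_nat_0_le_iff)
    then have "z^2 \<le> (real (Suc N) * \<delta>)^2" using z(2) by (intro power_mono) auto
    then have "\<delta> / (1 + (real (Suc N) * \<delta>)^2) \<le> \<delta> / (1 + z^2)"
      using d by (intro divide_left_mono mult_pos_pos add_pos_nonneg) auto
    then have "\<delta> / (1 + (real (Suc N) * \<delta>)^2) \<le> arctan (real (Suc N) * \<delta>) - arctan (real N * \<delta>)"
      unfolding z(3) by (simp add: divide_inverse)
    with Suc show ?case by simp
  qed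
  also have "\<dots> \<le> 3" using arctan_ubound[of "real N * \<delta>"] pi_less_4 by simp
  finally show ?thesis .
qed

lemma gx_le: "gx \<delta> x \<le> 2 / (1 + (x * \<delta>)^2)"
proof -
  define y where "y = (x * \<delta>)^2"
  have "1 + y \<le> 2 * (1 + y^2)"
  proof -
    have "2 * y \<le> 1 + y^2" using sum_squares_bound[of 1 y] by simp
    moreover have "0 \<le> y" "0 \<le> y^2" by (auto simp: y_def)
    ultimately show ?thesis by argo
  qed
  also have "\<dots> \<le> 2 * exp (y^2)" using exp_ge_add_one_self[of "y^2"] by argo
  finally have "exp (- (y^2)) \<le> 2 / (1 + y)"
    by (simp add: exp_minus field_simps y_def add_pos_nonneg)
  then show ?thesis by (simp add: gx_def y_def power_mult[symmetric])
qed

lemma gx_pos: "0 < gx \<delta> x" by (simp add: gx_def)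

text \<open>The weight of frequency \<open>j\<close> after an even sum over all integers is folded
  onto the natural numbers; it also absorbs the different normalisation of
  \<open>phi 0\<close>.\<close>

abbreviation cw :: "nat \<Rightarrow> real" where "cw j \<equiv> (if j = 0 then 1 else 2)"

text \<open>Summation by parts, twice: multiplication by \<open>2 - 2 * cos \<theta>\<close> takes
  second differences of the coefficients, and these add up to order \<open>\<delta>\<close>. The
  trivial bound \<open>12 / \<delta>\<close> for the sum covers the part with
  \<open>\<delta>^2\<close>. Together they give quadratic decay in \<open>\<theta>\<close> at scale
  \<open>\<delta>\<close>; 1740 is 12 + 1728, and the last term is the boundary term of the partial
  sum.\<close>

lemma dirichlet_sum_bound:
  assumes d: "0 < \<delta>" "\<delta> \<le> 1"
  shows "\<bar>\<Sum>j\<le>N. cw j * gx \<delta> (real j) * cos (real j * \<theta>)\<bar> * (\<delta>^2 + (2 - 2 * cos \<theta>)) \<le> 1740 * \<delta> + 4 * gx \<delta> (real N)"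
proof -
  let ?m = "\<lambda>j::nat. gx \<delta> (real j)"
  let ?c = "\<lambda>j::nat. cos (real j * \<theta>)"
  define D where "D N = (\<Sum>j\<le>N. cw j * ?m j * ?c j)" for N :: nat
  define dd where "dd j = 2 * gx \<delta> (real j) - gx \<delta> (real j + 1) - gx \<delta> (real j - 1)" for j :: nat
  have sum3: "(\<Sum>j\<le>N. 1 / (1 + (real j * \<delta>)^2)) \<le> 3 / \<delta>"
  proof -
    have "\<delta> * (\<Sum>j\<le>N. 1 / (1 + (real j * \<delta>)^2)) \<le> 3"
      using sum_inverse_quadratic[OF d, of N] by (simp add: sum_distrib_left)
    then show ?thesis using d by (simp add: pos_le_divide_eq mult.commute)
  qed
  have 1: "\<bar>D N\<bar> * \<delta>^2 \<le> 12 * \<delta>"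
  proof -
    have "\<bar>D N\<bar> \<le> (\<Sum>j\<le>N. \<bar>cw j * ?m j * ?c j\<bar>)" unfolding D_def by (rule sum_abs)
    also have "\<dots> \<le> (\<Sum>j\<le>N. 4 * (1 / (1 + (real j * \<delta>)^2)))"
    proof (rule sum_mono)
      fix j
      have "\<bar>cw j * ?m j * ?c j\<bar> \<le> 2 * ?m j * 1"
        unfolding abs_mult using gx_pos[of \<delta> "real j"] by (intro mult_mono) auto
      also have "\<dots> \<le> 4 * (1 / (1 + (real j * \<delta>)^2))" using gx_le[of \<delta> "real j"] by simp
      finally show "\<bar>cw j * ?m j * ?c j\<bar> \<le> 4 * (1 / (1 + (real j * \<delta>)^2))" .
    qed
    also have "\<dots> \<le> 12 / \<delta>" unfolding sum_distrib_left[symmetric] using sum3 by simp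
    finally have "\<bar>D N\<bar> * \<delta>^2 \<le> 12 / \<delta> * \<delta>^2" by (intro mult_right_mono) auto
    then show ?thesis using d by (simp add: power2_eq_square)
  qed
  \<comment> \<open>\<open>dd 0\<close> involves the frequency -1. Evenness supplies its value, and
    the weight 1 at \<open>j = 0\<close> then makes the identity below hold without a boundary term
    at that end.\<close>
  have even: "gx \<delta> (-1) = gx \<delta> 1" by (simp add: gx_def)
  have id: "D N * (2 - 2 * cos \<theta>) = (\<Sum>j\<le>N. cw j * dd j * ?c j) + 2 * ?m (Suc N) * ?c N - 2 * ?m N * ?c (Suc N)" for N
  proof (induction N)
    case 0
    show ?case by (simp add: D_def dd_def even algebra_simps)
  next
    case (Suc N)
    have c: "2 * cos \<theta> * ?c (Suc N) = ?c (Suc (Suc N)) + ?c N"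
    proof -
      have "real (Suc (Suc N)) * \<theta> = real (Suc N) * \<theta> + \<theta>" "real N * \<theta> = real (Suc N) * \<theta> - \<theta>"
        by (simp_all add: algebra_simps)
      then show ?thesis by (simp only: cos_add cos_diff) simp
    qed
    have "D (Suc N) * (2 - 2 * cos \<theta>) = D N * (2 - 2 * cos \<theta>) + 2 * ?m (Suc N) * (2 * ?c (Suc N) - 2 * cos \<theta> * ?c (Suc N))"
      by (simp add: D_def algebra_simps del: of_nat_Suc)
    also have "\<dots> = (\<Sum>j\<le>N. cw j * dd j * ?c j) + 2 * ?m (Suc N) * ?c N - 2 * ?m N * ?c (Suc N)
       + 2 * ?m (Suc N) * (2 * ?c (Suc N) - (?c (Suc (Suc N)) + ?c N))" unfolding Suc c ..
    also have "\<dots> = (\<Sum>j\<le>Suc N. cw j * dd j * ?c j) + 2 * ?m (Suc (Suc N)) * ?c (Suc N) - 2 * ?m (Suc N) * ?c (Suc (Suc N))"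
      by (simp add: dd_def algebra_simps)
    finally show ?case .
  qed
  have mono: "?m (Suc N) \<le> ?m N" using d by (auto simp: gx_def intro!: power_mono mult_right_mono)
  have bd: "\<bar>a * b\<bar> \<le> \<bar>a\<bar>" if "\<bar>b\<bar> \<le> 1" for a b :: real
    using that by (simp add: abs_mult mult_left_le)
  have "\<bar>D N * (2 - 2 * cos \<theta>)\<bar> \<le> \<bar>\<Sum>j\<le>N. cw j * dd j * ?c j\<bar> + \<bar>2 * ?m (Suc N) * ?c N\<bar> + \<bar>2 * ?m N * ?c (Suc N)\<bar>"
    unfolding id by linarith
  also have "\<dots> \<le> 1728 * \<delta> + 2 * ?m N + 2 * ?m N"
  proof (intro add_mono)
    have "\<bar>\<Sum>j\<le>N. cw j * dd j * ?c j\<bar> \<le> (\<Sum>j\<le>N. \<bar>cw j * dd j * ?c j\<bar>)" by (rule sum_abs)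
    also have "\<dots> \<le> (\<Sum>j\<le>N. 576 * \<delta> * (\<delta> / (1 + (real j * \<delta>)^2)))"
    proof (rule sum_mono)
      fix j
      have "\<bar>cw j * dd j * ?c j\<bar> \<le> \<bar>cw j * dd j\<bar>" by (rule bd) simp
      also have "\<dots> \<le> 2 * \<bar>dd j\<bar>" unfolding abs_mult by (intro mult_right_mono) auto
      also have "\<dots> \<le> 2 * (288 * \<delta>^2 / (1 + (real j * \<delta>)^2))"
        using gx_second_difference[OF d, of "real j"] unfolding dd_def by simp
      finally show "\<bar>cw j * dd j * ?c j\<bar> \<le> 576 * \<delta> * (\<delta> / (1 + (real j * \<delta>)^2))"
        by (simp add: power2_eq_square)
    qed
    also have "\<dots> \<le> 576 * \<delta> * 3" unfolding sum_distrib_left[symmetric]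
      using sum_inverse_quadratic[OF d] d by (intro mult_left_mono) auto
    finally show "\<bar>\<Sum>j\<le>N. cw j * dd j * ?c j\<bar> \<le> 1728 * \<delta>" by simp
    show "\<bar>2 * ?m (Suc N) * ?c N\<bar> \<le> 2 * ?m N"
      using bd[of "?c N" "2 * ?m (Suc N)"] mono gx_pos[of \<delta> "real (Suc N)"] by simp
    show "\<bar>2 * ?m N * ?c (Suc N)\<bar> \<le> 2 * ?m N"
      using bd[of "?c (Suc N)" "2 * ?m N"] gx_pos[of \<delta> "real N"] by simp
  qed
  finally have 2: "\<bar>D N\<bar> * (2 - 2 * cos \<theta>) \<le> 1728 * \<delta> + 4 * ?m N" by (simp add: abs_mult)
  show ?thesis using 1 2 unfolding D_def[symmetric] by (simp add: distrib_left)
qed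

text \<open>From \<open>y * cos y \<le> sin y\<close> at \<open>y = x / 2\<close>, doubled with
  \<open>sin_double\<close>, where \<open>cos y\<close> is at least
  \<open>sqrt 2 / 2\<close>.\<close>

lemma half_le_sin: assumes "0 \<le> x" "x \<le> pi / 2" shows "x / 2 \<le> sin x"
proof -
  have "\<exists>z. 0 < z \<and> z < x/2 \<and> (sin (x/2) - (x/2) * cos (x/2)) - (sin 0 - 0 * cos 0) = (x/2 - 0) * (z * sin z)" if "0 < x"
    by (rule MVT2[where f="\<lambda>y. sin y - y * cos y"]) (use that in \<open>auto intro!: derivative_eq_intros\<close>)
  then have "x/2 * cos (x/2) \<le> sin (x/2)"
  proof (cases "x = 0")
    case False
    with assms obtain z where z: "0 < z" "z < x/2" "sin (x/2) - (x/2) * cos (x/2) = x/2 * (z * sin z)"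
      using \<open>0 < x \<Longrightarrow> _\<close> by auto
    have "0 \<le> sin z" using z assms pi_gt_zero by (intro sin_ge_zero) auto
    then show ?thesis using z by (smt (verit) mult_nonneg_nonneg)
  qed auto
  moreover have c: "sqrt 2 / 2 \<le> cos (x/2)"
    using assms cos_monotone_0_pi_le[of "x/2" "pi/4"] by (simp add: cos_45)
  ultimately have "2 * (x/2 * cos (x/2)) * cos (x/2) \<le> 2 * sin (x/2) * cos (x/2)"
    by (intro mult_right_mono mult_left_mono) (auto intro: order_trans[OF _ c])
  moreover have "1/2 \<le> cos (x/2) * cos (x/2)"
    using mult_mono[OF c c] by (simp add: order_trans[OF _ c])
  then have "x * (1/2) \<le> x * (cos (x/2) * cos (x/2))" using assms(1) by (rule mult_left_mono)
  ultimately show ?thesis using sin_double[of "x/2"] by simp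
qed

lemma two_minus_two_cos_ge: assumes "\<bar>\<theta>\<bar> \<le> pi" shows "\<theta>^2 / 4 \<le> 2 - 2 * cos \<theta>"
proof -
  have "\<bar>\<theta>\<bar> / 2 / 2 \<le> sin (\<bar>\<theta>\<bar> / 2)" using assms by (intro half_le_sin) auto
  then have "(\<bar>\<theta>\<bar> / 2 / 2)^2 \<le> (sin (\<bar>\<theta>\<bar> / 2))^2" by (intro power_mono) auto
  moreover have "cos \<bar>\<theta>\<bar> = 1 - 2 * (sin (\<bar>\<theta>\<bar> / 2))^2" using cos_double_sin[of "\<bar>\<theta>\<bar> / 2"] by simp
  ultimately show ?thesis by (simp add: power_divide)
qed

section \<open>A nonnegative majorant of the kernel\<close>

definition cauchy_kernel :: "real \<Rightarrow> real \<Rightarrow> real" where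
  "cauchy_kernel \<delta> \<theta> = \<delta> / (\<delta>^2 + \<theta>^2 / 4)"

text \<open>The method of images: the source \<open>x\<close> and its reflections \<open>- x\<close>
  and \<open>2 * pi - x\<close> at the two endpoints. The factor is 1740 from
  \<open>dirichlet_bound\<close> times \<open>1 / (2 * pi)\<close>, the normalisation in the product
  of two basis functions.\<close>

definition biharm_dom :: "real \<Rightarrow> real \<Rightarrow> real \<Rightarrow> real" where
  "biharm_dom \<delta> x y = 870 / pi *
     (cauchy_kernel \<delta> (y - x) + cauchy_kernel \<delta> (y + x) + cauchy_kernel \<delta> (y - (2 * pi - x)))"

lemma cauchy_kernel_nonneg: "0 < \<delta> \<Longrightarrow> 0 \<le> cauchy_kernel \<delta> \<theta>"
  by (simp add: cauchy_kernel_def)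

lemma biharm_dom_sym: "biharm_dom \<delta> x y = biharm_dom \<delta> y x"
proof -
  have "(y - x)^2 = (x - y)^2" by (simp add: power2_commute)
  moreover have "(y - (2 * pi - x)) = (x - (2 * pi - y))" by simp
  ultimately show ?thesis unfolding biharm_dom_def cauchy_kernel_def by (simp only: add.commute[of y x])
qed

lemma biharm_dom_nonneg: "0 < \<delta> \<Longrightarrow> 0 \<le> biharm_dom \<delta> x y"
  unfolding biharm_dom_def by (intro mult_nonneg_nonneg add_nonneg_nonneg cauchy_kernel_nonneg) auto

lemma nn_integral_cauchy_kernel:
  assumes "0 < \<delta>" shows "(\<integral>\<^sup>+y. ennreal (cauchy_kernel \<delta> (y - s)) \<partial>lebI) \<le> ennreal (2 * pi)"
proof -
  have "(\<integral>\<^sup>+y. ennreal (cauchy_kernel \<delta> (y - s)) \<partial>lebI) \<le> (\<integral>\<^sup>+y. ennreal (cauchy_kernel \<delta> (y - s)) * indicator {0..pi} y \<partial>lborel)"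
    unfolding nn_integral_lebI by (intro nn_integral_mono) (auto simp: indicator_def)
  also have "\<dots> = ennreal (2 * arctan ((pi - s) / (2 * \<delta>)) - 2 * arctan ((0 - s) / (2 * \<delta>)))"
  proof (rule nn_integral_FTC_Icc)
    show "(\<lambda>y. cauchy_kernel \<delta> (y - s)) \<in> borel_measurable borel" unfolding cauchy_kernel_def by measurable
    fix y
    show "((\<lambda>y. 2 * arctan ((y - s) / (2 * \<delta>))) has_real_derivative cauchy_kernel \<delta> (y - s)) (at y)"
      unfolding cauchy_kernel_def
      using assms by (auto intro!: derivative_eq_intros simp: field_simps power2_eq_square add_nonneg_eq_0_iff)
  qed (use assms in \<open>auto intro: cauchy_kernel_nonneg\<close>)
  also have "\<dots> \<le> ennreal (2 * pi)"
    using arctan_bounded[of "(pi - s) / (2 * \<delta>)"] arctan_bounded[of "(0 - s) / (2 * \<delta>)"]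
    by (intro ennreal_leI) linarith
  finally show ?thesis .
qed

lemma biharm_dom_meas: "(\<lambda>p. biharm_dom \<delta> (fst p) (snd p)) \<in> borel_measurable (borel \<Otimes>\<^sub>M borel)"
  unfolding biharm_dom_def cauchy_kernel_def by measurable

text \<open>5220 is \<open>870 / pi\<close> times three Cauchy kernels of mass at most
  \<open>2 * pi\<close> each. The bound does not depend on \<open>\<delta>\<close>, which makes the
  later L3 estimate uniform in time.\<close>

lemma nn_integral_biharm_dom:
  assumes "0 < \<delta>" shows "(\<integral>\<^sup>+y. ennreal (biharm_dom \<delta> x y) \<partial>lebI) \<le> ennreal 5220"
proof -
  have m: "(\<lambda>y. ennreal (cauchy_kernel \<delta> (y - s))) \<in> borel_measurable lebI" for s
    by (rule borel_measurable_lebI) (unfold cauchy_kernel_def, measurable)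
  have m': "(\<lambda>y. ennreal (cauchy_kernel \<delta> (y + s))) \<in> borel_measurable lebI" for s using m[of "-s"] by simp
  have e: "ennreal (biharm_dom \<delta> x y) = ennreal (870 / pi) *
     (ennreal (cauchy_kernel \<delta> (y - x)) + ennreal (cauchy_kernel \<delta> (y + x)) + ennreal (cauchy_kernel \<delta> (y - (2 * pi - x))))" for y
    unfolding biharm_dom_def using assms
    by (subst ennreal_mult) (auto simp: cauchy_kernel_nonneg)
  have "(\<integral>\<^sup>+y. ennreal (biharm_dom \<delta> x y) \<partial>lebI) = ennreal (870 / pi) *
     ((\<integral>\<^sup>+y. ennreal (cauchy_kernel \<delta> (y - x)) \<partial>lebI) + (\<integral>\<^sup>+y. ennreal (cauchy_kernel \<delta> (y + x)) \<partial>lebI)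
      + (\<integral>\<^sup>+y. ennreal (cauchy_kernel \<delta> (y - (2 * pi - x))) \<partial>lebI))"
    unfolding e using m m' by (simp add: nn_integral_cmult nn_integral_add)
  also have "\<dots> \<le> ennreal (870 / pi) * (ennreal (2 * pi) + ennreal (2 * pi) + ennreal (2 * pi))"
    using nn_integral_cauchy_kernel[OF assms, of x] nn_integral_cauchy_kernel[OF assms, of "-x"] nn_integral_cauchy_kernel[OF assms, of "2*pi - x"]
    by (intro mult_left_mono add_mono) auto
  also have "\<dots> = ennreal 5220"
    by (simp add: ennreal_plus[symmetric] ennreal_mult[symmetric] del: ennreal_plus)
  finally show ?thesis .
qed

lemma summable_gx: assumes "0 < \<delta>" shows "summable (\<lambda>j. gx \<delta> (real j))"
proof (rule summable_comparison_test'[of "\<lambda>j. 2 / \<delta>^2 * (1 / (real j)^2)" 1])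
  show "summable (\<lambda>j. 2 / \<delta>^2 * (1 / (real j)^2))"
    using inverse_power_summable[of 2, where 'a=real] by (intro summable_mult) (simp add: inverse_eq_divide)
  fix j :: nat assume "1 \<le> j"
  then have p: "0 < (real j * \<delta>)^2" using assms by simp
  have "norm (gx \<delta> (real j)) \<le> 2 / (1 + (real j * \<delta>)^2)" using gx_le[of \<delta> "real j"] gx_pos[of \<delta> "real j"] by simp
  also have "\<dots> \<le> 2 / (real j * \<delta>)^2" using p by (intro divide_left_mono mult_pos_pos add_pos_pos) auto
  finally show "norm (gx \<delta> (real j)) \<le> 2 / \<delta>^2 * (1 / (real j)^2)" by (simp add: power_mult_distrib ac_simps)
qed

lemma dirichlet_bound:
  assumes d: "0 < \<delta>" "\<delta> \<le> 1"
  shows "\<bar>\<Sum>j. cw j * gx \<delta> (real j) * cos (real j * \<theta>)\<bar> * (\<delta>^2 + (2 - 2 * cos \<theta>)) \<le> 1740 * \<delta>"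
proof -
  have s: "summable (\<lambda>j. cw j * gx \<delta> (real j) * cos (real j * \<theta>))"
  proof (rule summable_comparison_test'[OF summable_mult[OF summable_gx[OF d(1)], of 2], of 0])
    fix j
    have "\<bar>cw j * gx \<delta> (real j) * cos (real j * \<theta>)\<bar> \<le> 2 * gx \<delta> (real j) * 1"
      unfolding abs_mult using gx_pos[of \<delta> "real j"] by (intro mult_mono) auto
    then show "norm (cw j * gx \<delta> (real j) * cos (real j * \<theta>)) \<le> 2 * gx \<delta> (real j)" by simp
  qed
  have "(\<lambda>N. \<bar>\<Sum>j\<le>N. cw j * gx \<delta> (real j) * cos (real j * \<theta>)\<bar> * (\<delta>^2 + (2 - 2 * cos \<theta>))) \<longlonglongrightarrow>
     \<bar>\<Sum>j. cw j * gx \<delta> (real j) * cos (real j * \<theta>)\<bar> * (\<delta>^2 + (2 - 2 * cos \<theta>))"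
    by (intro tendsto_intros summable_LIMSEQ'[OF s])
  moreover have "(\<lambda>N. 1740 * \<delta> + 4 * gx \<delta> (real N)) \<longlonglongrightarrow> 1740 * \<delta> + 4 * 0"
    by (intro tendsto_intros summable_LIMSEQ_zero[OF summable_gx[OF d(1)]])
  ultimately show ?thesis
    using dirichlet_sum_bound[OF d] by (auto intro: LIMSEQ_le)
qed

lemma biharm_kernel_bound:
  assumes d: "0 < \<delta>" "\<delta> \<le> 1" and xy: "x \<in> {0<..<pi}" "y \<in> {0<..<pi}"
  shows "\<bar>cseries (\<lambda>j. gx \<delta> (real j) * phi j x) y\<bar> \<le> biharm_dom \<delta> x y"
proof -
  define D where "D \<theta> = (\<Sum>j. cw j * gx \<delta> (real j) * cos (real j * \<theta>))" for \<theta>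
  have s: "summable (\<lambda>j. cw j * gx \<delta> (real j) * cos (real j * \<theta>))" for \<theta>
  proof (rule summable_comparison_test'[OF summable_mult[OF summable_gx[OF d(1)], of 2], of 0])
    fix j
    have "\<bar>cw j * gx \<delta> (real j) * cos (real j * \<theta>)\<bar> \<le> 2 * gx \<delta> (real j) * 1"
      unfolding abs_mult using gx_pos[of \<delta> "real j"] by (intro mult_mono) auto
    then show "norm (cw j * gx \<delta> (real j) * cos (real j * \<theta>)) \<le> 2 * gx \<delta> (real j)" by simp
  qed
  have Db: "\<bar>D \<theta>\<bar> \<le> 1740 * cauchy_kernel \<delta> \<theta>'" if "\<bar>\<theta>'\<bar> \<le> pi" "cos \<theta>' = cos \<theta>" for \<theta> \<theta>'
  proof -
    have p: "0 < \<delta>^2 + \<theta>'^2 / 4" using d by (intro add_pos_nonneg) auto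
    have "\<bar>D \<theta>\<bar> * (\<delta>^2 + \<theta>'^2 / 4) \<le> \<bar>D \<theta>\<bar> * (\<delta>^2 + (2 - 2 * cos \<theta>))"
      using two_minus_two_cos_ge[OF that(1)] that(2) by (intro mult_left_mono) auto
    also have "\<dots> \<le> 1740 * \<delta>" unfolding D_def by (rule dirichlet_bound[OF d])
    finally show ?thesis unfolding cauchy_kernel_def using p by (simp add: field_simps)
  qed
  have prod: "phi j x * phi j y = cw j / (2 * pi) * (cos (real j * (y - x)) + cos (real j * (y + x)))" for j
  proof (cases "j = 0")
    case False
    have "sqrt (2 / pi) * sqrt (2 / pi) = 2 / pi" by simp
    moreover have "cos (real j * (y - x)) + cos (real j * (y + x)) = 2 * (cos (real j * x) * cos (real j * y))"
      by (simp add: right_diff_distrib distrib_left cos_add cos_diff)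
    moreover have "phi j x * phi j y = (sqrt (2 / pi) * sqrt (2 / pi)) * (cos (real j * x) * cos (real j * y))"
      using False unfolding phi_def by (simp only: if_False ac_simps)
    ultimately show ?thesis using False by (simp only:) simp
  qed (simp add: phi_def)
  have t: "gx \<delta> (real j) * phi j x * phi j y =
      1 / (2 * pi) * (cw j * gx \<delta> (real j) * cos (real j * (y - x)) + cw j * gx \<delta> (real j) * cos (real j * (y + x)))" for j
  proof -
    have "gx \<delta> (real j) * phi j x * phi j y = gx \<delta> (real j) * (phi j x * phi j y)" by simp
    also have "\<dots> = 1 / (2 * pi) * (cw j * gx \<delta> (real j) * cos (real j * (y - x)) + cw j * gx \<delta> (real j) * cos (real j * (y + x)))"
      unfolding prod distrib_left by simp
    finally show ?thesis .
  qed
  have "cseries (\<lambda>j. gx \<delta> (real j) * phi j x) y = (\<Sum>j. 1 / (2 * pi) * (cw j * gx \<delta> (real j) * cos (real j * (y - x)) + cw j * gx \<delta> (real j) * cos (real j * (y + x))))"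
    unfolding cseries_def t ..
  also have "\<dots> = 1 / (2 * pi) * (D (y - x) + D (y + x))"
    unfolding D_def suminf_add[OF s[of "y - x"] s[of "y + x"]] by (rule suminf_mult[OF summable_add[OF s s]])
  finally have eq: "cseries (\<lambda>j. gx \<delta> (real j) * phi j x) y = 1 / (2 * pi) * (D (y - x) + D (y + x))" .
  have D1: "\<bar>D (y - x)\<bar> \<le> 1740 * cauchy_kernel \<delta> (y - x)" using xy by (intro Db) auto
  \<comment> \<open>The quadratic lower bound for \<open>2 - 2 * cos\<close> needs an angle of
    modulus at most \<open>pi\<close>. When \<open>y + x\<close> exceeds \<open>pi\<close> the angle
    is shifted by a full period, and this produces the third image.\<close>
  have D2: "\<bar>D (y + x)\<bar> \<le> 1740 * (cauchy_kernel \<delta> (y + x) + cauchy_kernel \<delta> (y - (2 * pi - x)))"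
  proof (cases "y + x \<le> pi")
    case True
    then have "\<bar>D (y + x)\<bar> \<le> 1740 * cauchy_kernel \<delta> (y + x)" using xy by (intro Db) auto
    then show ?thesis using cauchy_kernel_nonneg[OF d(1), of "y - (2 * pi - x)"] by argo
  next
    case False
    have "cos (y - (2 * pi - x)) = cos (y + x)" using cos_periodic[of "y - (2 * pi - x)"] by (simp add: algebra_simps)
    then have "\<bar>D (y + x)\<bar> \<le> 1740 * cauchy_kernel \<delta> (y - (2 * pi - x))" using xy False by (intro Db) auto
    then show ?thesis using cauchy_kernel_nonneg[OF d(1), of "y + x"] by argo
  qed
  have "\<bar>D (y - x) + D (y + x)\<bar> \<le> 1740 * (cauchy_kernel \<delta> (y - x) + cauchy_kernel \<delta> (y + x) + cauchy_kernel \<delta> (y - (2 * pi - x)))"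
    using D1 D2 by argo
  then have "1 / (2 * pi) * \<bar>D (y - x) + D (y + x)\<bar> \<le> 1 / (2 * pi) * (1740 * (cauchy_kernel \<delta> (y - x) + cauchy_kernel \<delta> (y + x) + cauchy_kernel \<delta> (y - (2 * pi - x))))"
    by (intro mult_left_mono) auto
  moreover have "1 / (2 * pi) * (1740 * z) = 870 / pi * z" for z by simp
  moreover have "\<bar>1 / (2 * pi) * z\<bar> = 1 / (2 * pi) * \<bar>z\<bar>" for z by (simp add: abs_mult)
  ultimately show ?thesis unfolding eq biharm_dom_def by (simp only:)
qed

section \<open>Boundedness of the biharmonic semigroup on L3\<close>

lemma pair_lebI_meas:
  assumes "f \<in> borel_measurable (borel \<Otimes>\<^sub>M borel)" shows "f \<in> borel_measurable (lebI \<Otimes>\<^sub>M lebI)"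
proof -
  have id: "(\<lambda>x. x) \<in> lebI \<rightarrow>\<^sub>M borel" by (rule measurable_lebI) simp
  have "(\<lambda>p. (fst p, snd p)) \<in> (lebI \<Otimes>\<^sub>M lebI) \<rightarrow>\<^sub>M (borel \<Otimes>\<^sub>M borel)"
    by (intro measurable_Pair measurable_compose[OF measurable_fst id] measurable_compose[OF measurable_snd id])
  from measurable_compose[OF this assms] show ?thesis by simp
qed

text \<open>Jensen's inequality for the cube, from \<open>3 s\<^sup>2 r \<le> 2 s\<^sup>3 + r\<^sup>3\<close> with \<open>s\<close> the mean.\<close>

lemma nn_integral_cube_le:
  fixes k r :: "'a \<Rightarrow> real"
  assumes [measurable]: "k \<in> borel_measurable N" "r \<in> borel_measurable N"
    and k: "\<And>y. 0 \<le> k y" and r: "\<And>y. 0 \<le> r y"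
    and C: "(\<integral>\<^sup>+y. ennreal (k y) \<partial>N) \<le> ennreal C" "0 < C"
  shows "(\<integral>\<^sup>+y. ennreal (k y * r y) \<partial>N)^3 \<le> ennreal (C^2) * (\<integral>\<^sup>+y. ennreal (k y * r y^3) \<partial>N)"
proof -
  define Q where "Q = (\<integral>\<^sup>+y. ennreal (k y * r y^3) \<partial>N)"
  define V where "V = (\<integral>\<^sup>+y. ennreal (k y * r y) \<partial>N)"
  have cub: "3 * s^2 * a \<le> 2 * s^3 + a^3" if "0 \<le> s" "0 \<le> a" for s a :: real
  proof -
    have "0 \<le> (a - s)^2 * (a + 2 * s)" using that by simp
    then show ?thesis by (simp add: power2_eq_square power3_eq_cube algebra_simps)
  qed
  have main: "ennreal (3 * s^2) * V \<le> ennreal (2 * s^3) * ennreal C + Q" if s: "0 \<le> s" for s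
  proof -
    have "ennreal (3 * s^2) * V = (\<integral>\<^sup>+y. ennreal (k y * (3 * s^2 * r y)) \<partial>N)"
      unfolding V_def using k r
      by (subst nn_integral_cmult[symmetric]) (auto simp: ennreal_mult[symmetric] ac_simps intro!: nn_integral_cong)
    also have "\<dots> \<le> (\<integral>\<^sup>+y. ennreal (2 * s^3) * ennreal (k y) + ennreal (k y * r y^3) \<partial>N)"
    proof (rule nn_integral_mono)
      fix y
      have "k y * (3 * s^2 * r y) \<le> k y * (2 * s^3 + r y^3)" using cub[OF s r] k by (intro mult_left_mono) auto
      then have "ennreal (k y * (3 * s^2 * r y)) \<le> ennreal (2 * s^3 * k y + k y * r y^3)"
        by (intro ennreal_leI) (simp add: algebra_simps)
      also have "\<dots> = ennreal (2 * s^3) * ennreal (k y) + ennreal (k y * r y^3)"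
        using s k r by (simp add: ennreal_mult)
      finally show "ennreal (k y * (3 * s^2 * r y)) \<le> ennreal (2 * s^3) * ennreal (k y) + ennreal (k y * r y^3)" .
    qed
    also have "\<dots> = ennreal (2 * s^3) * (\<integral>\<^sup>+y. ennreal (k y) \<partial>N) + Q"
      unfolding Q_def by (simp add: nn_integral_add nn_integral_cmult)
    also have "\<dots> \<le> ennreal (2 * s^3) * ennreal C + Q" using C by (intro add_mono mult_left_mono) auto
    finally show ?thesis .
  qed
  show ?thesis
  proof (cases "Q = \<infinity>")
    case True
    then show ?thesis unfolding Q_def[symmetric] using C by (simp add: ennreal_mult_top)
  next
    case False
    then obtain q where q: "Q = ennreal q" "0 \<le> q" by (cases Q) auto
    \<comment> \<open>The choice \<open>s = 1\<close> only shows that \<open>V\<close> is finite, so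
      that the mean \<open>v / C\<close> may be inserted for \<open>s\<close> afterwards.\<close>
    have "ennreal (3 * 1^2) * V \<le> ennreal (2 * 1^3) * ennreal C + Q" by (rule main) simp
    also have "\<dots> < \<infinity>" using False by (simp add: ennreal_mult_less_top less_top)
    finally have "V < \<infinity>" by (auto simp: ennreal_mult_less_top)
    then obtain v where v: "V = ennreal v" "0 \<le> v" by (cases V) auto
    have "ennreal (3 * (v / C)^2) * ennreal v \<le> ennreal (2 * (v / C)^3) * ennreal C + ennreal q"
      using main[of "v / C"] v q C by simp
    then have "3 * (v / C)^2 * v \<le> 2 * (v / C)^3 * C + q"
      using v q C by (simp add: ennreal_mult[symmetric] ennreal_plus[symmetric] del: ennreal_plus)
    then have "v^3 / C^2 \<le> q" using C by (simp add: power2_eq_square power3_eq_cube field_simps)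
    then have "v^3 \<le> C^2 * q" using C by (simp add: field_simps)
    then have "ennreal (v^3) \<le> ennreal (C^2 * q)" by (rule ennreal_leI)
    then show ?thesis unfolding V_def[symmetric] Q_def[symmetric] v q using v q by (simp add: ennreal_power ennreal_mult)
  qed
qed

definition semi :: "real \<Rightarrow> (nat \<Rightarrow> real) \<Rightarrow> nat \<Rightarrow> real" where
  "semi \<tau> c j = exp (- ((lam j)^2 * \<tau>)) * c j"

lemma semi_gx: assumes "0 \<le> \<tau>" shows "exp (- ((lam j)^2 * \<tau>)) = gx (root 4 \<tau>) (real j)"
  using assms by (simp add: gx_def lam_def power_mult_distrib power_mult[symmetric])

lemma abs_cf_le: assumes "L2fun v" shows "\<bar>cf v j\<bar> \<le> sqrt (\<integral>x. (v x)^2 \<partial>lebI)"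
proof (rule real_le_rsqrt)
  have "(cf v j)^2 \<le> (\<Sum>i<Suc j. (cf v i)^2)" by (rule member_le_sum) auto
  also have "\<dots> \<le> (\<integral>x. (v x)^2 \<partial>lebI)" by (rule bessel[OF assms])
  finally show "\<bar>cf v j\<bar>^2 \<le> (\<integral>x. (v x)^2 \<partial>lebI)" by simp
qed

lemma summable_semi: assumes "0 < \<tau>" "L2fun v" shows "summable (\<lambda>j. \<bar>semi \<tau> (cf v) j\<bar>)"
proof (rule summable_comparison_test'[OF summable_mult2[OF summable_gx], of "root 4 \<tau>" 0 _ "sqrt (\<integral>x. (v x)^2 \<partial>lebI)"])
  fix j show "norm \<bar>semi \<tau> (cf v) j\<bar> \<le> gx (root 4 \<tau>) (real j) * sqrt (\<integral>x. (v x)^2 \<partial>lebI)"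
    using abs_cf_le[OF assms(2), of j] assms(1) gx_pos[of "root 4 \<tau>" "real j"]
    by (simp add: semi_def abs_mult semi_gx)
qed (use assms in simp)

text \<open>The biharmonic kernel has no sign, so positivity arguments are replaced by the Schur
  test with the symmetric majorant \<open>biharm_dom\<close>. Jensen in \<open>y\<close> costs
  \<open>5220^2\<close>, and integrating out \<open>x\<close> costs another 5220.\<close>

lemma semi_L3:
  assumes v: "L2fun v" and tau: "0 < \<tau>" "\<tau> \<le> 1"
  shows "(\<integral>\<^sup>+x. ennreal (\<bar>cseries (semi \<tau> (cf v)) x\<bar>^3) \<partial>lebI) \<le> ennreal (5220^3) * (\<integral>\<^sup>+x. ennreal (\<bar>v x\<bar>^3) \<partial>lebI)"
proof -
  define \<delta> where "\<delta> = root 4 \<tau>"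
  have d: "0 < \<delta>" "\<delta> \<le> 1" using tau by (auto simp: \<delta>_def)
  have vm: "v \<in> borel_measurable borel" using v by (rule L2fun_borel)
  let ?k = "\<lambda>x y. ennreal (biharm_dom \<delta> x y)"
  have km1: "(\<lambda>y. biharm_dom \<delta> x y) \<in> borel_measurable lebI" for x
    by (rule borel_measurable_lebI) (unfold biharm_dom_def cauchy_kernel_def, measurable)
  have pt: "ennreal (\<bar>cseries (semi \<tau> (cf v)) x\<bar>^3) \<le> ennreal (5220^2) * (\<integral>\<^sup>+y. ennreal (biharm_dom \<delta> x y * \<bar>v y\<bar>^3) \<partial>lebI)"
    if x: "x \<in> space lebI" for x
  proof -
    have sm: "summable (\<lambda>j. \<bar>gx \<delta> (real j) * phi j x\<bar>)"
      by (rule summable_phi) (use summable_gx[OF d(1)] gx_pos[of \<delta>] in \<open>simp add: less_imp_le\<close>)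
    have "(\<lambda>j. gx \<delta> (real j) * phi j x * cf v j) sums (\<integral>y. v y * cseries (\<lambda>j. gx \<delta> (real j) * phi j x) y \<partial>lebI)"
      unfolding L2inner_lebI by (rule cseries_integral[OF sm L2fun_integrable[OF v]])
    then have eq: "cseries (semi \<tau> (cf v)) x = (\<integral>y. v y * cseries (\<lambda>j. gx \<delta> (real j) * phi j x) y \<partial>lebI)"
    proof -
      have "semi \<tau> (cf v) j * phi j x = gx \<delta> (real j) * phi j x * cf v j" for j
        unfolding semi_def using tau semi_gx[of \<tau> j] by (simp add: \<delta>_def)
      then show ?thesis
        unfolding cseries_def[of "semi \<tau> (cf v)"] using \<open>_ sums _\<close> by (simp only: sums_iff)
    qed
    have "ennreal \<bar>cseries (semi \<tau> (cf v)) x\<bar> \<le> (\<integral>\<^sup>+y. ennreal \<bar>v y * cseries (\<lambda>j. gx \<delta> (real j) * phi j x) y\<bar> \<partial>lebI)"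
      unfolding eq using integral_norm_bound_ennreal[OF L2fun_mult[OF v L2fun_cseries[OF sm]]] by simp
    also have "\<dots> \<le> (\<integral>\<^sup>+y. ennreal (biharm_dom \<delta> x y * \<bar>v y\<bar>) \<partial>lebI)"
    proof (rule nn_integral_mono)
      fix y assume "y \<in> space lebI"
      then have "\<bar>cseries (\<lambda>j. gx \<delta> (real j) * phi j x) y\<bar> \<le> biharm_dom \<delta> x y"
        using x by (intro biharm_kernel_bound d) auto
      then show "ennreal \<bar>v y * cseries (\<lambda>j. gx \<delta> (real j) * phi j x) y\<bar> \<le> ennreal (biharm_dom \<delta> x y * \<bar>v y\<bar>)"
        by (intro ennreal_leI) (simp add: abs_mult mult.commute[of "biharm_dom \<delta> x y"] mult_left_mono)
    qed
    finally have "ennreal \<bar>cseries (semi \<tau> (cf v)) x\<bar>^3 \<le> (\<integral>\<^sup>+y. ennreal (biharm_dom \<delta> x y * \<bar>v y\<bar>) \<partial>lebI)^3"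
      by (rule power_mono) simp
    also have "\<dots> \<le> ennreal (5220^2) * (\<integral>\<^sup>+y. ennreal (biharm_dom \<delta> x y * \<bar>v y\<bar>^3) \<partial>lebI)"
      by (rule nn_integral_cube_le)
         (use km1 vm nn_integral_biharm_dom[OF d(1)] biharm_dom_nonneg[OF d(1)] in \<open>auto intro: borel_measurable_lebI\<close>)
    finally show ?thesis by (simp add: ennreal_power)
  qed
  have pm: "(\<lambda>p. ennreal (biharm_dom \<delta> (fst p) (snd p) * \<bar>v (snd p)\<bar>^3)) \<in> borel_measurable (lebI \<Otimes>\<^sub>M lebI)"
    by (intro pair_lebI_meas measurable_compose[OF _ measurable_ennreal] borel_measurable_times biharm_dom_meas
          borel_measurable_power borel_measurable_abs measurable_compose[OF measurable_snd vm])
  interpret P: pair_sigma_finite lebI lebI by standard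
  have "(\<integral>\<^sup>+x. ennreal (\<bar>cseries (semi \<tau> (cf v)) x\<bar>^3) \<partial>lebI) \<le>
     (\<integral>\<^sup>+x. ennreal (5220^2) * (\<integral>\<^sup>+y. ennreal (biharm_dom \<delta> x y * \<bar>v y\<bar>^3) \<partial>lebI) \<partial>lebI)"
    by (intro nn_integral_mono pt)
  also have "\<dots> = ennreal (5220^2) * (\<integral>\<^sup>+x. (\<integral>\<^sup>+y. ennreal (biharm_dom \<delta> x y * \<bar>v y\<bar>^3) \<partial>lebI) \<partial>lebI)"
    using pm by (intro nn_integral_cmult lebI.borel_measurable_nn_integral) (simp add: case_prod_unfold)
  also have "(\<integral>\<^sup>+x. (\<integral>\<^sup>+y. ennreal (biharm_dom \<delta> x y * \<bar>v y\<bar>^3) \<partial>lebI) \<partial>lebI) =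
     (\<integral>\<^sup>+y. (\<integral>\<^sup>+x. ennreal (biharm_dom \<delta> x y * \<bar>v y\<bar>^3) \<partial>lebI) \<partial>lebI)"
    using pm by (intro P.Fubini'[symmetric]) (simp add: case_prod_unfold)
  also have "\<dots> \<le> (\<integral>\<^sup>+y. ennreal 5220 * ennreal (\<bar>v y\<bar>^3) \<partial>lebI)"
  proof (rule nn_integral_mono)
    fix y
    have "(\<integral>\<^sup>+x. ennreal (biharm_dom \<delta> x y * \<bar>v y\<bar>^3) \<partial>lebI) = (\<integral>\<^sup>+x. ennreal (biharm_dom \<delta> y x) * ennreal (\<bar>v y\<bar>^3) \<partial>lebI)"
      by (intro nn_integral_cong) (simp add: ennreal_mult biharm_dom_nonneg d biharm_dom_sym[of \<delta> y])
    also have "\<dots> = (\<integral>\<^sup>+x. ennreal (biharm_dom \<delta> y x) \<partial>lebI) * ennreal (\<bar>v y\<bar>^3)"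
      using km1 by (intro nn_integral_multc) auto
    also have "\<dots> \<le> ennreal 5220 * ennreal (\<bar>v y\<bar>^3)" by (intro mult_right_mono nn_integral_biharm_dom d) auto
    finally show "(\<integral>\<^sup>+x. ennreal (biharm_dom \<delta> x y * \<bar>v y\<bar>^3) \<partial>lebI) \<le> ennreal 5220 * ennreal (\<bar>v y\<bar>^3)" .
  qed
  also have "\<dots> = ennreal 5220 * (\<integral>\<^sup>+y. ennreal (\<bar>v y\<bar>^3) \<partial>lebI)"
    using borel_measurable_lebI[OF vm] by (intro nn_integral_cmult) measurable
  finally have "(\<integral>\<^sup>+x. ennreal (\<bar>cseries (semi \<tau> (cf v)) x\<bar>^3) \<partial>lebI) \<le>
     ennreal (5220^2) * (ennreal 5220 * (\<integral>\<^sup>+y. ennreal (\<bar>v y\<bar>^3) \<partial>lebI))" by (simp add: mult_left_mono)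
  also have "\<dots> = ennreal (5220^3) * (\<integral>\<^sup>+x. ennreal (\<bar>v x\<bar>^3) \<partial>lebI)"
    unfolding mult.assoc[symmetric] by (simp add: ennreal_mult[symmetric])
  finally show ?thesis .
qed

section \<open>Stochastic convolutions are summable over the modes\<close>


text \<open>105 = 7 * 5 * 3 is the eighth moment of a standard normal variable. Eight is the lowest
  even order \<open>p\<close> that gives Hoelder exponent 1/3: the dyadic sums of level
  \<open>n\<close> scale like 2 to the power \<open>n (1 - p/2 + p/3)\<close>, which decays only for
  \<open>p > 6\<close>.\<close>

lemma brownian_eighth_moment:
  assumes "std_brownian_motion M b" "0 \<le> s" "s < t"
  shows "(\<integral>\<^sup>+\<omega>. ennreal ((b t \<omega> - b s \<omega>)^8) \<partial>M) = ennreal (105 * (t - s)^4)"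
proof -
  have d: "distributed M lborel (\<lambda>\<omega>. b t \<omega> - b s \<omega>) (normal_density 0 (sqrt (t - s)))"
    using assms by (auto simp: std_brownian_motion_def)
  have s0: "0 < sqrt (t - s)" using assms by simp
  have "(\<integral>\<^sup>+\<omega>. ennreal ((b t \<omega> - b s \<omega>)^8) \<partial>M) =
      (\<integral>\<^sup>+x. ennreal (normal_density 0 (sqrt (t - s)) x) * ennreal (x^8) \<partial>lborel)"
    by (rule distributed_nn_integral[OF d, symmetric]) auto
  also have "\<dots> = (\<integral>\<^sup>+x. ennreal (normal_density 0 (sqrt (t - s)) x * (x - 0)^(2*4)) \<partial>lborel)"
    by (intro nn_integral_cong) (simp add: ennreal_mult)
  also have "\<dots> = ennreal (fact (2 * 4) / ((2 / (sqrt (t - s))\<^sup>2)^4 * fact 4))"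
    using normal_moment_even[OF s0, of 0 4, unfolded has_bochner_integral_iff]
    by (subst nn_integral_eq_integral) auto
  also have "fact (2 * 4) / ((2 / (sqrt (t - s))\<^sup>2)^4 * fact 4) = 105 * (t - s)^4"
    using assms by (simp add: fact_numeral power_divide field_simps)
  finally show ?thesis .
qed

text \<open>The ratio between dyadic levels for Hoelder exponent 1/3. An exponent above 1/4 is
  needed, because mode \<open>j\<close> decays at rate \<open>j^4\<close> and the resulting powers
  of \<open>j\<close> must be summable.\<close>

definition dyq :: real where "dyq = 2 powr (-1/3)"

lemma dyq: "0 < dyq" "dyq < 1" "dyq^3 = 1/2" "dyq / (1 - dyq) \<le> 4"
proof -
  show 0: "0 < dyq" by (simp add: dyq_def)
  have "dyq^3 = 2 powr (3 * (-1/3))" unfolding dyq_def by (simp add: powr_powr powr_realpow[symmetric])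
  then show 3: "dyq^3 = 1/2" by (simp add: powr_minus)
  \<comment> \<open>The cube of 4/5 is 64/125, which exceeds 1/2.\<close>
  have "\<not> dyq \<ge> 4/5"
  proof
    assume "dyq \<ge> 4/5"
    then have "(4/5)^3 \<le> dyq^3" by (intro power_mono) auto
    then show False unfolding 3 by (simp add: power3_eq_cube)
  qed
  then show "dyq < 1" "dyq / (1 - dyq) \<le> 4" by (auto simp: field_simps)
qed

lemma dyq_geometric: "(\<Sum>i<m. dyq^Suc i) \<le> 4"
proof -
  have "(\<Sum>i<m. dyq^Suc i) = dyq * (\<Sum>i<m. dyq^i)" by (simp add: sum_distrib_left)
  also have "\<dots> = dyq * ((1 - dyq^m) / (1 - dyq))"
    using dyq by (subst sum_gp_strict) auto
  also have "\<dots> \<le> dyq * (1 / (1 - dyq))"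
    using dyq by (intro mult_left_mono divide_right_mono) auto
  finally show ?thesis using dyq(4) by simp
qed

text \<open>The chaining step of the Kolmogorov--Chentsov argument.\<close>

lemma holder_of_dyadic:
  fixes b :: "real \<Rightarrow> real" and N :: nat
  assumes cont: "continuous_on {0..} b"
    and inc: "\<And>n k. k < N * 2^n \<Longrightarrow> \<bar>b (real (Suc k) / 2^n) - b (real k / 2^n)\<bar> \<le> H * dyq^n"
    and H: "0 \<le> H" and st: "0 \<le> s" "s \<le> t" "t \<le> real N"
  shows "\<bar>b t - b s\<bar> \<le> (18 + real N) * H * (t - s) powr (1/3)"
proof -
  \<comment> \<open>\<open>g x n\<close> numbers the grid point of level \<open>n\<close> just below
    \<open>x\<close>. From one level to the next this point either stays or moves one step of the
    finer grid, and such a step is controlled by \<open>inc\<close>.\<close>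
  define g where "g x n = nat \<lfloor>2^n * x\<rfloor>" for x :: real and n
  have g: "real (g x n) \<le> 2^n * x" "2^n * x < real (g x n) + 1" if "0 \<le> x" for x n
  proof -
    have "0 \<le> \<lfloor>2^n * x\<rfloor>" using that by simp
    then have "real (g x n) = of_int \<lfloor>2^n * x\<rfloor>" by (simp add: g_def)
    then show "real (g x n) \<le> 2^n * x" "2^n * x < real (g x n) + 1" by linarith+
  qed
  have step: "\<bar>b (real (g x (Suc n)) / 2^Suc n) - b (real (g x n) / 2^n)\<bar> \<le> H * dyq^Suc n"
    if x: "0 \<le> x" "x \<le> real N" for x n
  proof -
    have "real (2 * g x n) < real (g x (Suc n)) + 1" using g[OF x(1), of n] g[OF x(1), of "Suc n"] by simp
    moreover have "real (g x (Suc n)) < real (2 * g x n) + 2" using g[OF x(1), of n] g[OF x(1), of "Suc n"] by simp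
    ultimately have "g x (Suc n) = 2 * g x n \<or> g x (Suc n) = Suc (2 * g x n)" by linarith
    then show ?thesis
    proof
      assume "g x (Suc n) = 2 * g x n"
      then show ?thesis using H dyq(1) by simp
    next
      assume e: "g x (Suc n) = Suc (2 * g x n)"
      have "real (g x (Suc n)) \<le> 2^Suc n * real N"
        by (rule order_trans[OF g(1)[OF x(1)]]) (use x in simp)
      then have "real (Suc (2 * g x n)) \<le> real (N * 2^Suc n)" unfolding e by (simp add: mult.commute)
      then have "2 * g x n < N * 2^Suc n" unfolding of_nat_le_iff by linarith
      from inc[OF this] show ?thesis unfolding e by simp
    qed
  qed
  have approx: "\<bar>b x - b (real (g x n) / 2^n)\<bar> \<le> 4 * H * dyq^n" if x: "0 \<le> x" "x \<le> real N" for x n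
  proof -
    have fin: "\<bar>b (real (g x (n+m)) / 2^(n+m)) - b (real (g x n) / 2^n)\<bar> \<le> H * dyq^n * (\<Sum>i<m. dyq^Suc i)" for m
    proof (induction m)
      case (Suc m)
      have "\<bar>b (real (g x (n+Suc m)) / 2^(n+Suc m)) - b (real (g x n) / 2^n)\<bar> \<le>
        \<bar>b (real (g x (Suc (n+m))) / 2^Suc (n+m)) - b (real (g x (n+m)) / 2^(n+m))\<bar> +
        \<bar>b (real (g x (n+m)) / 2^(n+m)) - b (real (g x n) / 2^n)\<bar>" by simp
      also have "\<dots> \<le> H * dyq^Suc (n+m) + H * dyq^n * (\<Sum>i<m. dyq^Suc i)"
        using step[OF x, of "n+m"] Suc.IH by linarith
      also have "\<dots> = H * dyq^n * (\<Sum>i<Suc m. dyq^Suc i)" by (simp add: power_add algebra_simps)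
      finally show ?case .
    qed simp
    have fin': "\<bar>b (real (g x (n+m)) / 2^(n+m)) - b (real (g x n) / 2^n)\<bar> \<le> 4 * H * dyq^n" for m
    proof -
      have "H * dyq^n * (\<Sum>i<m. dyq^Suc i) \<le> H * dyq^n * 4"
        using H dyq(1) by (intro mult_left_mono dyq_geometric) auto
      with fin[of m] show ?thesis by (simp add: ac_simps)
    qed
    have lim: "(\<lambda>m. real (g x m) / 2^m) \<longlonglongrightarrow> x"
    proof (rule tendsto_sandwich[where f="\<lambda>m. x - (1/2)^m" and h="\<lambda>m. x"])
      show "\<forall>\<^sub>F m in sequentially. x - (1/2)^m \<le> real (g x m) / 2^m"
      proof (intro always_eventually allI)
        fix m
        have "x \<le> (real (g x m) + 1) / 2^m" using g(2)[OF x(1), of m] by (simp add: field_simps)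
        then show "x - (1/2)^m \<le> real (g x m) / 2^m" by (simp add: add_divide_distrib power_divide)
      qed
      show "\<forall>\<^sub>F m in sequentially. real (g x m) / 2^m \<le> x"
        using g(1)[OF x(1)] by (intro always_eventually allI) (simp add: field_simps)
      have "(\<lambda>m. x - (1/2)^m) \<longlonglongrightarrow> x - 0" by (intro tendsto_intros LIMSEQ_realpow_zero) auto
      then show "(\<lambda>m. x - (1/2)^m) \<longlonglongrightarrow> x" by simp
    qed simp
    have "(\<lambda>m. b (real (g x m) / 2^m)) \<longlonglongrightarrow> b x"
      by (rule continuous_on_tendsto_compose[OF cont lim]) (use x in auto)
    then have "(\<lambda>m. b (real (g x (m+n)) / 2^(m+n))) \<longlonglongrightarrow> b x" by (rule LIMSEQ_ignore_initial_segment)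
    then have "(\<lambda>m. \<bar>b (real (g x (n+m)) / 2^(n+m)) - b (real (g x n) / 2^n)\<bar>) \<longlonglongrightarrow> \<bar>b x - b (real (g x n) / 2^n)\<bar>"
      by (intro tendsto_intros) (simp add: add.commute)
    then show ?thesis by (rule LIMSEQ_le_const2) (use fin' in auto)
  qed
  show ?thesis
  proof (cases "t - s \<le> 0")
    case True then show ?thesis using st by simp
  next
    case pos: False
    show ?thesis
    proof (cases "t - s \<le> 1")
      case False
      \<comment> \<open>For distant times the path is followed through the integer points in
        between. There are at most \<open>N\<close> unit increments, the origin of the summand
        \<open>N\<close> in the constant.\<close>
      have mono: "\<bar>b (real (k + m)) - b (real k)\<bar> \<le> real m * H" if "k + m \<le> N" for k m
        using that
      proof (induction m)
        case (Suc m)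
        have "\<bar>b (real (k + Suc m)) - b (real (k + m))\<bar> \<le> H"
          using inc[of "k+m" 0] Suc.prems by simp
        with Suc show ?case by (simp add: algebra_simps)
      qed simp
      have "\<lfloor>s\<rfloor> \<le> \<lfloor>t\<rfloor>" "\<lfloor>t\<rfloor> \<le> int N" using st floor_mono[of s t] floor_mono[of t "real N"] by auto
      then have "g s 0 \<le> g t 0" "g t 0 \<le> N" unfolding g_def by auto
      then have "\<bar>b (real (g t 0)) - b (real (g s 0))\<bar> \<le> real (g t 0 - g s 0) * H"
        using mono[of "g s 0" "g t 0 - g s 0"] by simp
      also have "\<dots> \<le> real N * H" using \<open>g t 0 \<le> N\<close> H by (intro mult_right_mono) auto
      finally have "\<bar>b t - b s\<bar> \<le> (18 + real N) * H"
        using approx[of t 0] approx[of s 0] st H by (simp add: algebra_simps)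
      also have "\<dots> \<le> (18 + real N) * H * (t - s) powr (1/3)"
      proof -
        have "1 \<le> (t - s) powr (1/3)" using False by (intro ge_one_powr_ge_zero) auto
        then show ?thesis using mult_left_mono[of 1 "(t - s) powr (1/3)" "(18 + real N) * H"] H by simp
      qed
      finally show ?thesis .
    next
      case True
      define d where "d = t - s"
      have d: "0 < d" "d \<le> 1" using True pos by (auto simp: d_def)
      obtain m where m: "(1/2::real)^m < d" using real_arch_pow_inv[of d "1/2"] d by auto
      \<comment> \<open>The predecessor \<open>k\<close> of \<open>n\<close> satisfies
        \<open>d \<le> (1/2)^k < 2 * d\<close>, so at level \<open>k\<close> the grid points of
        \<open>s\<close> and \<open>t\<close> coincide or are neighbours. The constant 18 is
        \<open>2 * (4 + 4 + 1)\<close>: two approximations and one grid step, doubled when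
        \<open>dyq^k\<close> is compared with the power of \<open>d\<close>.\<close>
      define n where "n = (LEAST m. (1/2::real)^m < d)"
      have n1: "(1/2::real)^n < d" unfolding n_def by (rule LeastI[of _ m]) (rule m)
      have "n \<noteq> 0" using n1 d by (cases n) auto
      then obtain k where k: "n = Suc k" by (cases n) auto
      have dk: "d \<le> (1/2)^k" using not_less_Least[of k "\<lambda>m. (1/2::real)^m < d"] k unfolding n_def[symmetric] by auto
      have kd: "(1/2)^k < 2 * d" using n1 unfolding k by simp
      have t0: "0 \<le> t" "s \<le> real N" using st by auto
      have "2^k * t \<le> 2^k * s + 1"
      proof -
        have "2^k * d \<le> 2^k * (1/2)^k" using dk by (intro mult_left_mono) auto
        then show ?thesis by (simp add: d_def power_mult_distrib[symmetric] algebra_simps)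
      qed
      then have "real (g t k) < real (g s k) + 2" using g[OF st(1), of k] g[OF t0(1), of k] by linarith
      moreover have "2^k * s \<le> 2^k * t" using st by simp
      then have "real (g s k) < real (g t k) + 1" using g[OF st(1), of k] g[OF t0(1), of k] by linarith
      ultimately have "g t k = g s k \<or> g t k = Suc (g s k)" by linarith
      then have "\<bar>b (real (g t k) / 2^k) - b (real (g s k) / 2^k)\<bar> \<le> H * dyq^k"
      proof
        assume e: "g t k = Suc (g s k)"
        have "real (g t k) \<le> 2^k * real N"
          by (rule order_trans[OF g(1)[OF t0(1)]]) (use st in simp)
        then have "real (Suc (g s k)) \<le> real (N * 2^k)" unfolding e by (simp add: mult.commute)
        then have "g s k < N * 2^k" unfolding of_nat_le_iff by linarith
        from inc[OF this] show ?thesis unfolding e .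
      qed (use H dyq(1) in simp)
      then have "\<bar>b t - b s\<bar> \<le> 9 * H * dyq^k"
        using approx[OF t0(1) st(3), of k] approx[OF st(1) t0(2), of k] by linarith
      also have "dyq^k \<le> 2 * d powr (1/3)"
      proof -
        have "dyq^k = ((1/2)^k) powr (1/3)"
        proof -
          have "((1/2)^k) powr (1/3) = ((dyq^k)^3) powr (1/3)" using dyq(3) by (metis power_commutes power_mult mult.commute)
          also have "\<dots> = ((dyq^k) powr 3) powr (1/3)" using dyq(1) by simp
          also have "\<dots> = dyq^k" using dyq(1) by (simp only: powr_powr) simp
          finally show ?thesis by simp
        qed
        also have "\<dots> \<le> (2 * d) powr (1/3)" using kd by (intro powr_mono2) auto
        also have "\<dots> = 2 powr (1/3) * d powr (1/3)" using d by (simp add: powr_mult)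
        also have "\<dots> \<le> 2 powr 1 * d powr (1/3)" by (intro mult_right_mono powr_mono) auto
        finally show ?thesis by simp
      qed
      then have "9 * H * dyq^k \<le> 9 * H * (2 * d powr (1/3))" using H by (intro mult_left_mono) auto
      also have "\<dots> \<le> (18 + real N) * H * d powr (1/3)" using H by (simp add: algebra_simps)
      finally show ?thesis unfolding d_def .
    qed
  qed
qed

text \<open>Half of an exponential weight can absorb the fractional power of the Hoelder modulus,
  which leaves an elementary integral in place of a Gamma function.\<close>

lemma powr_third_le_exp: fixes y :: real assumes "0 \<le> y" shows "y powr (1/3) \<le> 2 * exp (y / 2)"
proof -
  have "y powr (1/3) \<le> 1 + y"
  proof (cases "y \<le> 1")
    case True
    then have "y powr (1/3) \<le> 1 powr (1/3)" using assms by (intro powr_mono2) auto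
    then show ?thesis using assms by simp
  next
    case False
    then have "y powr (1/3) \<le> y powr 1" by (intro powr_mono) auto
    then show ?thesis using False by simp
  qed
  also have "\<dots> \<le> 2 * (1 + y / 2)" using assms by simp
  also have "\<dots> \<le> 2 * exp (y / 2)" by (intro mult_left_mono exp_ge_add_one_self) auto
  finally show ?thesis .
qed

lemma set_integral_exp:
  fixes \<mu> t :: real assumes "0 \<le> t" "\<mu> \<noteq> 0"
  shows "set_lebesgue_integral lborel {0..t} (\<lambda>s. exp (- \<mu> * (t - s))) = (1 - exp (- \<mu> * t)) / \<mu>"
proof -
  have "(\<integral>s. exp (- \<mu> * (t - s)) * indicator {0..t} s \<partial>lborel) = exp (- \<mu> * (t - t)) / \<mu> - exp (- \<mu> * (t - 0)) / \<mu>"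
    by (rule integral_FTC_Icc_real[where F="\<lambda>s. exp (- \<mu> * (t - s)) / \<mu>"])
       (use assms in \<open>auto intro!: derivative_eq_intros continuous_intros\<close>)
  then show ?thesis by (simp add: set_lebesgue_integral_def diff_divide_distrib mult.commute)
qed

text \<open>Subtracting \<open>b t\<close> inside the integral turns Hoelder continuity of the path into decay in \<open>\<mu>\<close>.\<close>

lemma wiener_conv_bound:
  assumes cont: "continuous_on {0..} (\<lambda>t. b t \<omega>)" and b0: "b 0 \<omega> = 0" and K: "0 \<le> K" and mu: "\<mu> > 0"
    and hol: "\<And>s. 0 \<le> s \<Longrightarrow> s \<le> t \<Longrightarrow> \<bar>b t \<omega> - b s \<omega>\<bar> \<le> K * (t - s) powr (1/3)"
    and t: "0 \<le> t"
  shows "\<bar>wiener_conv \<mu> b t \<omega>\<bar> \<le> 6 * K * \<mu> powr (-1/3)"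
proof -
  let ?I = "set_lebesgue_integral lborel {0..t}"
  have int: "set_integrable lborel {0..t} f" if "continuous_on {0..t} f" for f :: "real \<Rightarrow> real"
    by (rule borel_integrable_atLeastAtMost'[OF that])
  have cb: "continuous_on {0..t} (\<lambda>s. b s \<omega>)" using cont by (rule continuous_on_subset) auto
  have e: "?I (\<lambda>s. exp (- \<mu> * (t - s))) = (1 - exp (- \<mu> * t)) / \<mu>" using t mu by (intro set_integral_exp) auto
  have "?I (\<lambda>s. exp (- \<mu> * (t - s)) * (b t \<omega> - b s \<omega>)) =
     ?I (\<lambda>s. exp (- \<mu> * (t - s)) * b t \<omega>) - ?I (\<lambda>s. exp (- \<mu> * (t - s)) * b s \<omega>)"
    unfolding right_diff_distrib
    by (intro set_integral_diff int continuous_intros cb)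
  also have "?I (\<lambda>s. exp (- \<mu> * (t - s)) * b t \<omega>) = (1 - exp (- \<mu> * t)) / \<mu> * b t \<omega>"
    using e by simp
  finally have W: "wiener_conv \<mu> b t \<omega> = exp (- \<mu> * t) * b t \<omega> + \<mu> * ?I (\<lambda>s. exp (- \<mu> * (t - s)) * (b t \<omega> - b s \<omega>))"
    unfolding wiener_conv_def using mu by (simp add: field_simps)
  \<comment> \<open>Rescaling by \<open>\<mu>\<close> extracts the decay
    \<open>\<mu> powr (-1/3)\<close>; the price is half of the exponential rate.\<close>
  have scale: "r powr (1/3) \<le> \<mu> powr (-1/3) * (2 * exp (\<mu> * r / 2))" if "0 \<le> r" for r
  proof -
    have "r powr (1/3) = \<mu> powr (-1/3) * (\<mu> * r) powr (1/3)"
      using mu that by (simp add: powr_mult powr_minus field_simps)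
    also have "\<dots> \<le> \<mu> powr (-1/3) * (2 * exp (\<mu> * r / 2))"
      using mu that by (intro mult_left_mono powr_third_le_exp) auto
    finally show ?thesis .
  qed
  have 1: "\<bar>exp (- \<mu> * t) * b t \<omega>\<bar> \<le> 2 * K * \<mu> powr (-1/3)"
  proof -
    have "\<bar>b t \<omega>\<bar> \<le> K * t powr (1/3)" using hol[of 0] t b0 by simp
    also have "\<dots> \<le> K * (\<mu> powr (-1/3) * (2 * exp (\<mu> * t / 2)))" using K scale[OF t] by (intro mult_left_mono)
    finally have "\<bar>exp (- \<mu> * t) * b t \<omega>\<bar> \<le> exp (- \<mu> * t) * (K * (\<mu> powr (-1/3) * (2 * exp (\<mu> * t / 2))))"
      by (simp add: abs_mult)
    also have "\<dots> = 2 * K * \<mu> powr (-1/3) * exp (- \<mu> * t + \<mu> * t / 2)" by (simp only: exp_add) (simp add: ac_simps)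
    also have "\<dots> \<le> 2 * K * \<mu> powr (-1/3) * 1" using mu t K by (intro mult_left_mono) auto
    finally show ?thesis by simp
  qed
  have 2: "\<bar>?I (\<lambda>s. exp (- \<mu> * (t - s)) * (b t \<omega> - b s \<omega>))\<bar> \<le> 4 * K * \<mu> powr (-1/3) / \<mu>"
  proof -
    have "norm (?I (\<lambda>s. exp (- \<mu> * (t - s)) * (b t \<omega> - b s \<omega>))) \<le> ?I (\<lambda>s. norm (exp (- \<mu> * (t - s)) * (b t \<omega> - b s \<omega>)))"
      by (intro set_integral_norm_bound int continuous_intros cb)
    also have "\<dots> \<le> ?I (\<lambda>s. 2 * K * \<mu> powr (-1/3) * exp (- (\<mu>/2) * (t - s)))"
    proof (rule set_integral_mono)
      fix s assume "s \<in> {0..t}"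
      then have s: "0 \<le> s" "s \<le> t" by auto
      have "norm (exp (- \<mu> * (t - s)) * (b t \<omega> - b s \<omega>)) \<le> exp (- \<mu> * (t - s)) * (K * (t - s) powr (1/3))"
        using hol[OF s] by (simp add: abs_mult)
      also have "\<dots> \<le> exp (- \<mu> * (t - s)) * (K * (\<mu> powr (-1/3) * (2 * exp (\<mu> * (t - s) / 2))))"
        using K s by (intro mult_left_mono scale) auto
      also have "\<dots> = 2 * K * \<mu> powr (-1/3) * exp (- \<mu> * (t - s) + \<mu> * (t - s) / 2)"
        by (simp only: exp_add) (simp add: ac_simps)
      finally show "norm (exp (- \<mu> * (t - s)) * (b t \<omega> - b s \<omega>)) \<le> 2 * K * \<mu> powr (-1/3) * exp (- (\<mu>/2) * (t - s))"
        by simp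
    qed (auto intro!: int continuous_intros cb)
    also have "\<dots> = 2 * K * \<mu> powr (-1/3) * ((1 - exp (- (\<mu>/2) * t)) / (\<mu>/2))"
      using set_integral_exp[of t "\<mu>/2"] t mu by simp
    also have "\<dots> \<le> 2 * K * \<mu> powr (-1/3) * (1 / (\<mu>/2))"
      using K mu by (intro mult_left_mono divide_right_mono) auto
    finally show ?thesis by simp
  qed
  have "\<bar>\<mu> * ?I (\<lambda>s. exp (- \<mu> * (t - s)) * (b t \<omega> - b s \<omega>))\<bar> \<le> \<mu> * (4 * K * \<mu> powr (-1/3) / \<mu>)"
    unfolding abs_mult using 2 mu by (intro mult_mono) auto
  then have "\<bar>\<mu> * ?I (\<lambda>s. exp (- \<mu> * (t - s)) * (b t \<omega> - b s \<omega>))\<bar> \<le> 4 * K * \<mu> powr (-1/3)" using mu by simp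
  with 1 show ?thesis unfolding W by linarith
qed

text \<open>A single extended nonnegative quantity that controls every dyadic increment at once, so
  that one finite expectation replaces a union bound over levels and positions.\<close>

definition dyadic_energy :: "nat \<Rightarrow> (real \<Rightarrow> real) \<Rightarrow> ennreal" where
  "dyadic_energy N b = (\<Sum>n. ennreal (1 / dyq^(8*n)) *
     (\<Sum>k<N * 2^n. ennreal ((b (real (Suc k) / 2^n) - b (real k / 2^n))^8)))"

text \<open>Level \<open>n\<close> has \<open>N * 2^n\<close> increments of eighth moment
  \<open>105 * (1/2)^(4 n)\<close>. With \<open>(1/2)^n = dyq^(3 n)\<close>, division by
  \<open>dyq^(8 n)\<close> leaves \<open>105 * N * dyq^n\<close>, a geometric series.\<close>

lemma dyadic_energy_expectation:
  assumes "std_brownian_motion M b"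
  shows "(\<lambda>\<omega>. dyadic_energy N (\<lambda>t. b t \<omega>)) \<in> borel_measurable M"
    "(\<integral>\<^sup>+\<omega>. dyadic_energy N (\<lambda>t. b t \<omega>) \<partial>M) \<le> ennreal (105 * real N / (1 - dyq))"
proof -
  have [measurable]: "b t \<in> borel_measurable M" for t using assms by (simp add: std_brownian_motion_def)
  show "(\<lambda>\<omega>. dyadic_energy N (\<lambda>t. b t \<omega>)) \<in> borel_measurable M"
    unfolding dyadic_energy_def by measurable
  have mom: "(\<integral>\<^sup>+\<omega>. ennreal ((b (real (Suc k) / 2^n) \<omega> - b (real k / 2^n) \<omega>)^8) \<partial>M) = ennreal (105 * (1 / 2^n)^4)" for k n
    by (subst brownian_eighth_moment[OF assms]) (auto simp: divide_strict_right_mono diff_divide_distrib[symmetric])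
  have "(\<integral>\<^sup>+\<omega>. dyadic_energy N (\<lambda>t. b t \<omega>) \<partial>M) =
    (\<Sum>n. ennreal (1 / dyq^(8*n)) * (\<Sum>k<N * 2^n. ennreal (105 * (1 / 2^n)^4)))"
    unfolding dyadic_energy_def
    by (subst nn_integral_suminf) (auto simp: nn_integral_cmult nn_integral_sum mom simp del: sum_ennreal of_nat_Suc)
  also have "\<dots> = (\<Sum>n. ennreal (105 * real N * dyq^n))"
  proof (rule suminf_cong)
    fix n
    have q: "(1/2::real)^n = dyq^(3*n)" unfolding power_mult dyq(3) ..
    have "(\<Sum>k<N * 2^n. ennreal (105 * (1 / 2^n)^4)) = ennreal (real (N * 2^n) * (105 * (1/2^n)^4))"
      by (subst sum_ennreal) auto
    then have "ennreal (1 / dyq^(8*n)) * (\<Sum>k<N * 2^n. ennreal (105 * (1 / 2^n)^4)) =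
       ennreal (1 / dyq^(8*n) * (real (N * 2^n) * (105 * (1/2^n)^4)))"
      using dyq(1) by (simp only:) (subst ennreal_mult[symmetric], auto)
    also have "1 / dyq^(8*n) * (real (N * 2^n) * (105 * (1/2^n)^4)) = 105 * real N * (((1/2)^n)^3 / dyq^(8*n))"
      by (simp add: field_simps power3_eq_cube power4_eq_xxxx power_divide)
    also have "((1/2)^n)^3 / dyq^(8*n) = dyq^n"
      unfolding q using dyq(1) by (simp add: power_mult[symmetric] divide_eq_eq power_add[symmetric])
    finally show "ennreal (1 / dyq^(8*n)) * (\<Sum>k<N * 2^n. ennreal (105 * (1 / 2^n)^4)) = ennreal (105 * real N * dyq^n)" .
  qed
  also have "\<dots> = ennreal (\<Sum>n. 105 * real N * dyq^n)"
    using dyq by (intro suminf_ennreal2) auto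
  also have "(\<Sum>n. 105 * real N * dyq^n) = 105 * real N / (1 - dyq)"
    using dyq by (subst suminf_mult) (auto simp: suminf_geometric)
  finally show "(\<integral>\<^sup>+\<omega>. dyadic_energy N (\<lambda>t. b t \<omega>) \<partial>M) \<le> ennreal (105 * real N / (1 - dyq))" by simp
qed

lemma dyadic_energy_increment:
  assumes "dyadic_energy N b \<le> ennreal E" "0 \<le> E" "k < N * 2^n"
  shows "\<bar>b (real (Suc k) / 2^n) - b (real k / 2^n)\<bar> \<le> E powr (1/8) * dyq^n"
proof -
  let ?d = "b (real (Suc k) / 2^n) - b (real k / 2^n)"
  have "ennreal (1 / dyq^(8*n)) * ennreal (?d^8) \<le> ennreal (1 / dyq^(8*n)) *
     (\<Sum>k<N * 2^n. ennreal ((b (real (Suc k) / 2^n) - b (real k / 2^n))^8))"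
    using assms(3) by (intro mult_left_mono member_le_sum) auto
  also have "\<dots> \<le> dyadic_energy N b"
    unfolding dyadic_energy_def
    using sum_le_suminf[of "\<lambda>n. ennreal (1 / dyq^(8*n)) * (\<Sum>k<N * 2^n. ennreal ((b (real (Suc k) / 2^n) - b (real k / 2^n))^8))" "{n}"] by simp
  also have "\<dots> \<le> ennreal E" by fact
  finally have "1 / dyq^(8*n) * ?d^8 \<le> E"
    using assms(2) dyq(1) by (subst (asm) ennreal_mult[symmetric]) auto
  then have "?d^8 \<le> E * dyq^(8*n)" using dyq(1) by (simp add: field_simps)
  then have "\<bar>?d\<bar>^8 \<le> E * dyq^(n*8)" by (simp add: mult.commute)
  also have "\<dots> = (E powr (1/8) * dyq^n)^8"
    using assms(2) dyq(1) by (cases "E = 0") (auto simp: power_mult_distrib power_mult powr_realpow[symmetric] powr_powr)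
  finally show ?thesis by (rule power_le_imp_le_base[of _ 7, simplified]) (use dyq(1) in auto)
qed

text \<open>The energies of all modes, weighted by \<open>1 / j^2\<close>, have finite total
  expectation. Almost surely the energy of mode \<open>j\<close> is therefore at most a random
  multiple of \<open>j^2\<close>, and its Hoelder constant grows at most like the power 1/4 of
  \<open>j\<close>. The rate \<open>j^4\<close> of the convolution contributes the power -4/3, and
  the total exponent -13/12 is summable.\<close>

lemma stochastic_convolution_summable:
  assumes M: "prob_space M" and bm: "\<forall>j\<ge>1. std_brownian_motion M (\<beta> j)"
  shows "AE \<omega> in M. \<exists>\<Omega>. summable \<Omega> \<and> (\<forall>j\<ge>1. \<forall>t\<in>{0..real N}. \<bar>wiener_conv ((lam j)^2) (\<beta> j) t \<omega>\<bar> \<le> \<Omega> j)"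
proof -
  define Z where "Z \<omega> = (\<Sum>i. ennreal (1 / (real (Suc i))^2) * dyadic_energy N (\<lambda>t. \<beta> (Suc i) t \<omega>))" for \<omega>
  have [measurable]: "(\<lambda>\<omega>. dyadic_energy N (\<lambda>t. \<beta> (Suc i) t \<omega>)) \<in> borel_measurable M" for i
    using bm by (intro dyadic_energy_expectation(1)) auto
  have Zm [measurable]: "Z \<in> borel_measurable M" unfolding Z_def by measurable
  have "(\<integral>\<^sup>+\<omega>. Z \<omega> \<partial>M) = (\<Sum>i. ennreal (1 / (real (Suc i))^2) * (\<integral>\<^sup>+\<omega>. dyadic_energy N (\<lambda>t. \<beta> (Suc i) t \<omega>) \<partial>M))"
    unfolding Z_def by (subst nn_integral_suminf) (auto simp: nn_integral_cmult)
  also have "\<dots> \<le> (\<Sum>i. ennreal (1 / (real (Suc i))^2 * (105 * real N / (1 - dyq))))"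
  proof (rule suminf_le)
    fix i
    have "(\<integral>\<^sup>+\<omega>. dyadic_energy N (\<lambda>t. \<beta> (Suc i) t \<omega>) \<partial>M) \<le> ennreal (105 * real N / (1 - dyq))"
      using bm by (intro dyadic_energy_expectation(2)) auto
    then show "ennreal (1 / (real (Suc i))^2) * (\<integral>\<^sup>+\<omega>. dyadic_energy N (\<lambda>t. \<beta> (Suc i) t \<omega>) \<partial>M) \<le>
       ennreal (1 / (real (Suc i))^2 * (105 * real N / (1 - dyq)))"
      using dyq by (subst ennreal_mult) (auto intro!: mult_left_mono)
  qed auto
  also have "\<dots> < \<infinity>"
  proof -
    have s: "summable (\<lambda>i. 1 / (real (Suc i))^2 * (105 * real N / (1 - dyq)))"
      using inverse_power_summable[of 2, where 'a=real]
      by (intro summable_mult2) (subst summable_Suc_iff, simp add: inverse_eq_divide)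
    show ?thesis using dyq by (subst suminf_ennreal2[OF _ s]) auto
  qed
  finally have "AE \<omega> in M. Z \<omega> \<noteq> \<infinity>" by (intro nn_integral_noteq_infinite Zm) auto
  moreover have "AE \<omega> in M. \<forall>i. \<beta> (Suc i) 0 \<omega> = 0"
    unfolding AE_all_countable using bm by (auto simp: std_brownian_motion_def)
  moreover have "AE \<omega> in M. \<forall>i. continuous_on {0..} (\<lambda>t. \<beta> (Suc i) t \<omega>)"
    unfolding AE_all_countable using bm by (auto simp: std_brownian_motion_def)
  ultimately show ?thesis
  proof eventually_elim
    case (elim \<omega>)
    define Y where "Y = enn2real (Z \<omega>)"
    have Y: "Z \<omega> = ennreal Y" "0 \<le> Y" using elim(1) by (auto simp: Y_def less_top)
    define K where "K j = (18 + real N) * (Y * (real j)^2) powr (1/8)" for j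
    define \<Omega> where "\<Omega> j = 6 * K j * ((lam j)^2) powr (-1/3)" for j
    have "\<bar>wiener_conv ((lam j)^2) (\<beta> j) t \<omega>\<bar> \<le> \<Omega> j" if j: "j \<ge> 1" and t: "t \<in> {0..real N}" for j t
    proof -
      obtain i where i: "j = Suc i" using j by (cases j) auto
      have "ennreal (1 / (real j)^2) * dyadic_energy N (\<lambda>t. \<beta> j t \<omega>) \<le> Z \<omega>"
        unfolding Z_def i using sum_le_suminf[of "\<lambda>i. ennreal (1 / (real (Suc i))^2) * dyadic_energy N (\<lambda>t. \<beta> (Suc i) t \<omega>)" "{i}"] by simp
      then have "ennreal ((real j)^2) * (ennreal (1 / (real j)^2) * dyadic_energy N (\<lambda>t. \<beta> j t \<omega>)) \<le> ennreal ((real j)^2) * Z \<omega>"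
        by (rule mult_left_mono) auto
      moreover have "ennreal ((real j)^2) * (ennreal (1 / (real j)^2) * dyadic_energy N (\<lambda>t. \<beta> j t \<omega>)) = dyadic_energy N (\<lambda>t. \<beta> j t \<omega>)"
        using j by (simp add: mult.assoc[symmetric] ennreal_mult[symmetric])
      moreover have "ennreal ((real j)^2) * Z \<omega> = ennreal (Y * (real j)^2)"
        unfolding Y(1) using Y(2) by (simp add: ennreal_mult mult.commute)
      ultimately have de: "dyadic_energy N (\<lambda>t. \<beta> j t \<omega>) \<le> ennreal (Y * (real j)^2)" by simp
      have E0: "0 \<le> Y * (real j)^2" using Y by simp
      show ?thesis
        unfolding \<Omega>_def
      proof (rule wiener_conv_bound)
        show "continuous_on {0..} (\<lambda>t. \<beta> j t \<omega>)" "\<beta> j 0 \<omega> = 0" using elim i by auto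
        show "0 \<le> K j" unfolding K_def by simp
        show "0 < (lam j)^2" using j by (simp add: lam_def)
        show "0 \<le> t" using t by simp
        fix s assume s: "0 \<le> s" "s \<le> t"
        show "\<bar>\<beta> j t \<omega> - \<beta> j s \<omega>\<bar> \<le> K j * (t - s) powr (1/3)"
          unfolding K_def
          by (rule holder_of_dyadic[where b="\<lambda>t. \<beta> j t \<omega>"])
             (use s t elim i dyadic_energy_increment[OF de E0] in auto)
      qed
    qed
    moreover have "summable \<Omega>"
    proof -
      have "\<Omega> j = 6 * (18 + real N) * Y powr (1/8) * (real j powr (-13/12))" for j
      proof (cases "j = 0")
        case False
        have 1: "(Y * (real j)^2) powr (1/8) = Y powr (1/8) * real j powr (1/4)"
        proof -
          have "((real j)^2) powr (1/8) = (real j powr 2) powr (1/8)" using False by simp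
          also have "\<dots> = real j powr (1/4)" by (simp only: powr_powr) simp
          finally show ?thesis using Y by (simp add: powr_mult)
        qed
        have "((lam j)^2) powr (-1/3) = real j powr (-4/3)"
        proof -
          have "((lam j)^2) powr (-1/3) = (real j powr 4) powr (-1/3)" using False by (simp add: lam_def)
          also have "\<dots> = real j powr (-4/3)" by (simp only: powr_powr) simp
          finally show ?thesis .
        qed
        moreover have "real j powr (1/4) * real j powr (-4/3) = real j powr (-13/12)"
          by (simp add: powr_add[symmetric])
        ultimately show ?thesis unfolding \<Omega>_def K_def 1 by (simp add: mult.assoc)
      qed (simp add: \<Omega>_def K_def)
      then show ?thesis by (subst summable_cong[of _ "\<lambda>j. 6 * (18 + real N) * Y powr (1/8) * (real j powr (-13/12))"])
          (auto intro!: summable_mult simp: summable_real_powr_iff)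
    qed
    ultimately show ?case by blast
  qed
qed

section \<open>Duhamel terms in space and time\<close>


text \<open>The multiplier of the Laplacian composed with the semigroup, with the minus sign moved
  out into the formulas that use it.\<close>

definition tker :: "nat \<Rightarrow> real \<Rightarrow> real" where
  "tker j \<tau> = lam j * exp (- ((lam j)^2 * \<tau>))"

lemma tker_nonneg: "0 \<le> tker j \<tau>" by (simp add: tker_def lam_def)

lemma tker_meas [measurable]: "tker j \<in> borel_measurable borel"
  unfolding tker_def[abs_def] by measurable

text \<open>The exponent 1/8 is a compromise. At \<open>x = j^4 * h\<close> it costs the power 1/2
  of \<open>j\<close>, after which the factor \<open>1 / j^2\<close> still leaves the summable
  exponent -3/2, and it gains a positive power of the interval length \<open>h\<close>.\<close>

lemma one_minus_exp_le: fixes x :: real assumes "0 \<le> x" shows "1 - exp (- x) \<le> x powr (1/8)"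
proof (cases "x \<le> 1")
  case True
  have "1 - exp (- x) \<le> x" using exp_ge_add_one_self[of "-x"] by argo
  also have "\<dots> \<le> x powr (1/8)"
  proof (cases "x = 0")
    case False
    then have "x powr 1 \<le> x powr (1/8)" using True assms by (intro powr_mono') auto
    then show ?thesis using assms by simp
  qed simp
  finally show ?thesis .
next
  case False
  then have "1 \<le> x powr (1/8)" by (intro ge_one_powr_ge_zero) auto
  then show ?thesis using exp_gt_zero[of "-x"] by argo
qed

definition kap :: real where "kap = (\<Sum>j. real j powr (-3/2))"

lemma summable_kap: "summable (\<lambda>j. real j powr (-3/2))"
  by (simp add: summable_real_powr_iff)

lemma kap_nonneg: "0 \<le> kap" unfolding kap_def by (intro suminf_nonneg summable_kap) simp

lemma nn_integral_tker:
  assumes "0 \<le> h"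
  shows "(\<integral>\<^sup>+\<tau>. ennreal (tker j \<tau>) * indicator {0..h} \<tau> \<partial>lborel) \<le> ennreal (h powr (1/8) * real j powr (-3/2))"
proof (cases "j = 0")
  case True then show ?thesis by (simp add: tker_def lam_def)
next
  case False
  have l: "lam j > 0" using False by (simp add: lam_def)
  have "(\<integral>\<^sup>+\<tau>. ennreal (tker j \<tau>) * indicator {0..h} \<tau> \<partial>lborel) =
     ennreal (- exp (- ((lam j)^2 * h)) / lam j - (- exp (- ((lam j)^2 * 0)) / lam j))"
    by (rule nn_integral_FTC_Icc)
       (use l assms in \<open>auto intro!: derivative_eq_intros simp: tker_def power2_eq_square\<close>)
  also have "\<dots> = ennreal ((1 - exp (- ((lam j)^2 * h))) / lam j)" by (simp add: diff_divide_distrib)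
  also have "\<dots> \<le> ennreal (((lam j)^2 * h) powr (1/8) / lam j)"
    using l assms by (intro ennreal_leI divide_right_mono one_minus_exp_le) auto
  also have "((lam j)^2 * h) powr (1/8) / lam j = h powr (1/8) * real j powr (-3/2)"
  proof -
    have "(lam j)^2 = real j powr 4" using False by (simp add: lam_def)
    then have "((lam j)^2 * h) powr (1/8) = real j powr (1/2) * h powr (1/8)"
      using assms by (simp only: powr_mult powr_powr) (simp add: powr_powr)
    moreover have "lam j = real j powr 2" using False by (simp add: lam_def)
    ultimately have "((lam j)^2 * h) powr (1/8) / lam j = h powr (1/8) * (real j powr (1/2) / real j powr 2)" by simp
    also have "real j powr (1/2) / real j powr 2 = real j powr (-3/2)" by (simp only: powr_diff[symmetric]) simp
    finally show ?thesis .
  qed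
  finally show ?thesis .
qed

text \<open>Formed in \<open>ennreal\<close>, so that it makes sense before any integrability of
  \<open>g\<close> in time is known.\<close>

definition tconv :: "(real \<Rightarrow> ennreal) \<Rightarrow> real \<Rightarrow> real \<Rightarrow> nat \<Rightarrow> ennreal" where
  "tconv g a t j = (\<integral>\<^sup>+s. ennreal (tker j (t - s)) * g s * indicator {a..t} s \<partial>lborel)"

lemma tconv_meas [measurable]:
  assumes [measurable]: "g \<in> borel_measurable borel" shows "(\<lambda>t. tconv g a t j) \<in> borel_measurable borel"
proof -
  have "(\<lambda>t. tconv g a t j) = (\<lambda>t. \<integral>\<^sup>+s. ennreal (tker j (t - s)) * g s * (indicator {a..} s * (if s \<le> t then 1 else 0)) \<partial>lborel)"
    unfolding tconv_def by (intro ext nn_integral_cong) (auto simp: indicator_def)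
  also have "\<dots> \<in> borel_measurable lborel"
    by (intro lborel.borel_measurable_nn_integral) measurable
  finally show ?thesis by simp
qed

text \<open>Young's convolution inequality in time; the factor is small on short intervals, which allows absorption.\<close>

lemma tconv_L2:
  assumes [measurable]: "g \<in> borel_measurable borel" and ab: "a \<le> b"
  shows "(\<integral>\<^sup>+t. (\<Sum>j. tconv g a t j)^2 * indicator {a..b} t \<partial>lborel) \<le>
     ennreal (kap^2 * (b - a) powr (1/4)) * (\<integral>\<^sup>+t. (g t)^2 * indicator {a..b} t \<partial>lborel)"
proof -
  define h where "h = b - a"
  have h: "0 \<le> h" using ab by (simp add: h_def)
  define kk where "kk \<tau> = (\<Sum>j. ennreal (tker j \<tau>) * indicator {0..h} \<tau>)" for \<tau>
  have kkm [measurable]: "kk \<in> borel_measurable borel" unfolding kk_def by measurable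
  define G where "G s = g s * indicator {a..b} s" for s
  have Gm [measurable]: "G \<in> borel_measurable borel" unfolding G_def by measurable
  define \<kappa> where "\<kappa> = (\<integral>\<^sup>+\<tau>. kk \<tau> \<partial>lborel)"
  have kap: "\<kappa> \<le> ennreal (h powr (1/8) * kap)"
  proof -
    have "\<kappa> = (\<Sum>j. \<integral>\<^sup>+\<tau>. ennreal (tker j \<tau>) * indicator {0..h} \<tau> \<partial>lborel)"
      unfolding \<kappa>_def kk_def by (rule nn_integral_suminf) measurable
    also have "\<dots> \<le> (\<Sum>j. ennreal (h powr (1/8) * real j powr (-3/2)))"
      by (intro suminf_le nn_integral_tker h) auto
    also have "\<dots> = ennreal (\<Sum>j. h powr (1/8) * real j powr (-3/2))"
      by (intro suminf_ennreal2 summable_mult summable_kap) auto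
    also have "(\<Sum>j. h powr (1/8) * real j powr (-3/2)) = h powr (1/8) * kap"
      unfolding kap_def by (rule suminf_mult[OF summable_kap])
    finally show ?thesis .
  qed
  have refl: "(\<integral>\<^sup>+s. kk (t - s) \<partial>lborel) = \<kappa>" for t
    unfolding \<kappa>_def using nn_integral_real_affine[of kk "-1" t] by simp
  have tran: "(\<integral>\<^sup>+t. kk (t - s) \<partial>lborel) = \<kappa>" for s
    unfolding \<kappa>_def using nn_integral_real_affine[of kk 1 "-s"] by simp
  have pt: "(\<Sum>j. tconv g a t j)^2 * indicator {a..b} t \<le> \<kappa> * (\<integral>\<^sup>+s. kk (t - s) * (G s)^2 \<partial>lborel)" for t
  proof (cases "t \<in> {a..b}")
    case True
    have "(\<Sum>j. tconv g a t j) = (\<integral>\<^sup>+s. (\<Sum>j. ennreal (tker j (t - s)) * g s * indicator {a..t} s) \<partial>lborel)"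
      unfolding tconv_def by (rule nn_integral_suminf[symmetric]) measurable
    also have "\<dots> = (\<integral>\<^sup>+s. kk (t - s) * G s \<partial>lborel)"
    proof (rule nn_integral_cong)
      fix s
      have "(\<Sum>j. ennreal (tker j (t - s)) * g s * indicator {a..t} s) = (\<Sum>j. ennreal (tker j (t - s)) * indicator {0..h} (t - s) * G s)"
        by (intro suminf_cong) (use True in \<open>auto simp: G_def h_def indicator_def\<close>)
      also have "\<dots> = kk (t - s) * G s" unfolding kk_def by simp
      finally show "(\<Sum>j. ennreal (tker j (t - s)) * g s * indicator {a..t} s) = kk (t - s) * G s" .
    qed
    \<comment> \<open>Young's inequality through Cauchy-Schwarz for the measure with density
      \<open>kk (t - s)\<close>; its mass \<open>\<kappa>\<close> is the same for all
      \<open>t\<close>.\<close>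
    also have "\<dots> = (\<integral>\<^sup>+s. 1 * G s \<partial>density lborel (\<lambda>s. kk (t - s)))"
      by (subst nn_integral_density) auto
    finally have "(\<Sum>j. tconv g a t j)^2 \<le> (\<integral>\<^sup>+s. 1^2 \<partial>density lborel (\<lambda>s. kk (t - s))) * (\<integral>\<^sup>+s. (G s)^2 \<partial>density lborel (\<lambda>s. kk (t - s)))"
      by (simp only:) (rule Cauchy_Schwarz_nn_integral, auto)
    also have "(\<integral>\<^sup>+s. 1^2 \<partial>density lborel (\<lambda>s. kk (t - s))) = \<kappa>"
      using refl by (subst nn_integral_density) auto
    also have "(\<integral>\<^sup>+s. (G s)^2 \<partial>density lborel (\<lambda>s. kk (t - s))) = (\<integral>\<^sup>+s. kk (t - s) * (G s)^2 \<partial>lborel)"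
      by (subst nn_integral_density) auto
    finally show ?thesis using True by simp
  qed simp
  have "(\<integral>\<^sup>+t. (\<Sum>j. tconv g a t j)^2 * indicator {a..b} t \<partial>lborel) \<le> (\<integral>\<^sup>+t. \<kappa> * (\<integral>\<^sup>+s. kk (t - s) * (G s)^2 \<partial>lborel) \<partial>lborel)"
    by (intro nn_integral_mono pt)
  also have "\<dots> = \<kappa> * (\<integral>\<^sup>+t. (\<integral>\<^sup>+s. kk (t - s) * (G s)^2 \<partial>lborel) \<partial>lborel)"
    by (intro nn_integral_cmult lborel.borel_measurable_nn_integral) measurable
  also have "(\<integral>\<^sup>+t. (\<integral>\<^sup>+s. kk (t - s) * (G s)^2 \<partial>lborel) \<partial>lborel) = (\<integral>\<^sup>+s. (\<integral>\<^sup>+t. kk (t - s) * (G s)^2 \<partial>lborel) \<partial>lborel)"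
    by (rule lborel_pair.Fubini') measurable
  also have "\<dots> = (\<integral>\<^sup>+s. \<kappa> * (G s)^2 \<partial>lborel)"
    by (intro nn_integral_cong) (simp add: nn_integral_multc tran)
  also have "\<dots> = \<kappa> * (\<integral>\<^sup>+s. (G s)^2 \<partial>lborel)" by (rule nn_integral_cmult) measurable
  also have "(\<integral>\<^sup>+s. (G s)^2 \<partial>lborel) = (\<integral>\<^sup>+s. (g s)^2 * indicator {a..b} s \<partial>lborel)"
    by (intro nn_integral_cong) (auto simp: G_def indicator_def)
  also have "\<kappa> * (\<kappa> * (\<integral>\<^sup>+s. (g s)^2 * indicator {a..b} s \<partial>lborel)) = (\<kappa> * \<kappa>) * (\<integral>\<^sup>+s. (g s)^2 * indicator {a..b} s \<partial>lborel)" by (simp add: mult.assoc)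
  also have "\<dots> \<le> ennreal (kap^2 * (b - a) powr (1/4)) * (\<integral>\<^sup>+s. (g s)^2 * indicator {a..b} s \<partial>lborel)"
  proof (rule mult_right_mono)
    have "\<kappa> * \<kappa> \<le> ennreal (h powr (1/8) * kap) * ennreal (h powr (1/8) * kap)" by (intro mult_mono kap) auto
    also have "\<dots> = ennreal (kap^2 * (h powr (1/8) * h powr (1/8)))"
      using kap_nonneg by (simp add: ennreal_mult[symmetric] power2_eq_square ac_simps)
    also have "h powr (1/8) * h powr (1/8) = h powr (1/4)" by (simp add: powr_add[symmetric])
    finally show "\<kappa> * \<kappa> \<le> ennreal (kap^2 * (b - a) powr (1/4))" by (simp add: h_def)
  qed simp
  finally show ?thesis .
qed

section \<open>L3 bounds through absolute coefficient sums\<close>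

definition cube_norm :: "(real \<Rightarrow> real) \<Rightarrow> ennreal" where
  "cube_norm v = (\<integral>\<^sup>+x. ennreal (\<bar>v x\<bar>^3) \<partial>lebI)"

definition cf_abs :: "(nat \<Rightarrow> real) \<Rightarrow> ennreal" where
  "cf_abs c = (\<Sum>j. ennreal \<bar>c j\<bar>)"

lemma cf_abs_finite:
  assumes "cf_abs c \<noteq> \<infinity>" shows "summable (\<lambda>j. \<bar>c j\<bar>)" "cf_abs c = ennreal (\<Sum>j. \<bar>c j\<bar>)"
proof -
  show s: "summable (\<lambda>j. \<bar>c j\<bar>)" using assms by (intro summable_suminf_not_top) (auto simp: cf_abs_def)
  then show "cf_abs c = ennreal (\<Sum>j. \<bar>c j\<bar>)" unfolding cf_abs_def by (intro suminf_ennreal2) auto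
qed

lemma cube_norm_bounded:
  assumes v: "L2fun v" and B: "AE x in lebI. \<bar>v x\<bar> \<le> B" and R: "(\<integral>x. (v x)^2 \<partial>lebI) \<le> R" and "0 \<le> B"
  shows "cube_norm v \<le> ennreal (B * R)"
proof -
  have "cube_norm v \<le> (\<integral>\<^sup>+x. ennreal (B * (v x)^2) \<partial>lebI)"
    unfolding cube_norm_def
  proof (rule nn_integral_mono_AE, use B in eventually_elim)
    case (elim x)
    have "\<bar>v x\<bar>^3 = \<bar>v x\<bar> * (v x)^2" by (simp add: power3_eq_cube power2_eq_square)
    also have "\<dots> \<le> B * (v x)^2" using elim by (intro mult_right_mono) auto
    finally show ?case by (rule ennreal_leI)
  qed
  also have "\<dots> = ennreal (\<integral>x. B * (v x)^2 \<partial>lebI)"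
    by (rule nn_integral_eq_integral) (use L2fun_sq[OF v] \<open>0 \<le> B\<close> in auto)
  also have "\<dots> \<le> ennreal (B * R)" using R \<open>0 \<le> B\<close> by (intro ennreal_leI) (simp add: mult_left_mono)
  finally show ?thesis .
qed

text \<open>Interpolation between L2 and the supremum: the L2 bound takes two of the three powers,
  so the result is linear in the coefficient sum. This is what makes Duhamel's estimate linear in
  the cubic quantity and absorption possible.\<close>

lemma cube_norm_le_cf_abs:
  assumes v: "L2fun v" and R: "(\<integral>x. (v x)^2 \<partial>lebI) \<le> R" "1 \<le> R"
  shows "cube_norm v \<le> ennreal R * cf_abs (cf v)"
proof (cases "cf_abs (cf v) = \<infinity>")
  case True then show ?thesis using R(2) by (simp add: ennreal_mult_top)
next
  case False
  note fin = cf_abs_finite[OF False]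
  have B: "AE x in lebI. \<bar>v x\<bar> \<le> (\<Sum>j. \<bar>cf v j\<bar>)"
    using AE_eq_cseries[OF v fin(1)] by eventually_elim (simp add: abs_cseries_le[OF fin(1)])
  have nn: "0 \<le> (\<Sum>j. \<bar>cf v j\<bar>)" by (intro suminf_nonneg fin) auto
  have "cube_norm v \<le> ennreal ((\<Sum>j. \<bar>cf v j\<bar>) * R)" by (rule cube_norm_bounded[OF v B R(1) nn])
  also have "\<dots> = ennreal R * cf_abs (cf v)" unfolding fin(2) using nn R(2) by (simp add: ennreal_mult mult.commute)
  finally show ?thesis .
qed

lemma integral_semi_sq:
  assumes "L2fun w" "0 < \<tau>"
  shows "(\<integral>x. (cseries (semi \<tau> (cf w)) x)^2 \<partial>lebI) \<le> (\<integral>x. (w x)^2 \<partial>lebI)"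
proof -
  have s: "summable (\<lambda>j. \<bar>semi \<tau> (cf w) j\<bar>)" using assms by (intro summable_semi)
  have 1: "(\<lambda>j. (semi \<tau> (cf w) j)^2) sums (\<integral>x. (cseries (semi \<tau> (cf w)) x)^2 \<partial>lebI)"
    using parseval[OF L2fun_cseries[OF s]] by (simp add: cf_cseries[OF s])
  have 2: "(\<lambda>j. (cf w j)^2) sums (\<integral>x. (w x)^2 \<partial>lebI)" by (rule parseval[OF assms(1)])
  have "(semi \<tau> (cf w) j)^2 \<le> (cf w j)^2" for j
  proof -
    have "\<bar>semi \<tau> (cf w) j\<bar> \<le> 1 * \<bar>cf w j\<bar>"
      unfolding semi_def abs_mult using assms(2) by (intro mult_right_mono) auto
    then show ?thesis by (simp add: abs_le_square_iff)
  qed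
  then show ?thesis using 1 2 by (rule sums_le)
qed

lemma cube_add_le: fixes x y :: real shows "\<bar>x + y\<bar>^3 \<le> 4 * \<bar>x\<bar>^3 + 4 * \<bar>y\<bar>^3"
proof -
  define a b where "a = \<bar>x\<bar>" "b = \<bar>y\<bar>"
  have ab: "0 \<le> a" "0 \<le> b" by (auto simp: a_b_def)
  have "\<bar>x + y\<bar>^3 \<le> (a + b)^3" unfolding a_b_def by (intro power_mono) auto
  also have "\<dots> \<le> 4 * a^3 + 4 * b^3"
  proof -
    have "0 \<le> 3 * ((a + b) * (a - b)^2)" using ab by simp
    then show ?thesis by (simp add: power2_eq_square power3_eq_cube algebra_simps)
  qed
  finally show ?thesis by (simp add: a_b_def)
qed

text \<open>Only the deviation from the semigroup is measured by its coefficient sum; the semigroup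
  itself stays in L3, so the bound does not blow up as \<open>\<tau>\<close> tends to 0. The factor
  \<open>16 * R\<close> is 4 from \<open>cube_add_le\<close> times the L2 bound \<open>4 * R\<close>
  of the deviation.\<close>

lemma cube_norm_semi_perturb:
  assumes v: "L2fun v" and w: "L2fun w"
    and R: "(\<integral>x. (v x)^2 \<partial>lebI) \<le> R" "(\<integral>x. (w x)^2 \<partial>lebI) \<le> R" "1 \<le> R" and tau: "0 < \<tau>" "\<tau> \<le> 1"
  shows "cube_norm v \<le> ennreal (4 * 5220^3) * cube_norm w + ennreal (16 * R) * cf_abs (\<lambda>j. cf v j - semi \<tau> (cf w) j)"
proof (cases "cf_abs (\<lambda>j. cf v j - semi \<tau> (cf w) j) = \<infinity>")
  case True then show ?thesis using R(3) by (simp add: ennreal_mult_top)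
next
  case False
  define z where "z j = cf v j - semi \<tau> (cf w) j" for j
  have fin: "summable (\<lambda>j. \<bar>z j\<bar>)" "cf_abs z = ennreal (\<Sum>j. \<bar>z j\<bar>)"
    using cf_abs_finite[OF False] unfolding z_def by auto
  have s: "summable (\<lambda>j. \<bar>semi \<tau> (cf w) j\<bar>)" using tau w by (intro summable_semi)
  define S where "S = cseries (semi \<tau> (cf w))"
  define h where "h = cseries z"
  have hS: "L2fun h" "L2fun S" unfolding h_def S_def using fin s by (auto intro: L2fun_cseries)
  have "AE x in lebI. v x - (S x + h x) = 0"
  proof (rule cf_zero_imp_AE_zero)
    show "L2fun (\<lambda>x. v x - (S x + h x))" by (intro L2fun_diff L2fun_add v hS)
    show "cf (\<lambda>x. v x - (S x + h x)) j = 0" for j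
      using hS v by (simp add: L2inner_diff_left L2inner_add_left L2fun_add L2fun_phi)
         (simp add: S_def h_def cf_cseries[OF s] cf_cseries[OF fin(1)] z_def)
  qed
  then have eq: "AE x in lebI. v x = S x + h x" by eventually_elim simp
  have nn: "0 \<le> (\<Sum>j. \<bar>z j\<bar>)" by (intro suminf_nonneg fin) auto
  have hL: "(\<integral>x. (h x)^2 \<partial>lebI) \<le> 4 * R"
  proof -
    have "(\<integral>x. (h x)^2 \<partial>lebI) = (\<integral>x. (v x - S x)^2 \<partial>lebI)"
      by (rule integral_cong_AE) (use hS v eq in \<open>auto intro!: borel_measurable_power borel_measurable_diff L2fun_meas\<close>)
    also have "\<dots> \<le> 2 * (\<integral>x. (v x - 0)^2 \<partial>lebI) + 2 * (\<integral>x. (0 - S x)^2 \<partial>lebI)"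
      by (intro integral_square_triangle v hS L2fun_const)
    also have "\<dots> \<le> 2 * R + 2 * R"
      using R integral_semi_sq[OF w tau(1)] unfolding S_def by (intro add_mono mult_left_mono) auto
    finally show ?thesis by simp
  qed
  have hc: "cube_norm h \<le> ennreal ((\<Sum>j. \<bar>z j\<bar>) * (4 * R))"
    by (rule cube_norm_bounded[OF hS(1) _ hL nn]) (simp add: h_def abs_cseries_le[OF fin(1)])
  have "cube_norm v \<le> (\<integral>\<^sup>+x. ennreal 4 * ennreal (\<bar>S x\<bar>^3) + ennreal 4 * ennreal (\<bar>h x\<bar>^3) \<partial>lebI)"
    unfolding cube_norm_def
  proof (rule nn_integral_mono_AE, use eq in eventually_elim)
    case (elim x)
    have "ennreal (\<bar>v x\<bar>^3) \<le> ennreal (4 * \<bar>S x\<bar>^3 + 4 * \<bar>h x\<bar>^3)" unfolding elim by (intro ennreal_leI cube_add_le)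
    also have "\<dots> = ennreal 4 * ennreal (\<bar>S x\<bar>^3) + ennreal 4 * ennreal (\<bar>h x\<bar>^3)" by (simp add: ennreal_mult)
    finally show ?case .
  qed
  also have "\<dots> = ennreal 4 * cube_norm S + ennreal 4 * cube_norm h"
    unfolding cube_norm_def using hS[THEN L2fun_meas] by (subst nn_integral_add) (auto simp: nn_integral_cmult)
  also have "\<dots> \<le> ennreal 4 * (ennreal (5220^3) * cube_norm w) + ennreal 4 * ennreal ((\<Sum>j. \<bar>z j\<bar>) * (4 * R))"
    using semi_L3[OF w tau] hc unfolding S_def cube_norm_def by (intro add_mono mult_left_mono) auto
  also have "\<dots> = ennreal (4 * 5220^3) * cube_norm w + ennreal (16 * R) * cf_abs z"
  proof -
    have "ennreal 4 * (ennreal (5220^3) * cube_norm w) = ennreal (4 * 5220^3) * cube_norm w"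
      unfolding mult.assoc[symmetric] by (subst ennreal_mult[symmetric]) auto
    moreover have "ennreal 4 * ennreal ((\<Sum>j. \<bar>z j\<bar>) * (4 * R)) = ennreal (16 * R) * ennreal (\<Sum>j. \<bar>z j\<bar>)"
      using nn R(3) by (subst (1 2) ennreal_mult[symmetric]) (auto simp: ac_simps)
    ultimately show ?thesis unfolding fin(2) by simp
  qed
  finally show ?thesis unfolding z_def .
qed

section \<open>Weak solutions along one path\<close>


lemma ennreal_sq_add: fixes x y :: ennreal shows "(x + y)^2 \<le> 2 * (x^2 + y^2)"
proof (cases "x = \<infinity> \<or> y = \<infinity>")
  case True then show ?thesis by (auto simp: power2_eq_square ennreal_mult_top)
next
  case False
  then obtain a b where ab: "x = ennreal a" "y = ennreal b" "0 \<le> a" "0 \<le> b" by (cases x; cases y) auto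
  have "(a + b)^2 \<le> 2 * (a^2 + b^2)" using sum_squares_bound[of a b] by (simp add: power2_sum)
  then have "ennreal ((a + b)^2) \<le> ennreal (2 * (a^2 + b^2))" by (rule ennreal_leI)
  then show ?thesis using ab by (simp add: ennreal_mult ennreal_power[symmetric] power2_eq_square)
qed

lemma ennreal_sq_add3: fixes x y z :: ennreal shows "(x + y + z)^2 \<le> 4 * (x^2 + y^2 + z^2)"
proof -
  have "(x + y + z)^2 \<le> 2 * ((x + y)^2 + z^2)" by (rule ennreal_sq_add)
  also have "\<dots> \<le> 2 * (2 * (x^2 + y^2) + 2 * z^2)"
    by (intro mult_left_mono add_mono ennreal_sq_add) (auto simp: mult_2)
  also have "\<dots> = 4 * (x^2 + y^2 + z^2)" by (simp add: distrib_left mult.assoc[symmetric])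
  finally show ?thesis .
qed

text \<open>With \<open>X\<close> infinite the inequality would carry no information. The finiteness
  premise is what forces the separate study of the times near which integrability might
  fail.\<close>

lemma ennreal_absorb:
  fixes X A :: ennreal assumes "X < \<infinity>" "X \<le> A + ennreal (1/2) * X" shows "X \<le> 2 * A"
proof (cases "A = \<infinity>")
  case False
  obtain x where x: "X = ennreal x" "0 \<le> x" using assms(1) by (cases X) auto
  obtain a where a: "A = ennreal a" "0 \<le> a" using False by (cases A) auto
  have "ennreal a + ennreal (1/2) * ennreal x = ennreal (a + 1/2 * x)"
    using x a by (subst ennreal_mult[symmetric]) (auto intro: ennreal_plus[symmetric])
  then have "ennreal x \<le> ennreal (a + 1/2 * x)" using assms(2) unfolding x(1) a(1) by (simp only:)
  then have "x \<le> a + 1/2 * x" using x a by (subst (asm) ennreal_le_iff) auto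
  then have "ennreal x \<le> ennreal (2 * a)" by (intro ennreal_leI) argo
  then show ?thesis using x a by (simp add: ennreal_mult)
qed (simp add: ennreal_mult_top)

lemma Cauchy_Schwarz_suminf_ennreal:
  fixes x y :: "nat \<Rightarrow> ennreal" shows "(\<Sum>j. x j * y j)^2 \<le> (\<Sum>j. (x j)^2) * (\<Sum>j. (y j)^2)"
  using Cauchy_Schwarz_nn_integral[of x "count_space UNIV" y] by (simp add: nn_integral_count_space_nat)

lemma integral_abs_le:
  assumes "L2fun g" shows "(\<integral>x. \<bar>g x\<bar> \<partial>lebI) \<le> sqrt (pi * (\<integral>x. (g x)^2 \<partial>lebI))"
proof (rule real_le_rsqrt)
  define m where "m = (\<integral>x. \<bar>g x\<bar> \<partial>lebI) / pi"
  have i: "integrable lebI (\<lambda>x. \<bar>g x\<bar>)" "integrable lebI (\<lambda>x. (g x)^2)"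
    using L2fun_integrable[OF assms] L2fun_sq[OF assms] by auto
  have "0 \<le> (\<integral>x. (\<bar>g x\<bar> - m)^2 \<partial>lebI)" by (intro integral_nonneg_AE) auto
  also have "\<dots> = (\<integral>x. (g x)^2 - 2 * m * \<bar>g x\<bar> + m^2 \<partial>lebI)"
    by (intro Bochner_Integration.integral_cong) (auto simp: power2_diff)
  also have "\<dots> = (\<integral>x. (g x)^2 \<partial>lebI) - 2 * m * (m * pi) + pi * m^2"
    using i by (simp add: m_def measure_lebI_space)
  finally have "pi * m^2 \<le> (\<integral>x. (g x)^2 \<partial>lebI)" by (simp add: power2_eq_square algebra_simps)
  then have "pi * (pi * m^2) \<le> pi * (\<integral>x. (g x)^2 \<partial>lebI)" by (intro mult_left_mono) auto
  then show "(\<integral>x. \<bar>g x\<bar> \<partial>lebI)^2 \<le> pi * (\<integral>x. (g x)^2 \<partial>lebI)"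
    by (simp add: m_def power2_eq_square)
qed

text \<open>Compactness of the time interval, in the form of \<open>Bolzano\<close>, because
  continuity is expressed by \<open>L2dist\<close> on representatives and not by a topology on a
  type.\<close>

lemma L2_continuous_bounded:
  fixes u :: "real \<Rightarrow> real \<Rightarrow> real"
  assumes L2: "\<And>t. 0 \<le> t \<Longrightarrow> L2fun (u t)"
    and cont: "\<And>t. 0 \<le> t \<Longrightarrow> ((\<lambda>s. L2dist (u s) (u t)) \<longlongrightarrow> 0) (at t within {0..})"
    and T: "0 \<le> T"
  shows "\<exists>R. 1 \<le> R \<and> (\<forall>t\<in>{0..T}. (\<integral>x. (u t x)^2 \<partial>lebI) \<le> R)"
proof -
  \<comment> \<open>The small intervals around a point near 0 may extend to negative times, where
    nothing is known about \<open>u\<close>; hence the intersection with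
    \<open>{0..}\<close>.\<close>
  define P where "P a b = (\<exists>R. \<forall>t\<in>{a..b} \<inter> {0..}. (\<integral>x. (u t x)^2 \<partial>lebI) \<le> R)" for a b
  have "P 0 T" using T
  proof (induction rule: Bolzano)
    case (trans a b c)
    then obtain R S where "\<forall>t\<in>{a..b} \<inter> {0..}. (\<integral>x. (u t x)^2 \<partial>lebI) \<le> R" "\<forall>t\<in>{b..c} \<inter> {0..}. (\<integral>x. (u t x)^2 \<partial>lebI) \<le> S"
      unfolding P_def by blast
    then have "\<forall>t\<in>{a..c} \<inter> {0..}. (\<integral>x. (u t x)^2 \<partial>lebI) \<le> max R S"
      by (auto simp: le_max_iff_disj)
    then show ?case unfolding P_def by blast
  next
    case (local x)
    have "\<forall>\<^sub>F s in at x within {0..}. L2dist (u s) (u x) < 1"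
      using cont[of x] local by (intro order_tendstoD(2)) auto
    then obtain d where d: "d > 0" "\<And>s. s \<in> {0..} \<Longrightarrow> s \<noteq> x \<Longrightarrow> dist s x < d \<Longrightarrow> L2dist (u s) (u x) < 1"
      unfolding eventually_at by auto
    have "P a b" if "a \<le> x" "x \<le> b" "b - a < d" for a b
      unfolding P_def
    proof (intro exI ballI)
      fix t assume t: "t \<in> {a..b} \<inter> {0..}"
      have "L2dist (u t) (u x) \<le> 1"
      proof (cases "t = x")
        case False
        then show ?thesis using d(2)[of t] t that by (intro less_imp_le d(2)) (auto simp: dist_real_def)
      qed (simp add: L2dist_lebI)
      then have 1: "(\<integral>y. (u t y - u x y)^2 \<partial>lebI) \<le> 1" unfolding L2dist_lebI by simp
      have "(\<integral>y. (u t y - 0)^2 \<partial>lebI) \<le> 2 * (\<integral>y. (u t y - u x y)^2 \<partial>lebI) + 2 * (\<integral>y. (u x y - 0)^2 \<partial>lebI)"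
        using t local by (intro integral_square_triangle L2 L2fun_const) auto
      with 1 show "(\<integral>y. (u t y)^2 \<partial>lebI) \<le> 2 + 2 * (\<integral>y. (u x y)^2 \<partial>lebI)" by simp
    qed
    then show ?case using d(1) by blast
  qed
  then obtain R where "\<forall>t\<in>{0..T} \<inter> {0..}. (\<integral>x. (u t x)^2 \<partial>lebI) \<le> R" unfolding P_def by blast
  then show ?thesis by (intro exI[of _ "max 1 R"]) (auto simp: le_max_iff_disj)
qed

text \<open>Cauchy-Schwarz over the modes separates the data from the squares
  \<open>exp (- 2 j^4 (t - a))\<close>, whose time integrals are summable in
  \<open>j \<ge> 1\<close>. Mode 0 does not decay and contributes the length of the interval, at
  most \<open>B\<close>.\<close>

lemma semi_time_L2:
  assumes "a \<le> b" "b - a \<le> B" and S: "0 \<le> S" "(\<Sum>j. ennreal ((e j)^2)) \<le> ennreal S"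
  shows "(\<integral>\<^sup>+t. (cf_abs (semi (t - a) e))^2 * indicator {a..b} t \<partial>lborel) \<le>
     ennreal (S * (\<Sum>j. if j = 0 then B else 1 / (real j)^2))"
proof -
  let ?r = "\<lambda>j::nat. if j = 0 then B else 1 / (real j)^2 :: real"
  have sr: "summable ?r"
    using inverse_power_summable[of 2, where 'a=real] by (subst summable_cong[of _ "\<lambda>j. inverse ((real j)^2)"])
      (auto simp: inverse_eq_divide eventually_sequentially intro!: exI[of _ 1])
  have pt: "(cf_abs (semi (t - a) e))^2 \<le> ennreal S * (\<Sum>j. ennreal ((exp (- ((lam j)^2 * (t - a))))^2))" for t
  proof -
    have "cf_abs (semi (t - a) e) = (\<Sum>j. ennreal \<bar>e j\<bar> * ennreal (exp (- ((lam j)^2 * (t - a)))))"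
      unfolding cf_abs_def semi_def by (simp add: abs_mult ennreal_mult mult.commute)
    then have "(cf_abs (semi (t - a) e))^2 \<le> (\<Sum>j. (ennreal \<bar>e j\<bar>)^2) * (\<Sum>j. (ennreal (exp (- ((lam j)^2 * (t - a)))))^2)"
      by (simp only: Cauchy_Schwarz_suminf_ennreal)
    also have "\<dots> \<le> ennreal S * (\<Sum>j. (ennreal (exp (- ((lam j)^2 * (t - a)))))^2)"
    proof (rule mult_right_mono)
      have "(\<Sum>j. (ennreal \<bar>e j\<bar>)^2) = (\<Sum>j. ennreal ((e j)^2))"
        by (intro suminf_cong) (simp add: ennreal_power)
      also have "\<dots> \<le> ennreal S" by (rule S)
      finally show "(\<Sum>j. (ennreal \<bar>e j\<bar>)^2) \<le> ennreal S" .
    qed simp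
    also have "(\<lambda>j. (ennreal (exp (- ((lam j)^2 * (t - a)))))^2) = (\<lambda>j. ennreal ((exp (- ((lam j)^2 * (t - a))))^2))"
      by (intro ext ennreal_power) simp
    finally show ?thesis .
  qed
  have one: "(\<integral>\<^sup>+t. ennreal ((exp (- ((lam j)^2 * (t - a))))^2) * indicator {a..b} t \<partial>lborel) \<le> ennreal (?r j)" for j
  proof (cases "j = 0")
    case True
    then show ?thesis using assms(1,2) by (simp add: lam_def ennreal_leI)
  next
    case False
    define q where "q = 2 * (lam j)^2"
    have q: "0 < q" using False by (simp add: q_def lam_def)
    have "(\<integral>\<^sup>+t. ennreal ((exp (- ((lam j)^2 * (t - a))))^2) * indicator {a..b} t \<partial>lborel) =
       (\<integral>\<^sup>+t. ennreal (exp (- (q * (t - a)))) * indicator {a..b} t \<partial>lborel)"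
      by (intro nn_integral_cong) (simp add: q_def exp_double[symmetric] algebra_simps)
    also have "\<dots> = ennreal (- exp (- (q * (b - a))) / q - (- exp (- (q * (a - a))) / q))"
      by (rule nn_integral_FTC_Icc) (use q assms(1) in \<open>auto intro!: derivative_eq_intros\<close>)
    also have "\<dots> \<le> ennreal (1 / q)" using q by (intro ennreal_leI) (simp add: field_simps)
    also have "\<dots> \<le> ennreal (1 / (real j)^2)"
    proof (intro ennreal_leI divide_left_mono)
      have "(real j)^2 * 1 \<le> (real j)^2 * (real j)^2" using False by (intro mult_left_mono) auto
      moreover have "0 \<le> (real j)^2 * (real j)^2" by simp
      moreover have "q = 2 * ((real j)^2 * (real j)^2)" by (simp add: q_def lam_def power2_eq_square)
      ultimately show "(real j)^2 \<le> q" by argo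
    qed (use q False in auto)
    finally show ?thesis using False by simp
  qed
  have "(\<integral>\<^sup>+t. (cf_abs (semi (t - a) e))^2 * indicator {a..b} t \<partial>lborel) \<le>
     (\<integral>\<^sup>+t. ennreal S * (\<Sum>j. ennreal ((exp (- ((lam j)^2 * (t - a))))^2) * indicator {a..b} t) \<partial>lborel)"
  proof (rule nn_integral_mono)
    fix t show "(cf_abs (semi (t - a) e))^2 * indicator {a..b} t \<le> ennreal S * (\<Sum>j. ennreal ((exp (- ((lam j)^2 * (t - a))))^2) * indicator {a..b} t)"
      using pt[of t] by (cases "t \<in> {a..b}") auto
  qed
  also have "\<dots> = ennreal S * (\<integral>\<^sup>+t. (\<Sum>j. ennreal ((exp (- ((lam j)^2 * (t - a))))^2) * indicator {a..b} t) \<partial>lborel)"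
    by (rule nn_integral_cmult) measurable
  also have "\<dots> = ennreal S * (\<Sum>j. \<integral>\<^sup>+t. ennreal ((exp (- ((lam j)^2 * (t - a))))^2) * indicator {a..b} t \<partial>lborel)"
    by (subst nn_integral_suminf) auto
  also have "\<dots> \<le> ennreal S * (\<Sum>j. ennreal (?r j))"
    by (intro mult_left_mono suminf_le one) auto
  also have "(\<Sum>j. ennreal (?r j)) = ennreal (\<Sum>j. ?r j)" using assms(1,2) by (intro suminf_ennreal2 sr) auto
  also have "ennreal S * ennreal (\<Sum>j. ?r j) = ennreal (S * (\<Sum>j. ?r j))"
    using S(1) sr assms(1,2) by (subst ennreal_mult) (auto intro!: suminf_nonneg)
  finally show ?thesis .
qed

text \<open>One realisation of the equation. The randomness survives only in \<open>noise\<close>,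
  which has a bound \<open>Om\<close> that is summable over the modes and uniform up to time
  \<open>T\<close>; all arguments inside the locale are deterministic.\<close>

locale ch_path =
  fixes T a0 a1 a2 a3 R :: real and u :: "real \<Rightarrow> real \<Rightarrow> real"
    and c0 :: "nat \<Rightarrow> real" and noise :: "nat \<Rightarrow> real \<Rightarrow> real" and Om :: "nat \<Rightarrow> real"
  assumes T0: "0 < T" and a0: "0 < a0" and R1: "1 \<le> R"
    and L2: "\<And>t. 0 \<le> t \<Longrightarrow> L2fun (u t)"
    and cont: "\<And>t. 0 \<le> t \<Longrightarrow> ((\<lambda>s. L2dist (u s) (u t)) \<longlongrightarrow> 0) (at t within {0..})"
    and R: "\<And>t. 0 \<le> t \<Longrightarrow> t \<le> T \<Longrightarrow> (\<integral>x. (u t x)^2 \<partial>lebI) \<le> R"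
    and fint: "\<And>t. 0 < t \<Longrightarrow> integrable lebI (\<lambda>x. cubic a0 a1 a2 a3 (u t x))"
    and Fint: "\<And>t j. 0 \<le> t \<Longrightarrow> set_integrable lborel {0..t}
          (\<lambda>s. - lam j * exp (- ((lam j)^2 * (t - s))) * L2inner (\<lambda>x. cubic a0 a1 a2 a3 (u s x)) (phi j))"
    and mild: "\<And>t j. 0 \<le> t \<Longrightarrow> cf (u t) j = exp (- ((lam j)^2 * t)) * c0 j
          + set_lebesgue_integral lborel {0..t}
              (\<lambda>s. - lam j * exp (- ((lam j)^2 * (t - s))) * L2inner (\<lambda>x. cubic a0 a1 a2 a3 (u s x)) (phi j))
          + noise j t"
    and Om: "summable Om" "\<And>j t. 0 \<le> t \<Longrightarrow> t \<le> T \<Longrightarrow> \<bar>noise j t\<bar> \<le> Om j"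
begin

definition FF :: "nat \<Rightarrow> real \<Rightarrow> real" where
  "FF j s = L2inner (\<lambda>x. cubic a0 a1 a2 a3 (u s x)) (phi j)"

text \<open>The factor 4 covers the length \<open>pi\<close> of the interval, which enters when the
  constant in \<open>1 + |x|^3\<close> is integrated.\<close>

definition Cf :: real where "Cf = 4 * (\<bar>a0\<bar> + \<bar>a1\<bar> + \<bar>a2\<bar> + \<bar>a3\<bar>)"

text \<open>The solution is unspecified at negative times; \<open>max 0 t\<close> makes \<open>pc\<close> Borel on the whole line.\<close>

definition pc :: "real \<Rightarrow> ennreal" where "pc t = cube_norm (u (max 0 t))"

definition gg :: "real \<Rightarrow> ennreal" where "gg t = ennreal Cf * (1 + pc t)"

lemma Cf_nonneg: "0 \<le> Cf" by (simp add: Cf_def)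

lemma cont_eps:
  assumes "0 \<le> t" "0 < e"
  shows "\<exists>d>0. \<forall>s\<ge>0. \<bar>s - t\<bar> < d \<longrightarrow> L2dist (u s) (u t) < e"
proof -
  have "\<forall>\<^sub>F s in at t within {0..}. L2dist (u s) (u t) < e"
    using cont[OF assms(1)] assms by (intro order_tendstoD(2)) auto
  then obtain d where d: "d > 0" "\<And>s. s \<in> {0..} \<Longrightarrow> s \<noteq> t \<Longrightarrow> dist s t < d \<Longrightarrow> L2dist (u s) (u t) < e"
    unfolding eventually_at by auto
  have "L2dist (u s) (u t) < e" if "0 \<le> s" "\<bar>s - t\<bar> < d" for s
    using d(2)[of s] that assms(2) by (cases "s = t") (auto simp: dist_real_def L2dist_lebI)
  with d(1) show ?thesis by blast
qed

text \<open>The cube truncated at height \<open>m\<close>. It is continuous in time for the L2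
  distance and increases to \<open>pc\<close>, which yields both measurability and lower
  semicontinuity of \<open>pc\<close>.\<close>

definition pm :: "nat \<Rightarrow> real \<Rightarrow> real" where
  "pm m t = (\<integral>x. (min \<bar>u (max 0 t) x\<bar> (real m))^3 \<partial>lebI)"

lemma um: "u (max 0 t) \<in> borel_measurable lebI"
  by (intro L2fun_meas L2) simp

lemma pm_integrable: "integrable lebI (\<lambda>x. (min \<bar>u (max 0 t) x\<bar> (real m))^3)"
  by (rule lebI.integrable_const_bound[of _ "(real m)^3"]) (use um[of t] in \<open>auto intro!: AE_I2 power_mono\<close>)

lemma cube_diff_le:
  fixes x y m :: real assumes "0 \<le> x" "x \<le> m" "0 \<le> y" "y \<le> m"
  shows "\<bar>x^3 - y^3\<bar> \<le> 3 * m^2 * \<bar>x - y\<bar>"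
proof -
  have "x^3 - y^3 = (x^2 + x * y + y^2) * (x - y)" by (simp add: power2_eq_square power3_eq_cube algebra_simps)
  moreover have "\<bar>x^2 + x * y + y^2\<bar> \<le> 3 * m^2"
  proof -
    have "x^2 \<le> m^2" "y^2 \<le> m^2" using assms by (auto intro: power_mono)
    moreover have "x * y \<le> m * m" using assms by (intro mult_mono) auto
    moreover have "0 \<le> x * y" using assms by simp
    moreover have "0 \<le> x^2" "0 \<le> y^2" by auto
    moreover have "m * m = m^2" by (simp add: power2_eq_square)
    ultimately show ?thesis by argo
  qed
  ultimately show ?thesis by (simp add: abs_mult mult_right_mono)
qed

lemma pm_lipschitz:
  "\<bar>pm m s - pm m t\<bar> \<le> 3 * (real m)^2 * sqrt pi * L2dist (u (max 0 s)) (u (max 0 t))"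
proof -
  let ?u = "\<lambda>t. u (max 0 t)"
  have d: "L2fun (\<lambda>x. ?u s x - ?u t x)" by (intro L2fun_diff L2) auto
  have "\<bar>pm m s - pm m t\<bar> = \<bar>\<integral>x. (min \<bar>?u s x\<bar> (real m))^3 - (min \<bar>?u t x\<bar> (real m))^3 \<partial>lebI\<bar>"
    unfolding pm_def using pm_integrable by (subst Bochner_Integration.integral_diff) auto
  also have "\<dots> \<le> (\<integral>x. \<bar>(min \<bar>?u s x\<bar> (real m))^3 - (min \<bar>?u t x\<bar> (real m))^3\<bar> \<partial>lebI)"
    by (rule integral_abs_bound)
  also have "\<dots> \<le> (\<integral>x. 3 * (real m)^2 * \<bar>?u s x - ?u t x\<bar> \<partial>lebI)"
  proof (rule integral_mono)
    fix x
    have "\<bar>(min \<bar>?u s x\<bar> (real m))^3 - (min \<bar>?u t x\<bar> (real m))^3\<bar> \<le> 3 * (real m)^2 * \<bar>min \<bar>?u s x\<bar> (real m) - min \<bar>?u t x\<bar> (real m)\<bar>"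
      by (intro cube_diff_le) auto
    also have "\<dots> \<le> 3 * (real m)^2 * \<bar>?u s x - ?u t x\<bar>"
    proof (rule mult_left_mono)
      show "\<bar>min \<bar>?u s x\<bar> (real m) - min \<bar>?u t x\<bar> (real m)\<bar> \<le> \<bar>?u s x - ?u t x\<bar>" by linarith
    qed simp
    finally show "\<bar>(min \<bar>?u s x\<bar> (real m))^3 - (min \<bar>?u t x\<bar> (real m))^3\<bar> \<le> 3 * (real m)^2 * \<bar>?u s x - ?u t x\<bar>" .
  qed (use pm_integrable L2fun_integrable[OF d] in auto)
  also have "\<dots> = 3 * (real m)^2 * (\<integral>x. \<bar>?u s x - ?u t x\<bar> \<partial>lebI)" by simp
  also have "\<dots> \<le> 3 * (real m)^2 * sqrt (pi * (\<integral>x. (?u s x - ?u t x)^2 \<partial>lebI))"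
    by (intro mult_left_mono integral_abs_le d) auto
  also have "\<dots> = 3 * (real m)^2 * sqrt pi * L2dist (u (max 0 s)) (u (max 0 t))"
    by (simp add: L2dist_lebI real_sqrt_mult)
  finally show ?thesis .
qed

lemma pm_continuous: "continuous_on UNIV (pm m)"
  unfolding continuous_on_iff
proof (intro ballI allI impI)
  fix t e :: real assume e: "0 < e"
  define k where "k = 3 * (real m)^2 * sqrt pi + 1"
  have k: "0 < k" unfolding k_def by (intro add_nonneg_pos) auto
  obtain d where d: "d > 0" "\<And>s. s \<ge> 0 \<Longrightarrow> \<bar>s - max 0 t\<bar> < d \<Longrightarrow> L2dist (u s) (u (max 0 t)) < e / k"
    using cont_eps[of "max 0 t" "e / k"] e k by auto
  have "dist (pm m s) (pm m t) < e" if "dist s t < d" for s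
  proof -
    have l: "L2dist (u (max 0 s)) (u (max 0 t)) < e / k" using that by (intro d) (auto simp: dist_real_def)
    have "\<bar>pm m s - pm m t\<bar> \<le> 3 * (real m)^2 * sqrt pi * L2dist (u (max 0 s)) (u (max 0 t))" by (rule pm_lipschitz)
    also have "\<dots> \<le> k * L2dist (u (max 0 s)) (u (max 0 t))" unfolding k_def by (intro mult_right_mono) (auto simp: L2dist_lebI)
    also have "\<dots> < k * (e / k)" using l k by (intro mult_strict_left_mono)
    finally show ?thesis using k by (simp add: dist_real_def)
  qed
  with d(1) show "\<exists>d>0. \<forall>s\<in>UNIV. dist s t < d \<longrightarrow> dist (pm m s) (pm m t) < e" by blast
qed

lemma pc_SUP: "pc t = (SUP m. ennreal (pm m t))"
proof -
  let ?v = "u (max 0 t)"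
  have pt: "ennreal (\<bar>?v x\<bar>^3) = (SUP m. ennreal ((min \<bar>?v x\<bar> (real m))^3))" for x
  proof (rule antisym)
    obtain m where "\<bar>?v x\<bar> \<le> real m" using real_arch_simple by blast
    then have "ennreal (\<bar>?v x\<bar>^3) = ennreal ((min \<bar>?v x\<bar> (real m))^3)" by simp
    also have "\<dots> \<le> (SUP m. ennreal ((min \<bar>?v x\<bar> (real m))^3))" by (rule SUP_upper) simp
    finally show "ennreal (\<bar>?v x\<bar>^3) \<le> (SUP m. ennreal ((min \<bar>?v x\<bar> (real m))^3))" .
    show "(SUP m. ennreal ((min \<bar>?v x\<bar> (real m))^3)) \<le> ennreal (\<bar>?v x\<bar>^3)"
      by (intro SUP_least ennreal_leI power_mono) auto
  qed
  have "pc t = (\<integral>\<^sup>+x. (SUP m. ennreal ((min \<bar>?v x\<bar> (real m))^3)) \<partial>lebI)"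
    unfolding pc_def cube_norm_def pt ..
  also have "\<dots> = (SUP m. \<integral>\<^sup>+x. ennreal ((min \<bar>?v x\<bar> (real m))^3) \<partial>lebI)"
    by (rule nn_integral_monotone_convergence_SUP)
       (use um[of t] in \<open>auto simp: incseq_def le_fun_def intro!: ennreal_leI power_mono min.mono\<close>)
  also have "\<dots> = (SUP m. ennreal (pm m t))"
    unfolding pm_def by (subst nn_integral_eq_integral[OF pm_integrable]) auto
  finally show ?thesis .
qed

lemma pc_meas [measurable]: "pc \<in> borel_measurable borel"
proof -
  have [measurable]: "pm m \<in> borel_measurable borel" for m
    by (rule borel_measurable_continuous_onI[OF pm_continuous])
  show ?thesis unfolding pc_SUP[abs_def] by measurable
qed

lemma gg_meas [measurable]: "gg \<in> borel_measurable borel" unfolding gg_def[abs_def] by measurable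

text \<open>Lower semicontinuity of a supremum of continuous functions. These sublevel sets are the
  closed sets of the Baire argument.\<close>

lemma closed_pc: assumes "0 \<le> c" shows "closed {t. pc t \<le> ennreal c}"
proof -
  have "{t. pc t \<le> ennreal c} = (\<Inter>m. {t. pm m t \<le> c})"
    using assms by (auto simp: pc_SUP SUP_le_iff)
  moreover have "closed {t. pm m t \<le> c}" for m
    by (rule closed_Collect_le[OF pm_continuous]) (rule continuous_on_const)
  ultimately show ?thesis by auto
qed

lemma cubic_bound: "\<bar>cubic a0 a1 a2 a3 x\<bar> \<le> (\<bar>a0\<bar> + \<bar>a1\<bar> + \<bar>a2\<bar> + \<bar>a3\<bar>) * (1 + \<bar>x\<bar>^3)"
proof -
  have x1: "\<bar>x\<bar> \<le> 1 + \<bar>x\<bar>^3" "\<bar>x\<bar>^2 \<le> 1 + \<bar>x\<bar>^3"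
  proof -
    have "\<bar>x\<bar>^k \<le> 1 + \<bar>x\<bar>^3" if "k \<le> 3" for k
    proof (cases "\<bar>x\<bar> \<le> 1")
      case True then have "\<bar>x\<bar>^k \<le> 1" by (intro power_le_one) auto
      then show ?thesis by (simp add: add_increasing2)
    next
      case False
      then have "\<bar>x\<bar>^k \<le> \<bar>x\<bar>^3" using that by (intro power_increasing) auto
      then show ?thesis by simp
    qed
    from this[of 1] this[of 2] show "\<bar>x\<bar> \<le> 1 + \<bar>x\<bar>^3" "\<bar>x\<bar>^2 \<le> 1 + \<bar>x\<bar>^3" by auto
  qed
  have "\<bar>cubic a0 a1 a2 a3 x\<bar> \<le> \<bar>a0 * x^3\<bar> + \<bar>a1 * x^2\<bar> + \<bar>a2 * x\<bar> + \<bar>a3\<bar>"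
    unfolding cubic_def by linarith
  also have "\<dots> = \<bar>a0\<bar> * \<bar>x\<bar>^3 + \<bar>a1\<bar> * \<bar>x\<bar>^2 + \<bar>a2\<bar> * \<bar>x\<bar> + \<bar>a3\<bar> * 1" by (simp add: abs_mult power_abs)
  also have "\<dots> \<le> \<bar>a0\<bar> * (1 + \<bar>x\<bar>^3) + \<bar>a1\<bar> * (1 + \<bar>x\<bar>^3) + \<bar>a2\<bar> * (1 + \<bar>x\<bar>^3) + \<bar>a3\<bar> * (1 + \<bar>x\<bar>^3)"
    using x1 by (intro add_mono mult_left_mono) auto
  finally show ?thesis by (simp add: algebra_simps)
qed

lemma nn_integral_cubic_le:
  assumes "0 \<le> s" shows "(\<integral>\<^sup>+x. ennreal \<bar>cubic a0 a1 a2 a3 (u s x)\<bar> \<partial>lebI) \<le> gg s"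
proof -
  define S where "S = \<bar>a0\<bar> + \<bar>a1\<bar> + \<bar>a2\<bar> + \<bar>a3\<bar>"
  have S: "0 \<le> S" by (simp add: S_def)
  have um': "u s \<in> borel_measurable lebI" using L2[OF assms] by (rule L2fun_meas)
  have "(\<integral>\<^sup>+x. ennreal \<bar>cubic a0 a1 a2 a3 (u s x)\<bar> \<partial>lebI) \<le> (\<integral>\<^sup>+x. ennreal S * (1 + ennreal (\<bar>u s x\<bar>^3)) \<partial>lebI)"
  proof (rule nn_integral_mono)
    fix x
    have "ennreal \<bar>cubic a0 a1 a2 a3 (u s x)\<bar> \<le> ennreal (S * (1 + \<bar>u s x\<bar>^3))"
      unfolding S_def by (intro ennreal_leI cubic_bound)
    also have "\<dots> = ennreal S * (1 + ennreal (\<bar>u s x\<bar>^3))"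
      using S by (subst ennreal_mult) auto
    finally show "ennreal \<bar>cubic a0 a1 a2 a3 (u s x)\<bar> \<le> ennreal S * (1 + ennreal (\<bar>u s x\<bar>^3))" .
  qed
  also have "\<dots> = ennreal S * (ennreal pi + pc s)"
    using um' assms by (simp add: nn_integral_cmult nn_integral_add emeasure_lebI_space pc_def cube_norm_def)
  also have "\<dots> \<le> ennreal S * (ennreal 4 * (1 + pc s))"
  proof (rule mult_left_mono)
    have "ennreal pi + pc s \<le> ennreal 4 + ennreal 4 * pc s"
    proof (intro add_mono)
      show "ennreal pi \<le> ennreal 4" using pi_less_4 by (intro ennreal_leI) simp
      have "1 * pc s \<le> ennreal 4 * pc s" by (intro mult_right_mono) auto
      then show "pc s \<le> ennreal 4 * pc s" by simp
    qed
    then show "ennreal pi + pc s \<le> ennreal 4 * (1 + pc s)" by (simp add: distrib_left)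
  qed simp
  also have "\<dots> = gg s"
  proof -
    have "ennreal S * ennreal 4 = ennreal Cf" unfolding Cf_def S_def[symmetric] using S by (subst ennreal_mult[symmetric]) (auto simp: mult.commute)
    then show ?thesis unfolding gg_def mult.assoc[symmetric] by simp
  qed
  finally show ?thesis .
qed

lemma FF_bound: assumes "0 \<le> s" shows "ennreal \<bar>FF j s\<bar> \<le> gg s"
proof (cases "integrable lebI (\<lambda>x. cubic a0 a1 a2 a3 (u s x) * phi j x)")
  case True
  have "ennreal \<bar>FF j s\<bar> \<le> (\<integral>\<^sup>+x. ennreal \<bar>cubic a0 a1 a2 a3 (u s x) * phi j x\<bar> \<partial>lebI)"
    unfolding FF_def L2inner_lebI using integral_norm_bound_ennreal[OF True] by simp
  also have "\<dots> \<le> (\<integral>\<^sup>+x. ennreal \<bar>cubic a0 a1 a2 a3 (u s x)\<bar> \<partial>lebI)"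
    by (intro nn_integral_mono ennreal_leI) (simp add: abs_mult mult_left_le abs_phi_le)
  also have "\<dots> \<le> gg s" by (rule nn_integral_cubic_le[OF assms])
  finally show ?thesis .
next
  \<comment> \<open>The integral of a non-integrable function is 0 by convention. This covers time
    0, where integrability of the nonlinearity is not assumed.\<close>
  case False
  then show ?thesis unfolding FF_def L2inner_lebI by (simp add: not_integrable_integral_eq)
qed

lemma Fint': "0 \<le> t \<Longrightarrow> set_integrable lborel {0..t} (\<lambda>s. tker j (t - s) * FF j s)"
  using set_integrable_mult_right[OF Fint[of t j], of "-1"] unfolding tker_def FF_def
  by (simp add: mult.assoc)

lemma mild': "0 \<le> t \<Longrightarrow> cf (u t) j = exp (- ((lam j)^2 * t)) * c0 j
          - set_lebesgue_integral lborel {0..t} (\<lambda>s. tker j (t - s) * FF j s) + noise j t"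
proof -
  assume "0 \<le> t"
  have "set_lebesgue_integral lborel {0..t} (\<lambda>s. - lam j * exp (- ((lam j)^2 * (t - s))) * L2inner (\<lambda>x. cubic a0 a1 a2 a3 (u s x)) (phi j))
    = set_lebesgue_integral lborel {0..t} (\<lambda>s. - 1 * (tker j (t - s) * FF j s))"
    unfolding tker_def FF_def by (simp add: mult.assoc)
  also have "\<dots> = - set_lebesgue_integral lborel {0..t} (\<lambda>s. tker j (t - s) * FF j s)"
    by (subst set_integral_mult_right) simp
  finally show ?thesis using mild[OF \<open>0 \<le> t\<close>, of j] by simp
qed

section \<open>Duhamel's formula restarted at a later time\<close>

lemma tker_shift: "tker j (t - s) = exp (- ((lam j)^2 * (t - a))) * tker j (a - s)"
  by (simp add: tker_def exp_add[symmetric] algebra_simps)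

text \<open>The semigroup law turns everything before \<open>a\<close> into the decayed coefficient
  of \<open>u a\<close>, except for the past noise, which must be subtracted again. The half-open
  interval keeps the two pieces of the integral disjoint.\<close>

lemma mild_from:
  assumes "0 \<le> a" "a \<le> t"
  shows "cf (u t) j = semi (t - a) (cf (u a)) j
     - set_lebesgue_integral lborel {a<..t} (\<lambda>s. tker j (t - s) * FF j s)
     + (noise j t - exp (- ((lam j)^2 * (t - a))) * noise j a)"
proof -
  let ?e = "exp (- ((lam j)^2 * (t - a)))"
  let ?h = "\<lambda>s. tker j (t - s) * FF j s"
  have t: "0 \<le> t" using assms by simp
  have i: "set_integrable lborel {0..t} ?h" by (rule Fint'[OF t])
  have "set_lebesgue_integral lborel {0..t} ?h = set_lebesgue_integral lborel ({0..a} \<union> {a<..t}) ?h"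
    using assms by (intro arg_cong[where f="\<lambda>A. set_lebesgue_integral lborel A ?h"]) auto
  also have "\<dots> = set_lebesgue_integral lborel {0..a} ?h + set_lebesgue_integral lborel {a<..t} ?h"
    using assms by (intro set_integral_Un set_integrable_subset[OF i]) auto
  also have "set_lebesgue_integral lborel {0..a} ?h = ?e * set_lebesgue_integral lborel {0..a} (\<lambda>s. tker j (a - s) * FF j s)"
    by (subst set_integral_mult_right[symmetric]) (simp only: tker_shift[of j t _ a] mult.assoc)
  finally have I: "set_lebesgue_integral lborel {0..t} ?h = ?e * set_lebesgue_integral lborel {0..a} (\<lambda>s. tker j (a - s) * FF j s) + set_lebesgue_integral lborel {a<..t} ?h" .
  have e: "exp (- ((lam j)^2 * t)) = ?e * exp (- ((lam j)^2 * a))" by (simp add: exp_add[symmetric] algebra_simps)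
  show ?thesis unfolding mild'[OF t] mild'[OF assms(1)] semi_def I e by (simp add: algebra_simps)
qed

lemma Om_nonneg: "0 \<le> Om j" using Om(2)[of 0 j] T0 by linarith

lemma duhamel_bound:
  assumes "0 \<le> a" "a \<le> t" "t \<le> T"
  shows "ennreal \<bar>cf (u t) j - semi (t - a) (cf (u a)) j\<bar> \<le> tconv gg a t j + ennreal (2 * Om j)"
proof -
  let ?e = "exp (- ((lam j)^2 * (t - a)))"
  let ?I = "set_lebesgue_integral lborel {a<..t} (\<lambda>s. tker j (t - s) * FF j s)"
  have "\<bar>noise j t - ?e * noise j a\<bar> \<le> Om j + 1 * Om j"
  proof -
    have "\<bar>?e * noise j a\<bar> \<le> 1 * Om j" unfolding abs_mult using assms Om(2)[of a j] by (intro mult_mono) auto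
    then show ?thesis using Om(2)[of t j] assms by linarith
  qed
  then have "\<bar>cf (u t) j - semi (t - a) (cf (u a)) j\<bar> \<le> \<bar>?I\<bar> + 2 * Om j"
    using mild_from[OF assms(1,2), of j] by linarith
  then have "ennreal \<bar>cf (u t) j - semi (t - a) (cf (u a)) j\<bar> \<le> ennreal \<bar>?I\<bar> + ennreal (2 * Om j)"
    using Om_nonneg[of j] by (subst ennreal_plus[symmetric]) (auto intro!: ennreal_leI simp del: ennreal_plus)
  also have "ennreal \<bar>?I\<bar> \<le> tconv gg a t j"
  proof -
    have i: "set_integrable lborel {a<..t} (\<lambda>s. tker j (t - s) * FF j s)"
      using assms by (intro set_integrable_subset[OF Fint'[of t]]) auto
    have "ennreal \<bar>?I\<bar> \<le> (\<integral>\<^sup>+s. ennreal \<bar>indicator {a<..t} s *\<^sub>R (tker j (t - s) * FF j s)\<bar> \<partial>lborel)"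
      unfolding set_lebesgue_integral_def using integral_norm_bound_ennreal[OF i[unfolded set_integrable_def]] by simp
    also have "\<dots> \<le> tconv gg a t j"
      unfolding tconv_def
    proof (rule nn_integral_mono)
      fix s
      show "ennreal \<bar>indicator {a<..t} s *\<^sub>R (tker j (t - s) * FF j s)\<bar> \<le> ennreal (tker j (t - s)) * gg s * indicator {a..t} s"
      proof (cases "s \<in> {a<..t}")
        case True
        then have "ennreal \<bar>FF j s\<bar> \<le> gg s" using assms by (intro FF_bound) auto
        then show ?thesis using True tker_nonneg[of j "t - s"]
          by (simp add: abs_mult ennreal_mult mult_left_mono)
      qed simp
    qed
    finally show ?thesis .
  qed
  finally show ?thesis by (simp add: add_mono)
qed

definition Om2 :: real where "Om2 = (\<Sum>j. 2 * Om j)"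

lemma Om2_nonneg: "0 \<le> Om2"
  unfolding Om2_def using Om_nonneg by (intro suminf_nonneg summable_mult Om(1)) auto

lemma duhamel_sum:
  assumes "0 \<le> a" "a \<le> t" "t \<le> T"
  shows "cf_abs (\<lambda>j. cf (u t) j - semi (t - a) (cf (u a)) j) \<le> (\<Sum>j. tconv gg a t j) + ennreal Om2"
proof -
  have "cf_abs (\<lambda>j. cf (u t) j - semi (t - a) (cf (u a)) j) \<le> (\<Sum>j. tconv gg a t j + ennreal (2 * Om j))"
    unfolding cf_abs_def by (intro suminf_le duhamel_bound assms) auto
  also have "\<dots> = (\<Sum>j. tconv gg a t j) + (\<Sum>j. ennreal (2 * Om j))" by (rule suminf_add[symmetric]) auto
  also have "(\<Sum>j. ennreal (2 * Om j)) = ennreal Om2"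
    unfolding Om2_def using Om_nonneg by (intro suminf_ennreal2 summable_mult Om(1)) auto
  finally show ?thesis .
qed

text \<open>The time integral of the squared cube, set up as a measure: infinite values are allowed,
  and countable additivity over gaps and continuity from below are available.\<close>

definition NN :: "real measure" where
  "NN = density lborel (\<lambda>t. (pc t)^2 * indicator {0..T} t)"

lemma sets_NN [simp, measurable_cong]: "sets NN = sets borel" by (simp add: NN_def)

lemma emeasure_NN: "A \<in> sets borel \<Longrightarrow> emeasure NN A = (\<integral>\<^sup>+t. (pc t)^2 * indicator {0..T} t * indicator A t \<partial>lborel)"
  unfolding NN_def by (subst emeasure_density) auto

lemma emeasure_NN_Icc:
  assumes "0 \<le> a" "b \<le> T" shows "emeasure NN {a..b} = (\<integral>\<^sup>+t. (pc t)^2 * indicator {a..b} t \<partial>lborel)"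
  by (subst emeasure_NN) (use assms in \<open>auto intro!: nn_integral_cong simp: indicator_def\<close>)

lemma gg_L2:
  assumes "0 \<le> a" "a \<le> b" "b \<le> T"
  shows "(\<integral>\<^sup>+t. (gg t)^2 * indicator {a..b} t \<partial>lborel) \<le> ennreal (2 * Cf^2) * (ennreal (b - a) + emeasure NN {a..b})"
proof -
  have pt: "(gg t)^2 \<le> ennreal (2 * Cf^2) * (1 + (pc t)^2)" for t
  proof -
    have "(gg t)^2 = ennreal (Cf^2) * (1 + pc t)^2" unfolding gg_def by (simp add: power_mult_distrib ennreal_power Cf_nonneg)
    also have "\<dots> \<le> ennreal (Cf^2) * (2 * (1^2 + (pc t)^2))" by (intro mult_left_mono ennreal_sq_add) auto
    also have "\<dots> = ennreal (2 * Cf^2) * (1 + (pc t)^2)" by (simp add: ennreal_mult mult.assoc[symmetric] mult.commute)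
    finally show ?thesis .
  qed
  have "(\<integral>\<^sup>+t. (gg t)^2 * indicator {a..b} t \<partial>lborel) \<le> (\<integral>\<^sup>+t. ennreal (2 * Cf^2) * (indicator {a..b} t + (pc t)^2 * indicator {a..b} t) \<partial>lborel)"
  proof (rule nn_integral_mono)
    fix t show "(gg t)^2 * indicator {a..b} t \<le> ennreal (2 * Cf^2) * (indicator {a..b} t + (pc t)^2 * indicator {a..b} t)"
      using pt[of t] by (cases "t \<in> {a..b}") auto
  qed
  also have "\<dots> = ennreal (2 * Cf^2) * (emeasure lborel {a..b} + (\<integral>\<^sup>+t. (pc t)^2 * indicator {a..b} t \<partial>lborel))"
    by (simp add: nn_integral_cmult nn_integral_add)
  also have "\<dots> = ennreal (2 * Cf^2) * (ennreal (b - a) + emeasure NN {a..b})"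
    using assms by (simp add: emeasure_NN_Icc)
  finally show ?thesis .
qed

lemma tconv_gg_L2:
  assumes "0 \<le> a" "a \<le> b" "b \<le> T"
  shows "(\<integral>\<^sup>+t. (\<Sum>j. tconv gg a t j)^2 * indicator {a..b} t \<partial>lborel) \<le>
     ennreal (2 * Cf^2 * kap^2 * (b - a) powr (1/4)) * (ennreal (b - a) + emeasure NN {a..b})"
proof -
  have "(\<integral>\<^sup>+t. (\<Sum>j. tconv gg a t j)^2 * indicator {a..b} t \<partial>lborel) \<le>
     ennreal (kap^2 * (b - a) powr (1/4)) * (\<integral>\<^sup>+t. (gg t)^2 * indicator {a..b} t \<partial>lborel)"
    by (rule tconv_L2) (use assms in auto)
  also have "\<dots> \<le> ennreal (kap^2 * (b - a) powr (1/4)) * (ennreal (2 * Cf^2) * (ennreal (b - a) + emeasure NN {a..b}))"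
    by (intro mult_left_mono gg_L2 assms) auto
  also have "\<dots> = ennreal (2 * Cf^2 * kap^2 * (b - a) powr (1/4)) * (ennreal (b - a) + emeasure NN {a..b})"
    unfolding mult.assoc[symmetric] by (subst ennreal_mult[symmetric]) (auto simp: ac_simps)
  finally show ?thesis .
qed

lemma semi_L2:
  assumes "0 \<le> a" "a \<le> b" "b \<le> T" "b - a \<le> 1"
  shows "(\<integral>\<^sup>+t. (cf_abs (semi (t - a) (cf (u a))))^2 * indicator {a..b} t \<partial>lborel) \<le>
     ennreal (R * (\<Sum>j. if j = 0 then 1 else 1 / (real j)^2))"
proof (rule semi_time_L2)
  have "(\<Sum>j. ennreal ((cf (u a) j)^2)) = ennreal (\<integral>x. (u a x)^2 \<partial>lebI)"
    using parseval[OF L2[OF assms(1)]] unfolding sums_iff by (subst suminf_ennreal2) auto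
  also have "\<dots> \<le> ennreal R" using R[of a] assms by (intro ennreal_leI) auto
  finally show "(\<Sum>j. ennreal ((cf (u a) j)^2)) \<le> ennreal R" .
qed (use assms R1 in auto)

end

section \<open>A Baire argument for the cubic nonlinearity\<close>


lemma exists_small_interval:
  fixes D :: real assumes "0 \<le> D" shows "\<exists>h>0. h \<le> 1 \<and> (\<forall>x. 0 \<le> x \<longrightarrow> x \<le> h \<longrightarrow> D * x powr (1/4) \<le> 1/2)"
proof -
  \<comment> \<open>Chosen so that \<open>D * k \<le> 1/2\<close>. The interval length is
    \<open>k^4\<close>, whose fourth root is \<open>k\<close>.\<close>
  define k where "k = 1 / (2 * (D + 1))"
  have k: "0 < k" "k \<le> 1" "D * k \<le> 1/2" using assms by (auto simp: k_def field_simps)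
  have "D * x powr (1/4) \<le> 1/2" if "0 \<le> x" "x \<le> k^4" for x
  proof -
    have "x powr (1/4) \<le> (k^4) powr (1/4)" using that by (intro powr_mono2) auto
    also have "\<dots> = (k powr 4) powr (1/4)" using k by simp
    also have "\<dots> = k" using k by (simp only: powr_powr) simp
    finally have "D * x powr (1/4) \<le> D * k" using assms by (intro mult_left_mono)
    then show ?thesis using k(3) by linarith
  qed
  moreover have "0 < k^4" "k^4 \<le> 1" using k by (auto intro: power_le_one)
  ultimately show ?thesis by blast
qed

lemma open_connected_bounded_real:
  fixes c :: "real set"
  assumes "open c" "connected c" "c \<noteq> {}" "c \<subseteq> {l..r}"
  shows "c = {Inf c<..<Sup c}" "Inf c \<in> closure c" "l \<le> Inf c" "Inf c < Sup c" "Sup c \<le> r"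
proof -
  have bd: "bdd_below c" "bdd_above c" using assms(4) bdd_below_mono[of "{l..r}" c] bdd_above_mono[of "{l..r}" c] by auto
  have inf: "Inf c \<notin> c"
  proof
    assume i: "Inf c \<in> c"
    then obtain e where e: "e > 0" "ball (Inf c) e \<subseteq> c" using assms(1) open_contains_ball by blast
    then have "Inf c - e/2 \<in> c" by (auto simp: dist_real_def)
    then have "Inf c \<le> Inf c - e/2" using bd by (intro cInf_lower)
    then show False using e by simp
  qed
  have sup: "Sup c \<notin> c"
  proof
    assume i: "Sup c \<in> c"
    then obtain e where e: "e > 0" "ball (Sup c) e \<subseteq> c" using assms(1) open_contains_ball by blast
    then have "Sup c + e/2 \<in> c" by (auto simp: dist_real_def)
    then have "Sup c + e/2 \<le> Sup c" using bd by (intro cSup_upper)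
    then show False using e by simp
  qed
  show "c = {Inf c<..<Sup c}"
  proof
    show "c \<subseteq> {Inf c<..<Sup c}"
    proof
      fix x assume x: "x \<in> c"
      have "Inf c \<le> x" "x \<le> Sup c" using x bd by (auto intro: cInf_lower cSup_upper)
      moreover have "Inf c \<noteq> x" "x \<noteq> Sup c" using x inf sup by auto
      ultimately show "x \<in> {Inf c<..<Sup c}" by auto
    qed
    show "{Inf c<..<Sup c} \<subseteq> c"
    proof
      fix x assume "x \<in> {Inf c<..<Sup c}"
      then obtain y z where "y \<in> c" "y < x" "z \<in> c" "x < z"
        using cInf_lessD[OF assms(3), of x] less_cSupD[OF assms(3), of x] by auto
      then show "x \<in> c" using connectedD_interval[OF assms(2), of y z x] by auto
    qed
  qed
  show "Inf c \<in> closure c" using closure_contains_Inf[OF assms(3) bd(1)] .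
  show "l \<le> Inf c" using assms(3,4) by (intro cInf_greatest) auto
  show "Sup c \<le> r" using assms(3,4) by (intro cSup_least) auto
  obtain x where "x \<in> c" using assms(3) by auto
  then show "Inf c < Sup c" using \<open>c = {Inf c<..<Sup c}\<close> by (metis greaterThanLessThan_iff less_trans)
qed

context ch_path begin

text \<open>The interval length below which the Duhamel term can be absorbed. 2048 is 2 from
  \<open>gg_L2\<close> times 1024, where \<open>1024 * R^2 = 4 * (16 * R)^2\<close> is the larger of
  the two prefactors that occur, the one in \<open>gap_bound\<close>.\<close>

definition h0 :: real where
  "h0 = (SOME h. 0 < h \<and> h \<le> 1 \<and> (\<forall>x. 0 \<le> x \<longrightarrow> x \<le> h \<longrightarrow> (2048 * R^2 * Cf^2 * kap^2) * x powr (1/4) \<le> 1/2))"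

lemma h0: "0 < h0" "h0 \<le> 1" "\<And>x. 0 \<le> x \<Longrightarrow> x \<le> h0 \<Longrightarrow> (2048 * R^2 * Cf^2 * kap^2) * x powr (1/4) \<le> 1/2"
proof -
  have "\<exists>h. 0 < h \<and> h \<le> 1 \<and> (\<forall>x. 0 \<le> x \<longrightarrow> x \<le> h \<longrightarrow> (2048 * R^2 * Cf^2 * kap^2) * x powr (1/4) \<le> 1/2)"
    using exists_small_interval[of "2048 * R^2 * Cf^2 * kap^2"] by auto
  from someI_ex[OF this] show "0 < h0" "h0 \<le> 1" "\<And>x. 0 \<le> x \<Longrightarrow> x \<le> h0 \<Longrightarrow> (2048 * R^2 * Cf^2 * kap^2) * x powr (1/4) \<le> 1/2"
    unfolding h0_def by blast+
qed

lemma tconv_small: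
  assumes ab: "0 \<le> a" "a \<le> b" "b \<le> T" "b - a \<le> h0" and c: "0 \<le> c" "c \<le> 1024 * R^2"
  shows "ennreal c * (\<integral>\<^sup>+t. (\<Sum>j. tconv gg a t j)^2 * indicator {a..b} t \<partial>lborel) \<le>
     ennreal (b - a) + ennreal (1/2) * emeasure NN {a..b}"
proof -
  let ?k = "(b - a) powr (1/4)"
  have le: "c * (2 * Cf^2 * kap^2 * ?k) \<le> 1/2"
  proof -
    have "c * (2 * Cf^2 * kap^2 * ?k) \<le> 1024 * R^2 * (2 * Cf^2 * kap^2 * ?k)" using c by (intro mult_right_mono) auto
    also have "\<dots> = (2048 * R^2 * Cf^2 * kap^2) * ?k" by simp
    also have "\<dots> \<le> 1/2" using h0(3)[of "b - a"] ab by auto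
    finally show ?thesis .
  qed
  have "ennreal c * (\<integral>\<^sup>+t. (\<Sum>j. tconv gg a t j)^2 * indicator {a..b} t \<partial>lborel) \<le>
     ennreal c * (ennreal (2 * Cf^2 * kap^2 * ?k) * (ennreal (b - a) + emeasure NN {a..b}))"
    by (intro mult_left_mono tconv_gg_L2 ab) auto
  also have "\<dots> = ennreal (c * (2 * Cf^2 * kap^2 * ?k)) * (ennreal (b - a) + emeasure NN {a..b})"
    unfolding mult.assoc[symmetric] using c by (subst ennreal_mult[symmetric]) (auto simp: mult.assoc)
  also have "\<dots> \<le> ennreal (1/2) * (ennreal (b - a) + emeasure NN {a..b})"
    using le by (intro mult_right_mono ennreal_leI) auto
  also have "\<dots> = ennreal (1/2) * ennreal (b - a) + ennreal (1/2) * emeasure NN {a..b}" by (rule distrib_left)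
  also have "\<dots> \<le> ennreal (b - a) + ennreal (1/2) * emeasure NN {a..b}"
  proof (rule add_right_mono)
    have "ennreal (1/2) * ennreal (b - a) = ennreal (1/2 * (b - a))" using ab by (intro ennreal_mult[symmetric]) auto
    also have "\<dots> \<le> ennreal (b - a)" using ab by (intro ennreal_leI) argo
    finally show "ennreal (1/2) * ennreal (b - a) \<le> ennreal (b - a)" .
  qed
  finally show ?thesis .
qed

definition Cstar :: ennreal where
  "Cstar = 2 * (ennreal (4 * R^2) * (ennreal (R * (\<Sum>j. if j = 0 then 1 else 1 / (real j)^2)) + ennreal (Om2^2)) + 1)"

lemma Cstar_finite: "Cstar < \<infinity>"
  unfolding Cstar_def by (simp add: ennreal_mult_less_top)

text \<open>Finiteness is used for absorption only; the resulting bound depends on \<open>R\<close>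
  and the noise but not on the finite value, so it survives limits of intervals. It does not shrink
  with \<open>b - a\<close>, because the semigroup started from L2 data contributes a fixed
  amount.\<close>

lemma local_bound:
  assumes ab: "0 \<le> a" "a \<le> b" "b \<le> T" "b - a \<le> h0" and fin: "emeasure NN {a..b} < \<infinity>"
  shows "emeasure NN {a..b} \<le> Cstar"
proof -
  let ?I = "\<lambda>f. \<integral>\<^sup>+t. f t * indicator {a..b} t \<partial>lborel"
  have ba: "b - a \<le> 1" using ab h0(2) by linarith
  have [measurable]: "(\<lambda>t. cf_abs (semi (t - a) (cf (u a)))) \<in> borel_measurable borel"
    unfolding cf_abs_def semi_def by measurable
  have pt: "(pc t)^2 * indicator {a..b} t \<le> ennreal (4 * R^2) * ((cf_abs (semi (t - a) (cf (u a))))^2 * indicator {a..b} t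
     + (\<Sum>j. tconv gg a t j)^2 * indicator {a..b} t + ennreal (Om2^2) * indicator {a..b} t)" for t
  proof (cases "t \<in> {a..b}")
    case True
    then have t: "0 \<le> t" "t \<le> T" "a \<le> t" using ab by auto
    have "cf_abs (cf (u t)) \<le> cf_abs (semi (t - a) (cf (u a))) + cf_abs (\<lambda>j. cf (u t) j - semi (t - a) (cf (u a)) j)"
      unfolding cf_abs_def
      by (subst suminf_add) (auto intro!: suminf_le simp: ennreal_plus[symmetric] simp del: ennreal_plus intro!: ennreal_leI)
    also have "\<dots> \<le> cf_abs (semi (t - a) (cf (u a))) + ((\<Sum>j. tconv gg a t j) + ennreal Om2)"
      using t ab by (intro add_left_mono duhamel_sum) auto
    finally have A: "cf_abs (cf (u t)) \<le> cf_abs (semi (t - a) (cf (u a))) + (\<Sum>j. tconv gg a t j) + ennreal Om2"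
      by (simp add: add.assoc)
    have "pc t \<le> ennreal R * cf_abs (cf (u t))"
      unfolding pc_def using t R[of t] L2[of t] R1 by (simp add: cube_norm_le_cf_abs)
    also have "\<dots> \<le> ennreal R * (cf_abs (semi (t - a) (cf (u a))) + (\<Sum>j. tconv gg a t j) + ennreal Om2)"
      by (intro mult_left_mono A) auto
    finally have "(pc t)^2 \<le> (ennreal R * (cf_abs (semi (t - a) (cf (u a))) + (\<Sum>j. tconv gg a t j) + ennreal Om2))^2"
      by (intro power_mono) auto
    also have "\<dots> = ennreal (R^2) * (cf_abs (semi (t - a) (cf (u a))) + (\<Sum>j. tconv gg a t j) + ennreal Om2)^2"
      using R1 by (simp add: power_mult_distrib ennreal_power)
    also have "\<dots> \<le> ennreal (R^2) * (4 * ((cf_abs (semi (t - a) (cf (u a))))^2 + (\<Sum>j. tconv gg a t j)^2 + (ennreal Om2)^2))"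
      by (intro mult_left_mono ennreal_sq_add3) auto
    also have "\<dots> = ennreal (4 * R^2) * ((cf_abs (semi (t - a) (cf (u a))))^2 + (\<Sum>j. tconv gg a t j)^2 + ennreal (Om2^2))"
    proof -
      have "ennreal (4 * R^2) = ennreal (R^2) * 4" by (simp add: ennreal_mult mult.commute)
      then show ?thesis using Om2_nonneg by (simp add: mult.assoc ennreal_power)
    qed
    finally show ?thesis using True by simp
  qed simp
  have "emeasure NN {a..b} = ?I (\<lambda>t. (pc t)^2)" using ab by (intro emeasure_NN_Icc) auto
  also have "\<dots> \<le> (\<integral>\<^sup>+t. ennreal (4 * R^2) * ((cf_abs (semi (t - a) (cf (u a))))^2 * indicator {a..b} t
     + (\<Sum>j. tconv gg a t j)^2 * indicator {a..b} t + ennreal (Om2^2) * indicator {a..b} t) \<partial>lborel)"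
    by (intro nn_integral_mono pt)
  also have "\<dots> = ennreal (4 * R^2) * (?I (\<lambda>t. (cf_abs (semi (t - a) (cf (u a))))^2) + ?I (\<lambda>t. (\<Sum>j. tconv gg a t j)^2) + ennreal (Om2^2) * ennreal (b - a))"
    using ab by (simp add: nn_integral_cmult nn_integral_add)
  also have "\<dots> = ennreal (4 * R^2) * (?I (\<lambda>t. (cf_abs (semi (t - a) (cf (u a))))^2) + ennreal (Om2^2) * ennreal (b - a)) + ennreal (4 * R^2) * ?I (\<lambda>t. (\<Sum>j. tconv gg a t j)^2)"
    by (simp add: distrib_left add_ac)
  also have "\<dots> \<le> ennreal (4 * R^2) * (ennreal (R * (\<Sum>j. if j = 0 then 1 else 1 / (real j)^2)) + ennreal (Om2^2) * 1) + (ennreal (b - a) + ennreal (1/2) * emeasure NN {a..b})"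
    using ab ba R1 by (intro add_mono mult_left_mono semi_L2 tconv_small) auto
  also have "\<dots> \<le> (ennreal (4 * R^2) * (ennreal (R * (\<Sum>j. if j = 0 then 1 else 1 / (real j)^2)) + ennreal (Om2^2)) + 1) + ennreal (1/2) * emeasure NN {a..b}"
    unfolding add.assoc[symmetric] using ba by (intro add_mono) (auto simp: ennreal_le_1)
  finally show ?thesis unfolding Cstar_def using fin by (intro ennreal_absorb) auto
qed

text \<open>A bound on \<open>pc\<close> at the left endpoint keeps the semigroup part bounded in L3
  at every time, so each term integrates to a multiple of the length. This permits summation over
  infinitely many gaps.\<close>

lemma gap_bound:
  assumes ab: "0 \<le> a" "a \<le> b" "b \<le> T" "b - a \<le> h0" and fin: "emeasure NN {a..b} < \<infinity>"
    and M: "0 \<le> M" "pc a \<le> ennreal M"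
  shows "emeasure NN {a..b} \<le> ennreal (2 * (4 * (4 * 5220^3 * M)^2 + 4 * (16 * R)^2 * Om2^2 + 1) * (b - a))"
proof -
  let ?I = "\<lambda>f. \<integral>\<^sup>+t. f t * indicator {a..b} t \<partial>lborel"
  let ?c = "4 * 5220^3 * M"
  \<comment> \<open>The semigroup estimate needs a positive elapsed time; the single point
    \<open>t = a\<close> is a null set.\<close>
  have pt: "(pc t)^2 * indicator {a..b} t \<le> ennreal (4 * ?c^2 + 4 * (16 * R)^2 * Om2^2) * indicator {a..b} t
     + ennreal (4 * (16 * R)^2) * ((\<Sum>j. tconv gg a t j)^2 * indicator {a..b} t)" if "t \<noteq> a" for t
  proof (cases "t \<in> {a..b}")
    case True
    then have t: "0 \<le> t" "t \<le> T" "a < t" using ab that by auto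
    have ta: "0 < t - a" "t - a \<le> 1" using t True ab h0(2) by auto
    have "pc t \<le> ennreal (4 * 5220^3) * pc a + ennreal (16 * R) * cf_abs (\<lambda>j. cf (u t) j - semi (t - a) (cf (u a)) j)"
      unfolding pc_def using cube_norm_semi_perturb[OF L2[OF t(1)] L2[OF ab(1)] R[OF t(1,2)] R[OF ab(1)] R1 ta] t ab by simp
    also have "\<dots> \<le> ennreal (4 * 5220^3) * ennreal M + ennreal (16 * R) * ((\<Sum>j. tconv gg a t j) + ennreal Om2)"
      using t ab M by (intro add_mono mult_left_mono duhamel_sum) auto
    also have "\<dots> = ennreal ?c + ennreal (16 * R) * (\<Sum>j. tconv gg a t j) + ennreal (16 * R * Om2)"
    proof -
      have "ennreal (4 * 5220^3) * ennreal M = ennreal ?c" using M by (intro ennreal_mult[symmetric]) auto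
      moreover have "ennreal (16 * R) * ennreal Om2 = ennreal (16 * R * Om2)" using R1 Om2_nonneg by (intro ennreal_mult[symmetric]) auto
      ultimately show ?thesis by (simp only: distrib_left add.assoc)
    qed
    finally have "(pc t)^2 \<le> (ennreal ?c + ennreal (16 * R) * (\<Sum>j. tconv gg a t j) + ennreal (16 * R * Om2))^2"
      by (intro power_mono) auto
    also have "\<dots> \<le> 4 * ((ennreal ?c)^2 + (ennreal (16 * R) * (\<Sum>j. tconv gg a t j))^2 + (ennreal (16 * R * Om2))^2)"
      by (rule ennreal_sq_add3)
    also have "\<dots> = ennreal (4 * ?c^2 + 4 * (16 * R)^2 * Om2^2) + ennreal (4 * (16 * R)^2) * (\<Sum>j. tconv gg a t j)^2"
    proof -
      have 1: "(ennreal ?c)^2 = ennreal (?c^2)" using M by (intro ennreal_power) auto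
      have 2: "(ennreal (16 * R * Om2))^2 = ennreal ((16 * R)^2 * Om2^2)"
        using R1 Om2_nonneg by (subst ennreal_power) (auto simp: power_mult_distrib)
      have 3: "(ennreal (16 * R) * (\<Sum>j. tconv gg a t j))^2 = ennreal ((16 * R)^2) * (\<Sum>j. tconv gg a t j)^2"
        using R1 by (subst power_mult_distrib, subst ennreal_power) auto
      have 4: "ennreal (4 * x) = 4 * ennreal x" if "0 \<le> x" for x using that by (simp add: ennreal_mult)
      have "ennreal (4 * ?c^2 + 4 * (16 * R)^2 * Om2^2) = 4 * ennreal (?c^2) + 4 * ennreal ((16 * R)^2 * Om2^2)"
      proof -
        have "ennreal (4 * ?c^2 + 4 * (16 * R)^2 * Om2^2) = ennreal (4 * ?c^2) + ennreal (4 * ((16 * R)^2 * Om2^2))"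
          by (simp only: mult.assoc) (rule ennreal_plus, auto)
        also have "\<dots> = 4 * ennreal (?c^2) + 4 * ennreal ((16 * R)^2 * Om2^2)"
          using 4[of "?c^2"] 4[of "(16 * R)^2 * Om2^2"] by (simp only: zero_le_power2 mult_nonneg_nonneg)
        finally show ?thesis .
      qed
      moreover have "ennreal (4 * (16 * R)^2) = 4 * ennreal ((16 * R)^2)" by (rule 4) simp
      ultimately show ?thesis unfolding 1 2 3 by (simp add: distrib_left add_ac mult.assoc)
    qed
    finally show ?thesis using True by simp
  qed simp
  have "emeasure NN {a..b} = ?I (\<lambda>t. (pc t)^2)" using ab by (intro emeasure_NN_Icc) auto
  also have "\<dots> \<le> (\<integral>\<^sup>+t. ennreal (4 * ?c^2 + 4 * (16 * R)^2 * Om2^2) * indicator {a..b} t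
     + ennreal (4 * (16 * R)^2) * ((\<Sum>j. tconv gg a t j)^2 * indicator {a..b} t) \<partial>lborel)"
  proof (rule nn_integral_mono_AE, use AE_lborel_singleton[of a] in eventually_elim)
    case (elim t)
    then show ?case by (rule pt)
  qed
  also have "\<dots> = ennreal (4 * ?c^2 + 4 * (16 * R)^2 * Om2^2) * ennreal (b - a) + ennreal (4 * (16 * R)^2) * ?I (\<lambda>t. (\<Sum>j. tconv gg a t j)^2)"
    using ab by (simp add: nn_integral_cmult nn_integral_add del: ennreal_plus)
  also have "\<dots> \<le> ennreal (4 * ?c^2 + 4 * (16 * R)^2 * Om2^2) * ennreal (b - a) + (ennreal (b - a) + ennreal (1/2) * emeasure NN {a..b})"
    using ab by (intro add_left_mono tconv_small) (auto simp: power_mult_distrib)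
  also have "\<dots> = ennreal ((4 * ?c^2 + 4 * (16 * R)^2 * Om2^2 + 1) * (b - a)) + ennreal (1/2) * emeasure NN {a..b}"
  proof -
    have "ennreal (4 * ?c^2 + 4 * (16 * R)^2 * Om2^2) * ennreal (b - a) + ennreal (b - a)
        = ennreal ((4 * ?c^2 + 4 * (16 * R)^2 * Om2^2) * (b - a) + (b - a))"
      using ab by (subst ennreal_mult[symmetric]) (auto simp del: ennreal_plus simp add: ennreal_plus[symmetric])
    then show ?thesis by (simp only: add.assoc[symmetric] distrib_right mult_1)
  qed
  finally have "emeasure NN {a..b} \<le> 2 * ennreal ((4 * ?c^2 + 4 * (16 * R)^2 * Om2^2 + 1) * (b - a))"
    using fin by (intro ennreal_absorb) auto
  also have "\<dots> = ennreal (2 * ((4 * ?c^2 + 4 * (16 * R)^2 * Om2^2 + 1) * (b - a)))"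
    using ab by (simp add: ennreal_mult)
  finally show ?thesis by (simp only: mult.assoc)
qed

section \<open>The set of times without local integrability\<close>

definition Bad :: "real set" where
  "Bad = {t\<in>{0..T}. \<forall>r>0. emeasure NN {t - r..t + r} = \<infinity>}"

lemma NN_finite_of_local:
  assumes "a \<le> b" "\<And>x. a \<le> x \<Longrightarrow> x \<le> b \<Longrightarrow> \<exists>r>0. emeasure NN {x - r..x + r} < \<infinity>"
  shows "emeasure NN {a..b} < \<infinity>"
  using assms(1)
proof (induction rule: Bolzano)
  case (trans a b c)
  have "emeasure NN {a..c} \<le> emeasure NN ({a..b} \<union> {b..c})" by (intro emeasure_mono) auto
  also have "\<dots> \<le> emeasure NN {a..b} + emeasure NN {b..c}" by (intro emeasure_subadditive) auto
  also have "\<dots> < \<infinity>" using trans by simp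
  finally show ?case .
next
  case (local x)
  then obtain r where r: "r > 0" "emeasure NN {x - r..x + r} < \<infinity>" using assms(2) by blast
  have "emeasure NN {c..d} < \<infinity>" if "c \<le> x" "x \<le> d" "d - c < r" for c d
  proof -
    have "emeasure NN {c..d} \<le> emeasure NN {x - r..x + r}" using that by (intro emeasure_mono) auto
    then show ?thesis using r(2) by (rule le_less_trans)
  qed
  then show ?case using r(1) by blast
qed

lemma closed_Bad: "closed Bad"
proof -
  define G where "G = {t. \<exists>r>0. emeasure NN {t - r..t + r} < \<infinity>}"
  have "open G"
    unfolding open_dist
  proof
    fix t assume "t \<in> G"
    then obtain r where r: "r > 0" "emeasure NN {t - r..t + r} < \<infinity>" by (auto simp: G_def)
    have "s \<in> G" if "dist s t < r / 2" for s
    proof -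
      have "emeasure NN {s - r/2..s + r/2} \<le> emeasure NN {t - r..t + r}"
      proof (rule emeasure_mono)
        have "\<bar>s - t\<bar> < r / 2" using that by (simp only: dist_real_def)
        then have "t - r \<le> s - r/2" "s + r/2 \<le> t + r" by argo+
        then show "{s - r/2..s + r/2} \<subseteq> {t - r..t + r}" by auto
      qed simp
      also have "\<dots> < \<infinity>" by (rule r)
      finally show ?thesis unfolding G_def using r(1) by (auto intro!: exI[of _ "r/2"])
    qed
    then show "\<exists>e>0. \<forall>s. dist s t < e \<longrightarrow> s \<in> G" using r(1) by (intro exI[of _ "r/2"]) auto
  qed
  moreover have "Bad = {0..T} - G" by (auto simp: Bad_def G_def less_top)
  ultimately show ?thesis by (simp add: closed_Diff)
qed

lemma NN_point: "emeasure NN {x} = 0"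
  by (subst emeasure_NN) (auto intro!: nn_integral_zero' AE_I[where N="{x}"] simp: indicator_def)

text \<open>Compact subintervals of the gap have finite mass by compactness, hence mass at most
  \<open>Cstar\<close> by \<open>local_bound\<close>. Continuity from below carries this uniform
  bound to the whole gap, and the endpoints are null.\<close>

lemma gap_finite:
  assumes ab: "0 \<le> a" "a < b" "b \<le> T" "b - a \<le> h0" and gap: "{a<..<b} \<inter> Bad = {}"
  shows "emeasure NN {a..b} \<le> Cstar"
proof -
  \<comment> \<open>The summand 3 keeps each \<open>d n\<close> at most a third of the length, so
    the inner intervals are never empty.\<close>
  define d where "d n = (b - a) / (real n + 3)" for n :: nat
  have d: "0 < d n" "d n \<le> (b - a) / 3" for n
  proof -
    show "0 < d n" using ab by (simp add: d_def)
    show "d n \<le> (b - a) / 3" unfolding d_def using ab by (intro divide_left_mono) auto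
  qed
  define A where "A n = {a + d n..b - d n}" for n
  have An: "emeasure NN (A n) \<le> Cstar" for n
  proof -
    have le: "a + d n \<le> b - d n" using d[of n] ab by argo
    have "emeasure NN {a + d n..b - d n} < \<infinity>"
    proof (rule NN_finite_of_local[OF le])
      fix x assume x: "a + d n \<le> x" "x \<le> b - d n"
      then have "x \<in> {a<..<b}" using d(1)[of n] by auto
      then have "x \<notin> Bad" "x \<in> {0..T}" using gap ab by auto
      then show "\<exists>r>0. emeasure NN {x - r..x + r} < \<infinity>" by (auto simp: Bad_def less_top)
    qed
    then show ?thesis unfolding A_def using d[of n] ab le by (intro local_bound) auto
  qed
  have incA: "incseq A"
  proof (rule incseq_SucI)
    fix n
    have "d (Suc n) \<le> d n" unfolding d_def using ab by (intro divide_left_mono) auto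
    then show "A n \<le> A (Suc n)" unfolding A_def by auto
  qed
  have un: "(\<Union>n. A n) = {a<..<b}"
  proof
    show "(\<Union>n. A n) \<subseteq> {a<..<b}" 
    proof
      fix x assume "x \<in> (\<Union>n. A n)"
      then obtain n where "x \<in> A n" by blast
      then show "x \<in> {a<..<b}" unfolding A_def using d(1)[of n] by auto
    qed
    show "{a<..<b} \<subseteq> (\<Union>n. A n)"
    proof
      fix x assume x: "x \<in> {a<..<b}"
      define m where "m = min (x - a) (b - x)"
      have m: "0 < m" using x by (simp add: m_def)
      obtain n :: nat where "(b - a) / m \<le> real n" using real_arch_simple by blast
      then have "b - a \<le> real n * m" using m by (simp add: divide_le_eq)
      also have "\<dots> \<le> (real n + 3) * m" using m by (intro mult_right_mono) auto
      finally have "d n \<le> m" unfolding d_def by (simp add: divide_le_eq mult.commute)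
      then have "x \<in> A n" unfolding A_def m_def by auto
      then show "x \<in> (\<Union>n. A n)" by blast
    qed
  qed
  have "emeasure NN {a<..<b} = (SUP n. emeasure NN (A n))"
    unfolding un[symmetric] by (rule SUP_emeasure_incseq[symmetric]) (auto simp: A_def incA[unfolded A_def])
  also have "\<dots> \<le> Cstar" using An by (intro SUP_least)
  finally have 1: "emeasure NN {a<..<b} \<le> Cstar" .
  have "emeasure NN {a..b} \<le> emeasure NN ({a<..<b} \<union> {a} \<union> {b})" by (intro emeasure_mono) auto
  also have "\<dots> \<le> emeasure NN {a<..<b} + emeasure NN {a} + emeasure NN {b}"
    by (intro order_trans[OF emeasure_subadditive] add_mono) auto
  finally show ?thesis using 1 by (simp add: NN_point)
qed

text \<open>On a portion of the bad set where the cubes are bounded by \<open>n\<close>, every complementary gap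
contributes at most a multiple of its length, because the estimate restarts from its left endpoint.\<close>

lemma portion_finite:
  assumes k: "k \<in> Bad" "k \<le> e" "e \<le> T" "e - k \<le> h0"
    and bd: "\<And>t. t \<in> Bad \<Longrightarrow> k \<le> t \<Longrightarrow> t < e \<Longrightarrow> pc t \<le> ennreal n" and n: "0 \<le> n"
  shows "emeasure NN {k..e} < \<infinity>"
proof -
  have k0: "0 \<le> k" "k \<le> T" using k(1) by (auto simp: Bad_def)
  define U where "U = {k<..<e} - Bad"
  have oU: "open U" unfolding U_def using closed_Bad by (intro open_Diff) auto
  define C2 where "C2 = 2 * (4 * (4 * 5220^3 * n)^2 + 4 * (16 * R)^2 * Om2^2 + 1)"
  have C2: "0 \<le> C2" unfolding C2_def by simp
  have comp: "emeasure NN c \<le> ennreal C2 * emeasure lborel c" if c: "c \<in> components U" for c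
  proof -
    have oc: "open c" using open_components[OF oU c] .
    have cc: "connected c" using in_components_connected[OF c] .
    have ne: "c \<noteq> {}" using in_components_nonempty[OF c] .
    have sub: "c \<subseteq> U" using in_components_subset[OF c] .
    have sub': "c \<subseteq> {k..e}" using sub unfolding U_def by auto
    note I = open_connected_bounded_real[OF oc cc ne sub']
    define \<alpha> \<gamma> where "\<alpha> = Inf c" and "\<gamma> = Sup c"
    have ceq: "c = {\<alpha><..<\<gamma>}" and ag: "\<alpha> < \<gamma>" "k \<le> \<alpha>" "\<gamma> \<le> e" using I unfolding \<alpha>_def \<gamma>_def by auto
    \<comment> \<open>A component is relatively closed in \<open>U\<close>, so its left endpoint
      would belong to it if it lay in \<open>U\<close>. The endpoint is therefore a bad time,
      possibly \<open>k\<close> itself, and \<open>pc\<close> is bounded there.\<close>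
    have "\<alpha> \<notin> U"
    proof
      assume aU: "\<alpha> \<in> U"
      have "closedin (top_of_set U) c" by (rule closedin_component[OF c])
      then obtain S where S: "closed S" "c = U \<inter> S" by (auto simp: closedin_closed)
      have "closure c \<subseteq> S" using S by (simp add: closure_minimal)
      then have "\<alpha> \<in> c" using I(2) aU S(2) unfolding \<alpha>_def by auto
      then show False unfolding ceq by simp
    qed
    then have aB: "\<alpha> \<in> Bad" using ag k(1) unfolding U_def by (cases "\<alpha> = k") auto
    have pca: "pc \<alpha> \<le> ennreal n" using aB ag by (intro bd) auto
    have bnd: "0 \<le> \<alpha>" "\<gamma> \<le> T" "\<gamma> - \<alpha> \<le> h0" using ag k k0 by auto
    have gap: "{\<alpha><..<\<gamma>} \<inter> Bad = {}" using sub unfolding ceq U_def by auto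
    have "emeasure NN {\<alpha>..\<gamma>} \<le> Cstar" using ag bnd gap by (intro gap_finite) auto
    then have fin: "emeasure NN {\<alpha>..\<gamma>} < \<infinity>" using Cstar_finite by (rule le_less_trans)
    have "emeasure NN c \<le> emeasure NN {\<alpha>..\<gamma>}" unfolding ceq by (intro emeasure_mono) auto
    also have "\<dots> \<le> ennreal (C2 * (\<gamma> - \<alpha>))"
      unfolding C2_def by (rule gap_bound) (use ag bnd fin n pca in auto)
    also have "\<dots> = ennreal C2 * emeasure lborel c" unfolding ceq using C2 ag by (simp add: ennreal_mult)
    finally show ?thesis .
  qed
  have cnt: "countable (components U)"
    by (rule countable_disjoint_open_subsets)
       (use open_components[OF oU] pairwise_disjoint_components[of U] in \<open>auto simp: disjnt_def pairwise_def\<close>)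
  have dis: "disjoint_family_on (\<lambda>c. c) (components U)"
    using pairwise_disjoint_components[of U] by (auto simp: disjoint_family_on_def pairwise_def)
  have cs: "c \<in> sets borel" if "c \<in> components U" for c using open_components[OF oU that] by auto
  have Ueq: "(\<Union>c\<in>components U. c) = U" using Union_components[of U] by auto
  have "emeasure NN U = emeasure NN (\<Union>c\<in>components U. c)" using Ueq by simp
  also have "\<dots> = (\<integral>\<^sup>+c. emeasure NN c \<partial>count_space (components U))"
    by (rule emeasure_UN_countable) (use cnt dis cs in auto)
  also have "\<dots> \<le> (\<integral>\<^sup>+c. ennreal C2 * emeasure lborel c \<partial>count_space (components U))"
    by (intro nn_integral_mono comp) simp
  also have "\<dots> = ennreal C2 * (\<integral>\<^sup>+c. emeasure lborel c \<partial>count_space (components U))"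
    by (rule nn_integral_cmult) simp
  also have "(\<integral>\<^sup>+c. emeasure lborel c \<partial>count_space (components U)) = emeasure lborel (\<Union>c\<in>components U. c)"
    by (rule emeasure_UN_countable[symmetric]) (use cnt dis cs in auto)
  also have "\<dots> \<le> emeasure lborel {k..e}" unfolding Ueq U_def by (intro emeasure_mono) auto
  finally have "emeasure NN U \<le> ennreal C2 * ennreal (e - k)" using k(2) by (simp add: mult_left_mono)
  then have 1: "emeasure NN U < \<infinity>" by (rule le_less_trans) (simp add: ennreal_mult_less_top)
  have "emeasure NN (Bad \<inter> {k..<e}) = (\<integral>\<^sup>+t. (pc t)^2 * indicator {0..T} t * indicator (Bad \<inter> {k..<e}) t \<partial>lborel)"
    using closed_Bad by (intro emeasure_NN) auto
  also have "\<dots> \<le> (\<integral>\<^sup>+t. (ennreal n)^2 * indicator {k..e} t \<partial>lborel)"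
    by (intro nn_integral_mono) (auto simp: indicator_def intro!: power_mono bd)
  also have "\<dots> = (ennreal n)^2 * ennreal (e - k)" using k(2) by (simp add: nn_integral_cmult)
  also have "\<dots> < \<infinity>" by (simp add: ennreal_mult_less_top power_less_top_ennreal)
  finally have 2: "emeasure NN (Bad \<inter> {k..<e}) < \<infinity>" .
  have "emeasure NN {k..e} \<le> emeasure NN (U \<union> (Bad \<inter> {k..<e}) \<union> {e})"
    unfolding U_def using closed_Bad k(1) by (intro emeasure_mono) (auto simp: less_le)
  also have "\<dots> \<le> emeasure NN U + emeasure NN (Bad \<inter> {k..<e}) + emeasure NN {e}"
    using closed_Bad oU by (intro order_trans[OF emeasure_subadditive] add_mono) auto
  also have "\<dots> < \<infinity>" using 1 2 by (simp add: NN_point)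
  finally show ?thesis .
qed

text \<open>Since \<open>a0\<close> is positive, the cube of \<open>u\<close> can be expressed
  through the nonlinearity and lower powers, all of which are integrable at positive times.\<close>

lemma pc_finite: assumes "0 < t" shows "pc t < \<infinity>"
proof -
  let ?f = "\<lambda>x. cubic a0 a1 a2 a3 (u t x)"
  have L: "L2fun (u t)" using assms by (intro L2) simp
  have i1: "integrable lebI (u t)" "integrable lebI (\<lambda>x. (u t x)^2)" using L by (auto intro: L2fun_integrable L2fun_sq)
  have "integrable lebI (\<lambda>x. 1/a0 * (?f x - a1 * (u t x)^2 - a2 * u t x - a3))"
    by (intro integrable_mult_right Bochner_Integration.integrable_diff fint assms i1) auto
  also have "(\<lambda>x. 1/a0 * (?f x - a1 * (u t x)^2 - a2 * u t x - a3)) = (\<lambda>x. (u t x)^3)"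
    using a0 by (simp add: cubic_def)
  finally have "integrable lebI (\<lambda>x. (u t x)^3)" .
  then have "(\<integral>\<^sup>+x. ennreal (norm ((u t x)^3)) \<partial>lebI) < \<infinity>" by (simp add: integrable_iff_bounded)
  then show ?thesis unfolding pc_def cube_norm_def using assms by (simp add: power_abs)
qed

text \<open>At time 0 the cube may fail to be integrable, so the sublevel sets of \<open>pc\<close>
  might miss that point of \<open>Bad\<close>. The singleton \<open>{0}\<close> completes the closed
  cover, whence the first alternative, in which 0 is an isolated bad time. \<open>gap_finite\<close>
  can treat it because it asks for no bound at the left endpoint.\<close>

lemma Bad_portion:
  assumes "Bad \<noteq> {}"
  shows "\<exists>q\<in>Bad. \<exists>r>0. (\<forall>t\<in>Bad. \<bar>t - q\<bar> < r \<longrightarrow> t = 0) \<or> (\<exists>n::nat. \<forall>t\<in>Bad. \<bar>t - q\<bar> < r \<longrightarrow> pc t \<le> ennreal (real n))"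
proof (rule ccontr)
  assume neg: "\<not> ?thesis"
  define C where "C n = (if n = 0 then {0} else {t. pc t \<le> ennreal (real n)})" for n :: nat
  have cC: "closed (C n)" for n unfolding C_def using closed_pc[of "real n"] by auto
  have dense: "Bad \<subseteq> closure (Bad - C n)" for n
  proof (rule subsetI, rule ccontr)
    fix q assume q: "q \<in> Bad" "q \<notin> closure (Bad - C n)"
    then obtain r where r: "r > 0" "\<And>t. t \<in> Bad - C n \<Longrightarrow> \<not> dist t q < r"
      unfolding closure_approachable by auto
    have "t \<in> C n" if "t \<in> Bad" "\<bar>t - q\<bar> < r" for t using r(2)[of t] that by (auto simp: dist_real_def)
    then have "(\<forall>t\<in>Bad. \<bar>t - q\<bar> < r \<longrightarrow> t = 0) \<or> (\<exists>n::nat. \<forall>t\<in>Bad. \<bar>t - q\<bar> < r \<longrightarrow> pc t \<le> ennreal (real n))"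
      by (cases "n = 0") (auto simp: C_def)
    then show False using neg q(1) r(1) by blast
  qed
  have "Bad \<subseteq> closure (\<Inter>(range (\<lambda>n. Bad - C n)))"
  proof (rule Baire[OF closed_Bad])
    fix S assume "S \<in> range (\<lambda>n. Bad - C n)"
    then obtain n where S: "S = Bad - C n" by auto
    have "openin (top_of_set Bad) (Bad - C n)"
      using cC[of n] by (auto simp: openin_open intro!: exI[of _ "- C n"])
    then show "openin (top_of_set Bad) S \<and> Bad \<subseteq> closure S" using dense S by auto
  qed auto
  moreover have "(\<Inter>(range (\<lambda>n. Bad - C n))) = {}"
  proof (rule ccontr)
    assume "\<not> ?thesis"
    then obtain t where t: "\<And>n. t \<in> Bad - C n" by auto
    have "t \<noteq> 0" using t[of 0] by (auto simp: C_def)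
    moreover have "0 \<le> t" using t[of 0] by (auto simp: Bad_def)
    ultimately have "pc t < \<infinity>" by (intro pc_finite) auto
    then obtain y where y: "pc t = ennreal y" "0 \<le> y" by (cases "pc t") auto
    obtain n :: nat where "y \<le> real n" using real_arch_simple by blast
    then have "pc t \<le> ennreal (real (Suc n))" unfolding y by (intro ennreal_leI) simp
    then show False using t[of "Suc n"] by (auto simp: C_def)
  qed
  ultimately have "Bad \<subseteq> closure {}" by (simp only:)
  then show False using assms by simp
qed

lemma Bad_empty: "Bad = {}"
proof (rule ccontr)
  assume "Bad \<noteq> {}"
  then obtain q r where q: "q \<in> Bad" and r: "r > 0"
    and alt: "(\<forall>t\<in>Bad. \<bar>t - q\<bar> < r \<longrightarrow> t = 0) \<or> (\<exists>n::nat. \<forall>t\<in>Bad. \<bar>t - q\<bar> < r \<longrightarrow> pc t \<le> ennreal (real n))"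
    using Bad_portion by blast
  \<comment> \<open>Half of \<open>h0\<close>, so that the interval from \<open>q - s\<close> to
    \<open>q + s\<close> has length at most \<open>h0\<close>; half of \<open>r\<close>, so that it
    stays strictly inside the portion.\<close>
  define s where "s = min (r/2) (h0/2)"
  have s: "0 < s" "s < r" "2 * s \<le> h0" using r h0(1) by (auto simp: s_def)
  have q0: "0 \<le> q" "q \<le> T" using q by (auto simp: Bad_def)
  define e where "e = min T (q + s)"
  define l where "l = max 0 (q - s)"
  have right: "emeasure NN {k..e} < \<infinity>" if k: "k \<in> Bad" "q - s \<le> k" "k \<le> q" for k
    using alt
  proof
    assume z: "\<forall>t\<in>Bad. \<bar>t - q\<bar> < r \<longrightarrow> t = 0"
    have k0: "k = 0" using z k s by auto
    have "{0<..<e} \<inter> Bad = {}" using z k s q0 k0 unfolding e_def by (auto simp: abs_less_iff)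
    moreover have "q = 0" using z q r by auto
    then have "0 < e" "e \<le> T" "e - 0 \<le> h0" unfolding e_def using T0 s by auto
    ultimately have "emeasure NN {0..e} \<le> Cstar" by (intro gap_finite) auto
    then show ?thesis unfolding k0 using Cstar_finite by (rule le_less_trans)
  next
    assume "\<exists>n::nat. \<forall>t\<in>Bad. \<bar>t - q\<bar> < r \<longrightarrow> pc t \<le> ennreal (real n)"
    then obtain n :: nat where n: "\<And>t. t \<in> Bad \<Longrightarrow> \<bar>t - q\<bar> < r \<Longrightarrow> pc t \<le> ennreal (real n)" by blast
    show ?thesis
    proof (rule portion_finite[where n="real n"])
      show "k \<in> Bad" by (rule k)
      show "k \<le> e" "e \<le> T" "e - k \<le> h0" unfolding e_def using k q0 s by auto
      show "pc t \<le> ennreal (real n)" if "t \<in> Bad" "k \<le> t" "t < e" for t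
        using that k s by (intro n) (auto simp: e_def abs_less_iff)
    qed simp
  qed
  have bad: "emeasure NN {q - \<rho>..q + \<rho>} = \<infinity>" if "\<rho> > 0" for \<rho> using q that by (auto simp: Bad_def)
  have restr: "emeasure NN A = emeasure NN (A \<inter> {0..T})" if "A \<in> sets borel" for A
    using that by (subst (1 2) emeasure_NN) (auto intro!: nn_integral_cong simp: indicator_def)
  show False
  \<comment> \<open>If no bad time lies just before \<open>q\<close>, the left side is a gap and the
    right side a portion. Otherwise a portion started at an earlier bad time \<open>k\<close>
    contains a whole symmetric neighbourhood of \<open>q\<close> within
    \<open>{0..T}\<close>.\<close>
  proof (cases "{l<..<q} \<inter> Bad = {}")
    case True
    have left: "emeasure NN {l..q} < \<infinity>"
    proof (cases "l = q")
      case True then show ?thesis by (simp add: NN_point)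
    next
      case False
      then have "emeasure NN {l..q} \<le> Cstar" using \<open>{l<..<q} \<inter> Bad = {}\<close> q0 s
        by (intro gap_finite) (auto simp: l_def)
      then show ?thesis using Cstar_finite by (rule le_less_trans)
    qed
    have "emeasure NN {q - s..q + s} = emeasure NN ({q - s..q + s} \<inter> {0..T})" by (rule restr) simp
    also have "\<dots> \<le> emeasure NN ({l..q} \<union> {q..e})" by (intro emeasure_mono) (auto simp: l_def e_def)
    also have "\<dots> \<le> emeasure NN {l..q} + emeasure NN {q..e}" by (intro emeasure_subadditive) auto
    also have "\<dots> < \<infinity>" using left right[of q] q s by simp
    finally show False using bad[OF s(1)] by simp
  next
    case False
    then obtain k where k: "k \<in> Bad" "l < k" "k < q" by auto
    have qk: "q - k > 0" "q - k \<le> s" using k by (auto simp: l_def)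
    have "emeasure NN {q - (q - k)..q + (q - k)} = emeasure NN ({q - (q - k)..q + (q - k)} \<inter> {0..T})" by (rule restr) simp
    also have "\<dots> \<le> emeasure NN {k..e}" using qk by (intro emeasure_mono) (auto simp: e_def)
    also have "\<dots> < \<infinity>" using k qk by (intro right) auto
    finally show False using bad[OF qk(1)] by simp
  qed
qed

lemma NN_finite: "emeasure NN {0..T} < \<infinity>"
proof (rule NN_finite_of_local)
  show "0 \<le> T" using T0 by simp
  fix x assume "0 \<le> x" "x \<le> T"
  then have "x \<in> {0..T}" "x \<notin> Bad" using Bad_empty by auto
  then show "\<exists>r>0. emeasure NN {x - r..x + r} < \<infinity>" by (auto simp: Bad_def less_top)
qed

end

section \<open>Contraction of two solutions driven by the same noise\<close>


text \<open>Integration by parts when the densities are merely integrable and no pointwise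
  derivative is at hand. Fubini is applied to the triangles on the two sides of the diagonal, which
  together fill the square.\<close>

lemma primitive_product:
  fixes p q :: "real \<Rightarrow> real"
  assumes p: "set_integrable lborel {0..T} p" and q: "set_integrable lborel {0..T} q"
    and W: "\<And>t. 0 \<le> t \<Longrightarrow> t \<le> T \<Longrightarrow> W t = W0 + set_lebesgue_integral lborel {0..t} p"
    and V: "\<And>t. 0 \<le> t \<Longrightarrow> t \<le> T \<Longrightarrow> V t = V0 + set_lebesgue_integral lborel {0..t} q"
    and T: "0 \<le> T"
  shows "set_integrable lborel {0..T} (\<lambda>t. p t * V t)" "set_integrable lborel {0..T} (\<lambda>t. W t * q t)"
    "W T * V T = W0 * V0 + set_lebesgue_integral lborel {0..T} (\<lambda>t. p t * V t + W t * q t)"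
proof -
  have part: "set_integrable lborel {0..T} (\<lambda>t. a t * B t) \<and>
     set_lebesgue_integral lborel {0..T} (\<lambda>t. a t * B t) = B0 * (\<integral>t. a' t \<partial>lborel) + (\<integral>t. (\<integral>s. (a' t * b' s) * (if s \<le> t then 1 else 0) \<partial>lborel) \<partial>lborel)
     \<and> integrable (lborel \<Otimes>\<^sub>M lborel) (\<lambda>(t, s). (a' t * b' s) * (if s \<le> t then 1 else 0))"
    if a: "set_integrable lborel {0..T} a" and b: "set_integrable lborel {0..T} b"
      and B: "\<And>t. 0 \<le> t \<Longrightarrow> t \<le> T \<Longrightarrow> B t = B0 + set_lebesgue_integral lborel {0..t} b"
      and a': "a' = (\<lambda>t. indicator {0..T} t * a t)" and b': "b' = (\<lambda>t. indicator {0..T} t * b t)"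
    for a b B a' b' :: "real \<Rightarrow> real" and B0 :: real
  proof -
    have ia: "integrable lborel a'" and ib: "integrable lborel b'"
      using a b unfolding a' b' set_integrable_def by auto
    have [measurable]: "a' \<in> borel_measurable borel" "b' \<in> borel_measurable borel" using ia ib by auto
    let ?f = "\<lambda>(t, s). (a' t * b' s) * (if s \<le> t then 1 else 0 :: real)"
    have int: "integrable (lborel \<Otimes>\<^sub>M lborel) ?f"
    proof (rule lborel_pair.Fubini_integrable)
      show "?f \<in> borel_measurable (lborel \<Otimes>\<^sub>M lborel)" by measurable
      have fs: "integrable lborel (\<lambda>s. ?f (t, s))" for t
        by (rule Bochner_Integration.integrable_bound[OF integrable_mult_right[OF ib, of "a' t"]]) auto
      then show "AE t in lborel. integrable lborel (\<lambda>s. ?f (t, s))" by simp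
      show "integrable lborel (\<lambda>t. \<integral>s. norm (?f (t, s)) \<partial>lborel)"
      proof (rule Bochner_Integration.integrable_bound)
        show "integrable lborel (\<lambda>t. \<bar>a' t\<bar> * (\<integral>s. \<bar>b' s\<bar> \<partial>lborel))" using ia by auto
        show "(\<lambda>t. \<integral>s. norm (?f (t, s)) \<partial>lborel) \<in> borel_measurable lborel"
          by (rule lborel.borel_measurable_lebesgue_integral) measurable
        have "(\<integral>s. norm (?f (t, s)) \<partial>lborel) \<le> (\<integral>s. \<bar>a' t\<bar> * \<bar>b' s\<bar> \<partial>lborel)" for t
        proof (rule integral_mono)
          show "integrable lborel (\<lambda>s. norm (?f (t, s)))" by (rule integrable_norm[OF fs])
          show "integrable lborel (\<lambda>s. \<bar>a' t\<bar> * \<bar>b' s\<bar>)" using ib by auto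
        qed (auto simp: abs_mult)
        then have "(\<integral>s. norm (?f (t, s)) \<partial>lborel) \<le> \<bar>a' t\<bar> * (\<integral>s. \<bar>b' s\<bar> \<partial>lborel)" for t by simp
        moreover have "0 \<le> (\<integral>s. norm (?f (t, s)) \<partial>lborel)" for t by (intro integral_nonneg_AE) auto
        ultimately show "AE t in lborel. norm (\<integral>s. norm (?f (t, s)) \<partial>lborel) \<le> norm (\<bar>a' t\<bar> * (\<integral>s. \<bar>b' s\<bar> \<partial>lborel))"
          by (intro AE_I2) (auto intro: order_trans[OF _ abs_ge_self])
      qed
    qed
    have eqB: "indicator {0..T} t *\<^sub>R (a t * B t) = B0 * a' t + (\<integral>s. (a' t * b' s) * (if s \<le> t then 1 else 0) \<partial>lborel)" for t
    proof (cases "t \<in> {0..T}")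
      case True
      have "(\<integral>s. (a' t * b' s) * (if s \<le> t then 1 else 0) \<partial>lborel) = (\<integral>s. a' t * (indicator {0..t} s *\<^sub>R b s) \<partial>lborel)"
        by (intro Bochner_Integration.integral_cong) (use True in \<open>auto simp: b' indicator_def\<close>)
      also have "\<dots> = a' t * set_lebesgue_integral lborel {0..t} b" unfolding set_lebesgue_integral_def by simp
      finally have X: "(\<integral>s. (a' t * b' s) * (if s \<le> t then 1 else 0) \<partial>lborel) = a' t * set_lebesgue_integral lborel {0..t} b" .
      show ?thesis unfolding X using True B[of t] by (simp add: a' algebra_simps)
    qed (simp add: a')
    have i2: "integrable lborel (\<lambda>t. \<integral>s. (a' t * b' s) * (if s \<le> t then 1 else 0) \<partial>lborel)"
      using lborel_pair.integrable_fst'[OF int] by simp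
    have "set_integrable lborel {0..T} (\<lambda>t. a t * B t)"
      unfolding set_integrable_def eqB using ia i2 by auto
    moreover have "set_lebesgue_integral lborel {0..T} (\<lambda>t. a t * B t) = B0 * (\<integral>t. a' t \<partial>lborel) + (\<integral>t. (\<integral>s. (a' t * b' s) * (if s \<le> t then 1 else 0) \<partial>lborel) \<partial>lborel)"
      unfolding set_lebesgue_integral_def eqB using ia i2 by (subst Bochner_Integration.integral_add) auto
    ultimately show ?thesis using int by simp
  qed
  define p' where "p' = (\<lambda>t. indicator {0..T} t * p t)"
  define q' where "q' = (\<lambda>t. indicator {0..T} t * q t)"
  have ip: "integrable lborel p'" and iq: "integrable lborel q'"
    using p q unfolding p'_def q'_def set_integrable_def by auto
  note PV = part[OF p q V p'_def q'_def] and QW = part[OF q p W q'_def p'_def]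
  show pV: "set_integrable lborel {0..T} (\<lambda>t. p t * V t)" using PV by simp
  show Wq: "set_integrable lborel {0..T} (\<lambda>t. W t * q t)" using QW by (simp add: mult.commute)
  have PV': "set_lebesgue_integral lborel {0..T} (\<lambda>t. p t * V t) = V0 * (\<integral>t. p' t \<partial>lborel) + (\<integral>t. (\<integral>s. (p' t * q' s) * (if s \<le> t then 1 else 0) \<partial>lborel) \<partial>lborel)"
    using PV by blast
  have QW': "set_lebesgue_integral lborel {0..T} (\<lambda>t. W t * q t) = W0 * (\<integral>t. q' t \<partial>lborel) + (\<integral>t. (\<integral>s. (q' t * p' s) * (if s \<le> t then 1 else 0) \<partial>lborel) \<partial>lborel)"
    using QW by (simp add: mult.commute[of "W _"])
  have swap: "(\<integral>t. (\<integral>s. (q' t * p' s) * (if s \<le> t then 1 else 0) \<partial>lborel) \<partial>lborel) = (\<integral>t. (\<integral>s. (p' t * q' s) * (if t \<le> s then 1 else 0) \<partial>lborel) \<partial>lborel)"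
    using lborel_pair.Fubini_integral[of "\<lambda>t s. (q' t * p' s) * (if s \<le> t then 1 else 0)"] QW
    by (simp add: mult.commute)
  have i1: "integrable lborel (\<lambda>t. \<integral>s. (p' t * q' s) * (if s \<le> t then 1 else 0) \<partial>lborel)"
    using lborel_pair.integrable_fst'[of "\<lambda>(t, s). (p' t * q' s) * (if s \<le> t then 1 else 0)"] PV by simp
  have i2: "integrable lborel (\<lambda>t. \<integral>s. (p' t * q' s) * (if t \<le> s then 1 else 0) \<partial>lborel)"
    using lborel_pair.integrable_snd[of "\<lambda>t s. (q' t * p' s) * (if s \<le> t then 1 else 0)"] QW by (simp add: mult.commute)
  have [measurable]: "p' \<in> borel_measurable borel" "q' \<in> borel_measurable borel" using ip iq by auto
  \<comment> \<open>The two triangles overlap only on the diagonal, where \<open>s = t\<close>, a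
    null set for each fixed \<open>t\<close>.\<close>
  have inner: "(\<integral>s. (p' t * q' s) * (if s \<le> t then 1 else 0) \<partial>lborel) + (\<integral>s. (p' t * q' s) * (if t \<le> s then 1 else 0) \<partial>lborel) = p' t * (\<integral>s. q' s \<partial>lborel)" for t
  proof -
    have j1: "integrable lborel (\<lambda>s. (p' t * q' s) * (if s \<le> t then 1 else 0))" "integrable lborel (\<lambda>s. (p' t * q' s) * (if t \<le> s then 1 else 0))"
      by (rule Bochner_Integration.integrable_bound[OF integrable_mult_right[OF iq, of "p' t"]]; auto)+
    have "(\<integral>s. (p' t * q' s) * (if s \<le> t then 1 else 0) \<partial>lborel) + (\<integral>s. (p' t * q' s) * (if t \<le> s then 1 else 0) \<partial>lborel)
      = (\<integral>s. (p' t * q' s) * (if s \<le> t then 1 else 0) + (p' t * q' s) * (if t \<le> s then 1 else 0) \<partial>lborel)"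
      using j1 by (rule Bochner_Integration.integral_add[symmetric])
    also have "\<dots> = (\<integral>s. p' t * q' s \<partial>lborel)"
    proof (rule integral_cong_AE)
      show "AE s in lborel. (p' t * q' s) * (if s \<le> t then 1 else 0) + (p' t * q' s) * (if t \<le> s then 1 else 0) = p' t * q' s"
        using AE_lborel_singleton[of t] by eventually_elim auto
    qed measurable
    finally show ?thesis by simp
  qed
  have "set_lebesgue_integral lborel {0..T} (\<lambda>t. p t * V t + W t * q t) =
     set_lebesgue_integral lborel {0..T} (\<lambda>t. p t * V t) + set_lebesgue_integral lborel {0..T} (\<lambda>t. W t * q t)"
    using pV Wq by (rule set_integral_add)
  also have "\<dots> = V0 * (\<integral>t. p' t \<partial>lborel) + W0 * (\<integral>t. q' t \<partial>lborel) + (\<integral>t. p' t * (\<integral>s. q' s \<partial>lborel) \<partial>lborel)"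
    unfolding PV' QW' swap inner[symmetric] using i1 i2 by simp
  also have "\<dots> = V0 * (\<integral>t. p' t \<partial>lborel) + W0 * (\<integral>t. q' t \<partial>lborel) + (\<integral>t. p' t \<partial>lborel) * (\<integral>s. q' s \<partial>lborel)" by simp
  finally have I: "set_lebesgue_integral lborel {0..T} (\<lambda>t. p t * V t + W t * q t) = V0 * (\<integral>t. p' t \<partial>lborel) + W0 * (\<integral>t. q' t \<partial>lborel) + (\<integral>t. p' t \<partial>lborel) * (\<integral>s. q' s \<partial>lborel)" .
  have "W T = W0 + (\<integral>t. p' t \<partial>lborel)" "V T = V0 + (\<integral>t. q' t \<partial>lborel)"
    using W[of T] V[of T] T by (auto simp: p'_def q'_def set_lebesgue_integral_def)
  then show "W T * V T = W0 * V0 + set_lebesgue_integral lborel {0..T} (\<lambda>t. p t * V t + W t * q t)"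
    unfolding I by (simp add: algebra_simps)
qed

lemma set_integrable_mult_continuous:
  fixes g h :: "real \<Rightarrow> real"
  assumes g: "set_integrable lborel {0..T} g" and h: "continuous_on {0..T} h"
  shows "set_integrable lborel {0..T} (\<lambda>t. h t * g t)"
proof -
  have "bounded (h ` {0..T})" using compact_imp_bounded[OF compact_continuous_image[OF h compact_Icc]] .
  then obtain B where "\<forall>y\<in>h ` {0..T}. norm y \<le> B" unfolding bounded_iff by blast
  then have B: "\<And>t. t \<in> {0..T} \<Longrightarrow> \<bar>h t\<bar> \<le> B" by auto
  have hm: "(\<lambda>t. indicator {0..T} t *\<^sub>R h t) \<in> borel_measurable borel"
    using borel_measurable_continuous_on_indicator[OF _ h] by simp
  have gi: "integrable lborel (\<lambda>t. indicator {0..T} t *\<^sub>R g t)" using g by (simp add: set_integrable_def)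
  have "integrable lborel (\<lambda>t. (indicator {0..T} t *\<^sub>R h t) * (indicator {0..T} t *\<^sub>R g t))"
  proof (rule Bochner_Integration.integrable_bound[OF integrable_mult_right[OF gi, of B]])
    show "(\<lambda>t. (indicator {0..T} t *\<^sub>R h t) * (indicator {0..T} t *\<^sub>R g t)) \<in> borel_measurable lborel"
      using hm borel_measurable_integrable[OF gi] by (intro borel_measurable_times) auto
    show "AE t in lborel. norm ((indicator {0..T} t *\<^sub>R h t) * (indicator {0..T} t *\<^sub>R g t)) \<le> norm (B * (indicator {0..T} t *\<^sub>R g t))"
    proof (rule AE_I2)
      fix t show "norm ((indicator {0..T} t *\<^sub>R h t) * (indicator {0..T} t *\<^sub>R g t)) \<le> norm (B * (indicator {0..T} t *\<^sub>R g t))"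
        using B[of t] by (cases "t \<in> {0..T}") (auto simp: abs_mult intro!: mult_right_mono)
    qed
  qed
  also have "(\<lambda>t. (indicator {0..T} t *\<^sub>R h t) * (indicator {0..T} t *\<^sub>R g t)) = (\<lambda>t. indicator {0..T} t *\<^sub>R (h t * g t))"
    by (auto simp: indicator_def)
  finally show ?thesis by (simp add: set_integrable_def)
qed

text \<open>The energy identity for \<open>z' = g - \<nu> * z\<close> in mild form. The product rule
  is used twice: for \<open>exp (- (\<nu> * t))\<close> times \<open>exp (\<nu> * t) * z t\<close>,
  which exhibits \<open>z\<close> itself as a primitive, and then for \<open>z\<close> times
  \<open>z\<close>.\<close>

lemma duhamel_square:
  fixes g :: "real \<Rightarrow> real"
  assumes T: "0 \<le> T" and g: "set_integrable lborel {0..T} g"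
    and z: "\<And>t. 0 \<le> t \<Longrightarrow> t \<le> T \<Longrightarrow> z t = exp (- (\<nu> * t)) * z0 + set_lebesgue_integral lborel {0..t} (\<lambda>s. exp (- (\<nu> * (t - s))) * g s)"
  shows "set_integrable lborel {0..T} (\<lambda>t. z t * (g t - \<nu> * z t))"
    "(z T)^2 = z0^2 + 2 * set_lebesgue_integral lborel {0..T} (\<lambda>t. z t * (g t - \<nu> * z t))"
proof -
  define y where "y t = exp (\<nu> * t) * z t" for t
  define q where "q s = exp (\<nu> * s) * g s" for s
  define p where "p s = - \<nu> * exp (- (\<nu> * s))" for s
  have qi: "set_integrable lborel {0..T} q"
    unfolding q_def by (rule set_integrable_mult_continuous[OF g]) (intro continuous_intros)
  have pc: "continuous_on S p" for S unfolding p_def by (intro continuous_intros)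
  have pi: "set_integrable lborel {0..T} p" by (rule borel_integrable_atLeastAtMost'[OF pc])
  have y: "y t = z0 + set_lebesgue_integral lborel {0..t} q" if "0 \<le> t" "t \<le> T" for t
  proof -
    have "exp (\<nu> * t) * set_lebesgue_integral lborel {0..t} (\<lambda>s. exp (- (\<nu> * (t - s))) * g s) =
      set_lebesgue_integral lborel {0..t} (\<lambda>s. exp (\<nu> * t) * (exp (- (\<nu> * (t - s))) * g s))" by simp
    also have "(\<lambda>s. exp (\<nu> * t) * (exp (- (\<nu> * (t - s))) * g s)) = q"
      by (auto simp: q_def mult.assoc[symmetric] exp_add[symmetric] algebra_simps)
    finally show ?thesis unfolding y_def z[OF that] by (simp add: distrib_left mult.assoc[symmetric] exp_add[symmetric])
  qed
  have W: "exp (- (\<nu> * t)) = 1 + set_lebesgue_integral lborel {0..t} p" if "0 \<le> t" "t \<le> T" for t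
  proof -
    have "(\<integral>s. p s * indicator {0..t} s \<partial>lborel) = exp (- (\<nu> * t)) - exp (- (\<nu> * 0))"
      by (rule integral_FTC_Icc_real) (use that in \<open>auto simp: p_def intro!: derivative_eq_intros continuous_intros\<close>)
    then show ?thesis by (simp add: set_lebesgue_integral_def mult.commute)
  qed
  have zy: "z t = exp (- (\<nu> * t)) * y t" for t unfolding y_def by (simp add: mult.assoc[symmetric] exp_add[symmetric])
  have eq: "p t * y t + exp (- (\<nu> * t)) * q t = g t - \<nu> * z t" for t
    unfolding p_def q_def zy by (simp add: mult.assoc[symmetric] exp_add[symmetric])
  have z1: "set_integrable lborel {0..t} (\<lambda>t. g t - \<nu> * z t) \<and> z t = z0 + set_lebesgue_integral lborel {0..t} (\<lambda>t. g t - \<nu> * z t)" if t: "0 \<le> t" "t \<le> T" for t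
  proof -
    have pi': "set_integrable lborel {0..t} p" and qi': "set_integrable lborel {0..t} q"
      using t by (auto intro: set_integrable_subset[OF pi] set_integrable_subset[OF qi])
    have W': "exp (- (\<nu> * s)) = 1 + set_lebesgue_integral lborel {0..s} p"
      and y': "y s = z0 + set_lebesgue_integral lborel {0..s} q" if "0 \<le> s" "s \<le> t" for s
      using that t by (auto intro!: W y simp del: exp_minus)
    note PP = primitive_product[OF pi' qi' W' y' t(1)]
    have a: "set_integrable lborel {0..t} (\<lambda>t. p t * y t)" "set_integrable lborel {0..t} (\<lambda>t. exp (- (\<nu> * t)) * q t)"
      "exp (- (\<nu> * t)) * y t = 1 * z0 + set_lebesgue_integral lborel {0..t} (\<lambda>t. p t * y t + exp (- (\<nu> * t)) * q t)"
      by (rule PP(1), assumption+) (rule PP(2), assumption+, rule PP(3), assumption+)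
    have "set_integrable lborel {0..t} (\<lambda>t. g t - \<nu> * z t)"
      unfolding eq[symmetric] using a(1,2) by (rule set_integral_add)
    then show ?thesis using a(3) unfolding eq zy[symmetric] by simp
  qed
  have zi: "set_integrable lborel {0..T} (\<lambda>t. g t - \<nu> * z t)" using z1[of T] T by simp
  have zt: "\<And>t. 0 \<le> t \<Longrightarrow> t \<le> T \<Longrightarrow> z t = z0 + set_lebesgue_integral lborel {0..t} (\<lambda>t. g t - \<nu> * z t)" using z1 by blast
  note QQ = primitive_product[OF zi zi zt zt T]
  show "set_integrable lborel {0..T} (\<lambda>t. z t * (g t - \<nu> * z t))" by (rule QQ(2))
  have "(z T)^2 = z0^2 + set_lebesgue_integral lborel {0..T} (\<lambda>t. (g t - \<nu> * z t) * z t + z t * (g t - \<nu> * z t))"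
    using QQ(3) by (simp add: power2_eq_square)
  also have "(\<lambda>t. (g t - \<nu> * z t) * z t + z t * (g t - \<nu> * z t)) = (\<lambda>t. 2 * (z t * (g t - \<nu> * z t)))" by (simp add: mult.commute)
  finally show "(z T)^2 = z0^2 + 2 * set_lebesgue_integral lborel {0..T} (\<lambda>t. z t * (g t - \<nu> * z t))" by simp
qed

lemma (in ch_path) cf_continuous: "continuous_on UNIV (\<lambda>t. cf (u (max 0 t)) j)"
  unfolding continuous_on_iff
proof (intro ballI allI impI)
  fix t e :: real assume e: "0 < e"
  obtain d where d: "d > 0" "\<And>s. s \<ge> 0 \<Longrightarrow> \<bar>s - max 0 t\<bar> < d \<Longrightarrow> L2dist (u s) (u (max 0 t)) < e"
    using cont_eps[of "max 0 t" e] e by auto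
  have "dist (cf (u (max 0 s)) j) (cf (u (max 0 t)) j) < e" if "dist s t < d" for s
  proof -
    have Ls: "L2fun (u (max 0 s))" "L2fun (u (max 0 t))" by (auto intro: L2)
    have "\<bar>cf (u (max 0 s)) j - cf (u (max 0 t)) j\<bar> = \<bar>cf (\<lambda>x. u (max 0 s) x - u (max 0 t) x) j\<bar>"
      using Ls by (simp add: L2inner_diff_left L2fun_phi)
    also have "\<dots> \<le> L2dist (u (max 0 s)) (u (max 0 t))"
      unfolding L2dist_lebI by (intro abs_cf_le L2fun_diff Ls)
    also have "\<dots> < e" using that by (intro d) (auto simp: dist_real_def)
    finally show ?thesis by (simp add: dist_real_def)
  qed
  with d(1) show "\<exists>d>0. \<forall>s\<in>UNIV. dist s t < d \<longrightarrow> dist (cf (u (max 0 s)) j) (cf (u (max 0 t)) j) < e" by blast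
qed

text \<open>Synchronous coupling: both paths share \<open>noise\<close>, which cancels in their
  difference. \<open>R\<close> bounds both of them.\<close>

locale ch_pair = U: ch_path T a0 a1 a2 a3 R u "cf u0" noise Om + V: ch_path T a0 a1 a2 a3 R v "cf v0" noise Om
  for T a0 a1 a2 a3 R u v u0 v0 noise Om +
  fixes L :: real
  assumes u0: "L2fun u0" and v0: "L2fun v0" and mean: "cf u0 0 = cf v0 0"
    and L: "0 \<le> L" "L < 1"
    and mono: "\<And>x y. - L * (x - y)^2 \<le> (cubic a0 a1 a2 a3 x - cubic a0 a1 a2 a3 y) * (x - y)"
begin

definition w :: "nat \<Rightarrow> real \<Rightarrow> real" where
  "w j t = cf (u (max 0 t)) j - cf (v (max 0 t)) j"

definition e0 :: "nat \<Rightarrow> real" where "e0 j = cf u0 j - cf v0 j"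

definition GG :: "nat \<Rightarrow> real \<Rightarrow> real" where "GG j s = U.FF j s - V.FF j s"

definition gs :: "real \<Rightarrow> ennreal" where "gs t = U.gg t + V.gg t"

definition S0 :: real where "S0 = (\<integral>x. (u0 x - v0 x)^2 \<partial>lebI)"

lemma e0_sums: "(\<lambda>j. (e0 j)^2) sums S0"
  unfolding S0_def e0_def using parseval[OF L2fun_diff[OF u0 v0]] u0 v0
  by (simp add: L2inner_diff_left L2fun_phi)

lemma S0_nonneg: "0 \<le> S0" unfolding S0_def by (intro integral_nonneg_AE) auto

lemma gs_meas [measurable]: "gs \<in> borel_measurable borel" unfolding gs_def[abs_def] by measurable

lemma GG_bound: "0 \<le> s \<Longrightarrow> ennreal \<bar>GG j s\<bar> \<le> gs s"
proof -
  assume s: "0 \<le> s"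
  have "ennreal \<bar>GG j s\<bar> \<le> ennreal (\<bar>U.FF j s\<bar> + \<bar>V.FF j s\<bar>)" unfolding GG_def by (intro ennreal_leI) simp
  also have "\<dots> = ennreal \<bar>U.FF j s\<bar> + ennreal \<bar>V.FF j s\<bar>" by simp
  also have "\<dots> \<le> gs s" unfolding gs_def using s by (intro add_mono U.FF_bound V.FF_bound)
  finally show ?thesis .
qed

lemma w_mild:
  assumes t: "0 \<le> t"
  shows "w j t = exp (- ((lam j)^2 * t)) * e0 j - set_lebesgue_integral lborel {0..t} (\<lambda>s. tker j (t - s) * GG j s)"
    "set_integrable lborel {0..t} (\<lambda>s. tker j (t - s) * GG j s)"
proof -
  show "set_integrable lborel {0..t} (\<lambda>s. tker j (t - s) * GG j s)"
    unfolding GG_def right_diff_distrib by (intro set_integral_diff U.Fint' V.Fint' t)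
  have "set_lebesgue_integral lborel {0..t} (\<lambda>s. tker j (t - s) * GG j s) =
    set_lebesgue_integral lborel {0..t} (\<lambda>s. tker j (t - s) * U.FF j s) - set_lebesgue_integral lborel {0..t} (\<lambda>s. tker j (t - s) * V.FF j s)"
    unfolding GG_def right_diff_distrib by (intro set_integral_diff U.Fint' V.Fint' t)
  then show "w j t = exp (- ((lam j)^2 * t)) * e0 j - set_lebesgue_integral lborel {0..t} (\<lambda>s. tker j (t - s) * GG j s)"
    unfolding w_def e0_def using U.mild'[OF t, of j] V.mild'[OF t, of j] t by (simp add: algebra_simps)
qed

lemma w_zero: assumes "0 \<le> t" shows "w 0 t = 0"
  using w_mild(1)[OF assms, of 0] mean by (simp add: tker_def lam_def e0_def)

text \<open>Here the finiteness obtained from the Baire argument, \<open>NN_finite\<close>, enters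
  for both paths.\<close>

lemma gs_L2: "(\<integral>\<^sup>+t. (gs t)^2 * indicator {0..T} t \<partial>lborel) < \<infinity>"
proof -
  have fin: "(\<integral>\<^sup>+t. (U.gg t)^2 * indicator {0..T} t \<partial>lborel) < \<infinity>" "(\<integral>\<^sup>+t. (V.gg t)^2 * indicator {0..T} t \<partial>lborel) < \<infinity>"
    using U.T0 U.NN_finite V.NN_finite
    by (auto intro!: le_less_trans[OF U.gg_L2] le_less_trans[OF V.gg_L2] simp: ennreal_mult_less_top)
  have "(\<integral>\<^sup>+t. (gs t)^2 * indicator {0..T} t \<partial>lborel) \<le> (\<integral>\<^sup>+t. 2 * ((U.gg t)^2 * indicator {0..T} t + (V.gg t)^2 * indicator {0..T} t) \<partial>lborel)"
  proof (rule nn_integral_mono)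
    fix t show "(gs t)^2 * indicator {0..T} t \<le> 2 * ((U.gg t)^2 * indicator {0..T} t + (V.gg t)^2 * indicator {0..T} t)"
      unfolding gs_def using ennreal_sq_add[of "U.gg t" "V.gg t"] by (cases "t \<in> {0..T}") auto
  qed
  also have "\<dots> = 2 * ((\<integral>\<^sup>+t. (U.gg t)^2 * indicator {0..T} t \<partial>lborel) + (\<integral>\<^sup>+t. (V.gg t)^2 * indicator {0..T} t \<partial>lborel))"
    by (simp add: nn_integral_cmult nn_integral_add)
  also have "\<dots> < \<infinity>" using fin by (simp add: ennreal_mult_less_top)
  finally show ?thesis .
qed

definition AA :: "real \<Rightarrow> ennreal" where "AA t = cf_abs (\<lambda>j. w j t)"

lemma AA_bound:
  assumes t: "0 \<le> t" shows "AA t \<le> cf_abs (semi (t - 0) e0) + (\<Sum>j. tconv gs 0 t j)"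
proof -
  have "ennreal \<bar>w j t\<bar> \<le> ennreal \<bar>semi (t - 0) e0 j\<bar> + tconv gs 0 t j" for j
  proof -
    let ?I = "set_lebesgue_integral lborel {0..t} (\<lambda>s. tker j (t - s) * GG j s)"
    have "ennreal \<bar>w j t\<bar> \<le> ennreal (\<bar>semi (t - 0) e0 j\<bar> + \<bar>?I\<bar>)"
      unfolding w_mild(1)[OF t] semi_def by (intro ennreal_leI) simp
    also have "\<dots> = ennreal \<bar>semi (t - 0) e0 j\<bar> + ennreal \<bar>?I\<bar>" by simp
    also have "ennreal \<bar>?I\<bar> \<le> (\<integral>\<^sup>+s. ennreal \<bar>indicator {0..t} s *\<^sub>R (tker j (t - s) * GG j s)\<bar> \<partial>lborel)"
      unfolding set_lebesgue_integral_def
      using integral_norm_bound_ennreal[OF w_mild(2)[OF t, of j, unfolded set_integrable_def]] by simp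
    also have "\<dots> \<le> tconv gs 0 t j"
      unfolding tconv_def
    proof (rule nn_integral_mono)
      fix s
      show "ennreal \<bar>indicator {0..t} s *\<^sub>R (tker j (t - s) * GG j s)\<bar> \<le> ennreal (tker j (t - s)) * gs s * indicator {0..t} s"
        using GG_bound[of s j] tker_nonneg[of j "t - s"]
        by (cases "s \<in> {0..t}") (auto simp: abs_mult ennreal_mult mult_left_mono)
    qed
    finally show ?thesis by (simp add: add_left_mono)
  qed
  then have "AA t \<le> (\<Sum>j. ennreal \<bar>semi (t - 0) e0 j\<bar> + tconv gs 0 t j)"
    unfolding AA_def cf_abs_def by (intro suminf_le) auto
  also have "\<dots> = cf_abs (semi (t - 0) e0) + (\<Sum>j. tconv gs 0 t j)"
    unfolding cf_abs_def by (rule suminf_add[symmetric]) auto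
  finally show ?thesis .
qed

text \<open>The initial difference is handled by Cauchy-Schwarz over the modes and the Duhamel part
  by Young's inequality. As \<open>gs\<close> is already square integrable, nothing has to be
  absorbed and \<open>T\<close> may be large.\<close>

lemma AA_L2: "(\<integral>\<^sup>+t. (AA t)^2 * indicator {0..T} t \<partial>lborel) < \<infinity>"
proof -
  have [measurable]: "(\<lambda>t. cf_abs (semi (t - 0) e0)) \<in> borel_measurable borel" unfolding cf_abs_def semi_def by measurable
  have T: "0 \<le> T" using U.T0 by simp
  have 1: "(\<integral>\<^sup>+t. (cf_abs (semi (t - 0) e0))^2 * indicator {0..T} t \<partial>lborel) < \<infinity>"
  proof -
    have "(\<Sum>j. ennreal ((e0 j)^2)) = ennreal S0"
      using e0_sums unfolding sums_iff by (subst suminf_ennreal2) auto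
    then have "(\<integral>\<^sup>+t. (cf_abs (semi (t - 0) e0))^2 * indicator {0..T} t \<partial>lborel) \<le> ennreal (S0 * (\<Sum>j. if j = 0 then T else 1 / (real j)^2))"
      using T S0_nonneg by (intro semi_time_L2) auto
    then show ?thesis by (rule le_less_trans) simp
  qed
  have 2: "(\<integral>\<^sup>+t. (\<Sum>j. tconv gs 0 t j)^2 * indicator {0..T} t \<partial>lborel) < \<infinity>"
    by (rule le_less_trans[OF tconv_L2[OF gs_meas T]]) (use gs_L2 in \<open>simp add: ennreal_mult_less_top\<close>)
  have "(\<integral>\<^sup>+t. (AA t)^2 * indicator {0..T} t \<partial>lborel) \<le>
     (\<integral>\<^sup>+t. 2 * ((cf_abs (semi (t - 0) e0))^2 * indicator {0..T} t + (\<Sum>j. tconv gs 0 t j)^2 * indicator {0..T} t) \<partial>lborel)"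
  proof (rule nn_integral_mono)
    fix t
    have "(AA t)^2 \<le> 2 * ((cf_abs (semi (t - 0) e0))^2 + (\<Sum>j. tconv gs 0 t j)^2)" if "0 \<le> t"
      using power_mono[OF AA_bound[OF that], of 2] ennreal_sq_add[of "cf_abs (semi (t - 0) e0)" "\<Sum>j. tconv gs 0 t j"]
      by (auto intro: order_trans)
    then show "(AA t)^2 * indicator {0..T} t \<le> 2 * ((cf_abs (semi (t - 0) e0))^2 * indicator {0..T} t + (\<Sum>j. tconv gs 0 t j)^2 * indicator {0..T} t)"
      by (cases "t \<in> {0..T}") auto
  qed
  also have "\<dots> = 2 * (\<integral>\<^sup>+t. (cf_abs (semi (t - 0) e0))^2 * indicator {0..T} t + (\<Sum>j. tconv gs 0 t j)^2 * indicator {0..T} t \<partial>lborel)"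
    by (rule nn_integral_cmult) measurable
  also have "(\<integral>\<^sup>+t. (cf_abs (semi (t - 0) e0))^2 * indicator {0..T} t + (\<Sum>j. tconv gs 0 t j)^2 * indicator {0..T} t \<partial>lborel) =
      (\<integral>\<^sup>+t. (cf_abs (semi (t - 0) e0))^2 * indicator {0..T} t \<partial>lborel) + (\<integral>\<^sup>+t. (\<Sum>j. tconv gs 0 t j)^2 * indicator {0..T} t \<partial>lborel)"
    by (rule nn_integral_add) measurable
  finally show ?thesis using 1 2 by (auto simp: ennreal_mult_less_top elim!: le_less_trans)
qed

section \<open>The weighted energy estimate, mode by mode and summed\<close>

lemma w_continuous: "continuous_on UNIV (w j)"
  unfolding w_def[abs_def] by (intro continuous_on_diff U.cf_continuous V.cf_continuous)

lemma w_meas [measurable]: "w j \<in> borel_measurable borel"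
  by (rule borel_measurable_continuous_onI[OF w_continuous])

lemma AA_meas [measurable]: "AA \<in> borel_measurable borel"
  unfolding AA_def[abs_def] cf_abs_def by measurable

text \<open>Division by the positive continuous multiplier recovers the coefficient from its Duhamel
  integrand at time \<open>T\<close>. For \<open>j = 0\<close> that multiplier vanishes.\<close>

lemma GG_integrable: assumes "1 \<le> j" shows "set_integrable lborel {0..T} (GG j)"
proof -
  have l: "0 < lam j" using assms by (simp add: lam_def)
  have "set_integrable lborel {0..T} (\<lambda>s. (exp ((lam j)^2 * (T - s)) / lam j) * (tker j (T - s) * GG j s))"
    by (rule set_integrable_mult_continuous[OF w_mild(2)]) (use U.T0 l in \<open>auto intro!: continuous_intros\<close>)
  also have "(\<lambda>s. (exp ((lam j)^2 * (T - s)) / lam j) * (tker j (T - s) * GG j s)) = GG j"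
    using l by (auto simp: tker_def exp_minus)
  finally show ?thesis .
qed

text \<open>With \<open>c = 1 - L\<close> and \<open>l = lam j\<close>, half the time derivative of
  \<open>exp (2 c t) * (w j t)^2 / l\<close> is \<open>exp (2 c t)\<close> times
  \<open>- w G - (l - c / l) w^2\<close>. Replacing \<open>l - c / l\<close> by the smaller number
  \<open>L\<close> gives \<open>hh\<close>, whose sum over the modes is governed by the one-sided
  Lipschitz bound.\<close>

definition hh :: "nat \<Rightarrow> real \<Rightarrow> real" where
  "hh j t = exp (2 * (1 - L) * t) * (- (w j t * GG j t) - L * (w j t)^2)"

lemma energy_mode:
  shows "set_integrable lborel {0..T} (hh j)"
    "exp (2 * (1 - L) * T) * (w j T)^2 / lam j \<le> (e0 j)^2 + 2 * set_lebesgue_integral lborel {0..T} (hh j)"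
proof -
  have T: "0 \<le> T" using U.T0 by simp
  have "set_integrable lborel {0..T} (hh j) \<and>
    exp (2 * (1 - L) * T) * (w j T)^2 / lam j \<le> (e0 j)^2 + 2 * set_lebesgue_integral lborel {0..T} (hh j)"
  proof (cases "j = 0")
    \<comment> \<open>Division by \<open>lam 0 = 0\<close> gives 0 and mode 0 of the difference
      vanishes, so the inequality only says that a square is nonnegative.\<close>
    case True
    have z: "indicator {0..T} t *\<^sub>R hh j t = 0" for t
      using w_zero[of t] True by (cases "t \<in> {0..T}") (auto simp: hh_def)
    show ?thesis unfolding set_integrable_def set_lebesgue_integral_def z using True by (simp add: lam_def)
  next
    case False
    define c where "c = 1 - L"
    have c: "0 < c" "c \<le> 1" using L by (auto simp: c_def)
    define l where "l = lam j"
    have l: "1 \<le> l" using False by (simp add: l_def lam_def)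
    have wc: "continuous_on {0..T} (w j)" by (rule continuous_on_subset[OF w_continuous]) auto
    have Gi: "set_integrable lborel {0..T} (GG j)" using False by (intro GG_integrable) simp
    define z where "z t = exp (c * t) * w j t" for t
    define g where "g s = - l * exp (c * s) * GG j s" for s
    define \<nu> where "\<nu> = l^2 - c"
    have gi: "set_integrable lborel {0..T} g"
      unfolding g_def by (rule set_integrable_mult_continuous[OF Gi]) (intro continuous_intros)
    have zf: "z t = exp (- (\<nu> * t)) * e0 j + set_lebesgue_integral lborel {0..t} (\<lambda>s. exp (- (\<nu> * (t - s))) * g s)"
      if t: "0 \<le> t" "t \<le> T" for t
    proof -
      have "set_lebesgue_integral lborel {0..t} (\<lambda>s. exp (- (\<nu> * (t - s))) * g s) =
        set_lebesgue_integral lborel {0..t} (\<lambda>s. (- exp (c * t)) * (tker j (t - s) * GG j s))"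
      proof -
        have "exp (- (\<nu> * (t - s))) * g s = (- exp (c * t)) * (tker j (t - s) * GG j s)" for s
        proof -
          have "exp (- (\<nu> * (t - s))) * exp (c * s) = exp (c * t) * exp (- (l^2 * (t - s)))"
            by (simp add: \<nu>_def exp_add[symmetric] algebra_simps)
          then show ?thesis by (simp add: g_def tker_def l_def[symmetric])
        qed
        then show ?thesis by simp
      qed
      also have "\<dots> = - exp (c * t) * set_lebesgue_integral lborel {0..t} (\<lambda>s. tker j (t - s) * GG j s)"
        by (rule set_integral_mult_right)
      finally show ?thesis
        unfolding z_def w_mild(1)[OF t(1)]
        by (simp add: \<nu>_def l_def[symmetric] right_diff_distrib mult.assoc[symmetric] exp_add[symmetric]) (simp add: algebra_simps)
    qed
    have dq: "set_integrable lborel {0..T} (\<lambda>t. z t * (g t - \<nu> * z t))"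
      "(z T)^2 = (e0 j)^2 + 2 * set_lebesgue_integral lborel {0..T} (\<lambda>t. z t * (g t - \<nu> * z t))"
      using duhamel_square[OF T gi, of z \<nu> "e0 j"] zf by blast+
    have id: "1 / l * (z t * (g t - \<nu> * z t)) = hh j t - exp (2 * c * t) * ((l - c / l - L) * (w j t)^2)" for t
    proof -
      have e: "exp (2 * c * t) = exp (c * t) * exp (c * t)" by (simp add: exp_add[symmetric])
      show ?thesis unfolding z_def g_def \<nu>_def hh_def c_def[symmetric] e using l
        by (simp add: field_simps power2_eq_square)
    qed
    have hi: "set_integrable lborel {0..T} (hh j)"
    proof -
      have 1: "set_integrable lborel {0..T} (\<lambda>t. (- exp (2 * (1 - L) * t) * w j t) * GG j t)"
        by (rule set_integrable_mult_continuous[OF Gi]) (intro continuous_intros wc)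
      have 2: "set_integrable lborel {0..T} (\<lambda>t. exp (2 * (1 - L) * t) * (L * (w j t)^2))"
        by (rule borel_integrable_atLeastAtMost') (intro continuous_intros wc)
      have "hh j = (\<lambda>t. (- exp (2 * (1 - L) * t) * w j t) * GG j t - exp (2 * (1 - L) * t) * (L * (w j t)^2))"
        by (auto simp: hh_def algebra_simps)
      then show ?thesis using set_integral_diff(1)[OF 1 2] by simp
    qed
    have "exp (2 * c * T) * (w j T)^2 / l = 1 / l * (z T)^2"
      unfolding z_def by (simp add: power_mult_distrib exp_double[symmetric] mult.assoc)
    also have "\<dots> = (e0 j)^2 / l + 2 * set_lebesgue_integral lborel {0..T} (\<lambda>t. 1 / l * (z t * (g t - \<nu> * z t)))"
      unfolding dq(2) by (simp add: add_divide_distrib)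
    also have "\<dots> \<le> (e0 j)^2 + 2 * set_lebesgue_integral lborel {0..T} (hh j)"
    proof (intro add_mono mult_left_mono)
      have "(e0 j)^2 * 1 \<le> (e0 j)^2 * l" using l by (intro mult_left_mono) auto
      then show "(e0 j)^2 / l \<le> (e0 j)^2" using l by (simp add: divide_le_eq)
      show "set_lebesgue_integral lborel {0..T} (\<lambda>t. 1 / l * (z t * (g t - \<nu> * z t))) \<le> set_lebesgue_integral lborel {0..T} (hh j)"
      proof (rule set_integral_mono)
        show "set_integrable lborel {0..T} (\<lambda>t. 1 / l * (z t * (g t - \<nu> * z t)))"
          by (rule set_integrable_mult_right) (rule dq(1))
        fix t
        \<comment> \<open>The spectral gap: the first nonzero eigenvalue is 1, so
          \<open>l - c / l \<ge> 1 - c = L\<close>.\<close>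
        have "c / l \<le> c" using c l by (simp add: divide_le_eq mult_left_le_one_le)
        then have "0 \<le> l - c / l - L" using l by (simp add: c_def)
        then show "1 / l * (z t * (g t - \<nu> * z t)) \<le> hh j t" unfolding id by simp
      qed (rule hi)
    qed simp
    finally show ?thesis using hi unfolding c_def l_def by simp
  qed
  then show "set_integrable lborel {0..T} (hh j)"
    "exp (2 * (1 - L) * T) * (w j T)^2 / lam j \<le> (e0 j)^2 + 2 * set_lebesgue_integral lborel {0..T} (hh j)" by auto
qed

text \<open>All \<open>GG j\<close> share the bound \<open>gs\<close>, so the series is dominated by
  the coefficient sum \<open>AA\<close> times \<open>gs + AA\<close>. The dominating function is
  integrable in time because \<open>gs\<close> and \<open>AA\<close> are square integrable.\<close>

lemma hh_sum_bound:
  assumes t: "t \<in> {0..T}" and fin: "AA t \<noteq> \<infinity>" "gs t \<noteq> \<infinity>"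
  shows "summable (\<lambda>j. hh j t)"
    "\<bar>\<Sum>j<n. hh j t\<bar> \<le> exp (2 * T) * ((enn2real (gs t))^2 + 2 * (enn2real (AA t))^2)"
proof -
  have t0: "0 \<le> t" "t \<le> T" using t by auto
  define A where "A = (\<Sum>j. \<bar>w j t\<bar>)"
  have s: "summable (\<lambda>j. \<bar>w j t\<bar>)" and Aeq: "AA t = ennreal A"
    using cf_abs_finite[of "\<lambda>j. w j t"] fin(1) unfolding AA_def A_def by auto
  have A0: "0 \<le> A" unfolding A_def by (intro suminf_nonneg s) auto
  define G where "G = enn2real (gs t)"
  have Geq: "gs t = ennreal G" "0 \<le> G" unfolding G_def using fin(2) by (auto simp: less_top)
  have GGb: "\<bar>GG j t\<bar> \<le> G" for j using GG_bound[OF t0(1), of j] Geq by simp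
  have wA: "\<bar>w j t\<bar> \<le> A" for j unfolding A_def using sum_le_suminf[OF s, of "{j}"] by simp
  have hb: "\<bar>hh j t\<bar> \<le> exp (2 * T) * ((G + A) * \<bar>w j t\<bar>)" for j
  proof -
    have "\<bar>- (w j t * GG j t) - L * (w j t)^2\<bar> \<le> \<bar>w j t\<bar> * \<bar>GG j t\<bar> + L * (\<bar>w j t\<bar> * \<bar>w j t\<bar>)"
    proof -
      have "\<bar>- (w j t * GG j t) - L * (w j t)^2\<bar> \<le> \<bar>w j t * GG j t\<bar> + \<bar>L * (w j t)^2\<bar>" by linarith
      then show ?thesis using L(1) by (simp add: abs_mult power2_eq_square)
    qed
    also have "\<dots> \<le> \<bar>w j t\<bar> * G + 1 * (A * \<bar>w j t\<bar>)"
      using GGb wA L A0 by (intro add_mono mult_mono mult_right_mono) auto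
    also have "\<dots> = (G + A) * \<bar>w j t\<bar>" by (simp add: algebra_simps)
    finally have 1: "\<bar>- (w j t * GG j t) - L * (w j t)^2\<bar> \<le> (G + A) * \<bar>w j t\<bar>" .
    have "2 * (1 - L) * t \<le> 2 * T" using L t0 by (intro mult_mono) auto
    then show ?thesis unfolding hh_def abs_mult using 1 by (intro mult_mono) auto
  qed
  have sb: "summable (\<lambda>j. exp (2 * T) * ((G + A) * \<bar>w j t\<bar>))" by (intro summable_mult s)
  show "summable (\<lambda>j. hh j t)" by (rule summable_comparison_test'[OF sb, of 0]) (use hb in auto)
  have "\<bar>\<Sum>j<n. hh j t\<bar> \<le> (\<Sum>j<n. exp (2 * T) * ((G + A) * \<bar>w j t\<bar>))"
    by (rule order_trans[OF sum_abs]) (intro sum_mono hb)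
  also have "\<dots> = exp (2 * T) * ((G + A) * (\<Sum>j<n. \<bar>w j t\<bar>))" by (simp add: sum_distrib_left)
  also have "\<dots> \<le> exp (2 * T) * ((G + A) * A)"
    using Geq A0 unfolding A_def by (intro mult_left_mono sum_le_suminf s) auto
  also have "\<dots> \<le> exp (2 * T) * (G^2 + 2 * A^2)"
  proof (rule mult_left_mono)
    have "2 * G * A \<le> G^2 + A^2" by (rule sum_squares_bound)
    moreover have "0 \<le> G^2" "(G + A) * A = G * A + A^2" by (auto simp: power2_eq_square algebra_simps)
    ultimately show "(G + A) * A \<le> G^2 + 2 * A^2" using zero_le_power2[of A] by argo
  qed simp
  finally show "\<bar>\<Sum>j<n. hh j t\<bar> \<le> exp (2 * T) * ((enn2real (gs t))^2 + 2 * (enn2real (AA t))^2)"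
    unfolding Aeq Geq using A0 Geq by simp
qed

text \<open>At such a time the difference has an absolutely convergent series, hence is essentially
  bounded and can be paired with f(u) - f(v), which is only in L1. The modes add up to minus this
  pairing minus \<open>L\<close> times the squared L2 norm, and \<open>mono\<close> gives the
  sign.\<close>

lemma hh_suminf_nonpos:
  assumes t: "t \<in> {0<..T}" and fin: "AA t \<noteq> \<infinity>"
  shows "(\<Sum>j. hh j t) \<le> 0"
proof -
  have t0: "0 < t" "0 \<le> t" using t by auto
  let ?f = "cubic a0 a1 a2 a3"
  define d where "d x = u t x - v t x" for x
  define \<Delta> where "\<Delta> x = ?f (u t x) - ?f (v t x)" for x
  have d: "L2fun d" unfolding d_def by (intro L2fun_diff U.L2 V.L2 t0)
  have cfd: "cf d j = w j t" for j unfolding d_def w_def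
    using t0 U.L2[OF t0(2)] V.L2[OF t0(2)] by (simp add: L2inner_diff_left L2fun_phi)
  have s: "summable (\<lambda>j. \<bar>w j t\<bar>)" using cf_abs_finite(1)[of "\<lambda>j. w j t"] fin unfolding AA_def by auto
  have cfd': "cf d = (\<lambda>j. w j t)" using cfd by auto
  have ae: "AE x in lebI. d x = cseries (\<lambda>j. w j t) x"
  proof -
    have "summable (\<lambda>j. \<bar>cf d j\<bar>)" unfolding cfd by (rule s)
    from AE_eq_cseries[OF d this] show ?thesis unfolding cfd' .
  qed
  have Di: "integrable lebI \<Delta>" unfolding \<Delta>_def by (intro Bochner_Integration.integrable_diff U.fint V.fint t0)
  have bp: "integrable lebI (\<lambda>x. a x * phi j x)" if "integrable lebI a" for a :: "real \<Rightarrow> real" and j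
    by (rule Bochner_Integration.integrable_bound[OF that])
       (use that abs_phi_le in \<open>auto intro!: borel_measurable_times borel_measurable_lebI[OF phi_meas] AE_I2 simp: abs_mult mult_left_le\<close>)
  have Gj: "(\<integral>x. \<Delta> x * phi j x \<partial>lebI) = GG j t" for j
    unfolding \<Delta>_def GG_def U.FF_def V.FF_def L2inner_lebI left_diff_distrib
    by (intro Bochner_Integration.integral_diff bp U.fint V.fint t0)
  have 1: "(\<lambda>j. w j t * GG j t) sums (\<integral>x. \<Delta> x * cseries (\<lambda>j. w j t) x \<partial>lebI)"
    using cseries_integral[OF s Di] unfolding Gj .
  have 2: "(\<lambda>j. (w j t)^2) sums (\<integral>x. (d x)^2 \<partial>lebI)" using parseval[OF d] unfolding cfd .
  have Dc: "integrable lebI (\<lambda>x. \<Delta> x * cseries (\<lambda>j. w j t) x)"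
  proof (rule Bochner_Integration.integrable_bound[OF integrable_mult_right[OF Di, of "\<Sum>j. \<bar>w j t\<bar>"]])
    show "(\<lambda>x. \<Delta> x * cseries (\<lambda>j. w j t) x) \<in> borel_measurable lebI"
      using Di by (intro borel_measurable_times borel_measurable_lebI[OF cseries_meas]) auto
    show "AE x in lebI. norm (\<Delta> x * cseries (\<lambda>j. w j t) x) \<le> norm ((\<Sum>j. \<bar>w j t\<bar>) * \<Delta> x)"
    proof (rule AE_I2)
      fix x
      have "\<bar>\<Delta> x\<bar> * \<bar>cseries (\<lambda>j. w j t) x\<bar> \<le> \<bar>\<Delta> x\<bar> * \<bar>\<Sum>j. \<bar>w j t\<bar>\<bar>"
        using abs_cseries_le[OF s, of x] by (intro mult_left_mono) auto
      then show "norm (\<Delta> x * cseries (\<lambda>j. w j t) x) \<le> norm ((\<Sum>j. \<bar>w j t\<bar>) * \<Delta> x)" by (simp add: abs_mult mult.commute)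
    qed
  qed
  have "(\<integral>x. - L * (d x)^2 \<partial>lebI) \<le> (\<integral>x. \<Delta> x * cseries (\<lambda>j. w j t) x \<partial>lebI)"
  proof (rule integral_mono_AE)
    show "integrable lebI (\<lambda>x. - L * (d x)^2)" by (intro integrable_mult_right L2fun_sq d)
    show "AE x in lebI. - L * (d x)^2 \<le> \<Delta> x * cseries (\<lambda>j. w j t) x"
      using ae
    proof eventually_elim
      case (elim x)
      then show ?case using mono[of "u t x" "v t x"] unfolding \<Delta>_def by (simp add: d_def)
    qed
  qed (rule Dc)
  then have key: "- L * (\<integral>x. (d x)^2 \<partial>lebI) \<le> (\<integral>x. \<Delta> x * cseries (\<lambda>j. w j t) x \<partial>lebI)" by simp
  have "(\<lambda>j. hh j t) sums (exp (2 * (1 - L) * t) * (- (\<integral>x. \<Delta> x * cseries (\<lambda>j. w j t) x \<partial>lebI) - L * (\<integral>x. (d x)^2 \<partial>lebI)))"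
    unfolding hh_def by (intro sums_mult sums_diff sums_minus 1 2)
  then have "(\<Sum>j. hh j t) = exp (2 * (1 - L) * t) * (- (\<integral>x. \<Delta> x * cseries (\<lambda>j. w j t) x \<partial>lebI) - L * (\<integral>x. (d x)^2 \<partial>lebI))"
    by (simp add: sums_iff)
  also have "\<dots> \<le> 0" using key by (intro mult_nonneg_nonpos) auto
  finally show ?thesis .
qed

text \<open>A single mode suffices on the left, since all terms there are nonnegative. On the right
  the individual \<open>hh j\<close> have no sign, so all modes must be summed under the time
  integral, by dominated convergence, before \<open>hh_suminf_nonpos\<close> applies.\<close>

theorem contraction: "exp (2 * (1 - L) * T) * (w k T)^2 / lam k \<le> S0"
proof -
  have T: "0 \<le> T" using U.T0 by simp
  let ?I = "indicator {0..T} :: real \<Rightarrow> real"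
  define Hn where "Hn n t = ?I t *\<^sub>R (\<Sum>j<n. hh j t)" for n t
  define H where "H t = ?I t *\<^sub>R (\<Sum>j. hh j t)" for t
  define D where "D t = ?I t * (exp (2 * T) * ((enn2real (gs t))^2 + 2 * (enn2real (AA t))^2))" for t
  have hi: "integrable lborel (\<lambda>t. ?I t *\<^sub>R hh j t)" for j using energy_mode(1) unfolding set_integrable_def .
  have hm [measurable]: "(\<lambda>t. ?I t *\<^sub>R hh j t) \<in> borel_measurable borel" for j using borel_measurable_integrable[OF hi[of j]] by simp
  have Hneq: "Hn n = (\<lambda>t. \<Sum>j<n. ?I t *\<^sub>R hh j t)" for n unfolding Hn_def[abs_def] scaleR_sum_right ..
  have Heq: "H = (\<lambda>t. \<Sum>j. ?I t *\<^sub>R hh j t)"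
  proof
    fix t show "H t = (\<Sum>j. ?I t *\<^sub>R hh j t)" unfolding H_def by (cases "t \<in> {0..T}") auto
  qed
  have fin: "AE t in lborel. t \<in> {0..T} \<longrightarrow> AA t \<noteq> \<infinity> \<and> gs t \<noteq> \<infinity>"
  proof -
    have "AE t in lborel. (AA t)^2 * indicator {0..T} t \<noteq> \<infinity>"
      by (rule nn_integral_noteq_infinite) (use AA_L2 in auto)
    moreover have "AE t in lborel. (gs t)^2 * indicator {0..T} t \<noteq> \<infinity>"
      by (rule nn_integral_noteq_infinite) (use gs_L2 in auto)
    ultimately show ?thesis by eventually_elim (auto simp: power2_eq_square)
  qed
  have Dint: "integrable lborel D"
  proof (rule integrableI_bounded)
    show "D \<in> borel_measurable lborel" unfolding D_def[abs_def] by measurable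
    have le: "ennreal ((enn2real x)^2) \<le> x^2" for x :: ennreal
      by (cases x) (auto simp: ennreal_power)
    have "(\<integral>\<^sup>+t. ennreal (norm (D t)) \<partial>lborel) \<le> (\<integral>\<^sup>+t. ennreal (exp (2 * T)) * ((gs t)^2 * indicator {0..T} t + 2 * ((AA t)^2 * indicator {0..T} t)) \<partial>lborel)"
    proof (rule nn_integral_mono)
      fix t
      show "ennreal (norm (D t)) \<le> ennreal (exp (2 * T)) * ((gs t)^2 * indicator {0..T} t + 2 * ((AA t)^2 * indicator {0..T} t))"
      proof (cases "t \<in> {0..T}")
        case True
        then have "ennreal (norm (D t)) = ennreal (exp (2 * T)) * (ennreal ((enn2real (gs t))^2) + 2 * ennreal ((enn2real (AA t))^2))"
          unfolding D_def by (simp add: ennreal_mult)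
        also have "\<dots> \<le> ennreal (exp (2 * T)) * ((gs t)^2 + 2 * (AA t)^2)"
          by (intro mult_left_mono add_mono le) auto
        finally show ?thesis using True by simp
      qed (simp add: D_def)
    qed
    also have "\<dots> = ennreal (exp (2 * T)) * ((\<integral>\<^sup>+t. (gs t)^2 * indicator {0..T} t \<partial>lborel) + 2 * (\<integral>\<^sup>+t. (AA t)^2 * indicator {0..T} t \<partial>lborel))"
      by (simp add: nn_integral_cmult nn_integral_add)
    also have "\<dots> < \<infinity>" using gs_L2 AA_L2 by (simp add: ennreal_mult_less_top)
    finally show "(\<integral>\<^sup>+t. ennreal (norm (D t)) \<partial>lborel) < \<infinity>" .
  qed
  have lim: "(\<lambda>n. \<integral>t. Hn n t \<partial>lborel) \<longlonglongrightarrow> (\<integral>t. H t \<partial>lborel)"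
  proof (rule integral_dominated_convergence[OF _ _ Dint])
    show "H \<in> borel_measurable lborel" unfolding Heq by measurable
    show "Hn n \<in> borel_measurable lborel" for n unfolding Hneq by measurable
    show "AE t in lborel. (\<lambda>n. Hn n t) \<longlonglongrightarrow> H t"
      using fin
    proof eventually_elim
      case (elim t)
      show ?case
      proof (cases "t \<in> {0..T}")
        case True
        then show ?thesis unfolding Hn_def H_def using hh_sum_bound(1)[OF True] elim by (auto intro!: summable_LIMSEQ)
      qed (simp add: Hn_def H_def)
    qed
    show "AE t in lborel. norm (Hn n t) \<le> D t" for n
      using fin
    proof eventually_elim
      case (elim t)
      show ?case
      proof (cases "t \<in> {0..T}")
        case True
        then show ?thesis unfolding Hn_def D_def using hh_sum_bound(2)[OF True, of n] elim by auto
      qed (simp add: Hn_def D_def)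
    qed
  qed
  have Hle: "(\<integral>t. H t \<partial>lborel) \<le> 0"
  proof -
    \<comment> \<open>Time 0 is discarded as a null set, because the pairing with the nonlinearity
      is justified only for positive times.\<close>
    have "AE t in lborel. H t \<le> 0"
      using fin AE_lborel_singleton[of 0]
    proof eventually_elim
      case (elim t)
      show ?case
      proof (cases "t \<in> {0..T}")
        case True
        then show ?thesis unfolding H_def using hh_suminf_nonpos[of t] elim by auto
      qed (simp add: H_def)
    qed
    then have "0 \<le> (\<integral>t. - H t \<partial>lborel)" by (intro integral_nonneg_AE) (auto elim: eventually_mono)
    then show ?thesis by simp
  qed
  have step: "exp (2 * (1 - L) * T) * (w k T)^2 / lam k \<le> S0 + 2 * (\<integral>t. Hn n t \<partial>lborel)" if n: "k < n" for n
  proof -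
    have "exp (2 * (1 - L) * T) * (w k T)^2 / lam k \<le> (\<Sum>j<n. exp (2 * (1 - L) * T) * (w j T)^2 / lam j)"
      using n by (intro member_le_sum) (auto simp: lam_def)
    also have "\<dots> \<le> (\<Sum>j<n. (e0 j)^2 + 2 * set_lebesgue_integral lborel {0..T} (hh j))"
      by (intro sum_mono energy_mode)
    also have "\<dots> = (\<Sum>j<n. (e0 j)^2) + 2 * (\<integral>t. Hn n t \<partial>lborel)"
    proof -
      have "(\<integral>t. Hn n t \<partial>lborel) = (\<Sum>j<n. set_lebesgue_integral lborel {0..T} (hh j))"
        unfolding Hneq set_lebesgue_integral_def by (rule Bochner_Integration.integral_sum) (rule hi)
      then show ?thesis by (simp add: sum.distrib sum_distrib_left)
    qed
    also have "(\<Sum>j<n. (e0 j)^2) \<le> S0"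
      using e0_sums sum_le_suminf[of "\<lambda>j. (e0 j)^2" "{..<n}"] by (simp add: sums_iff)
    finally show ?thesis by simp
  qed
  have "(\<lambda>n. S0 + 2 * (\<integral>t. Hn n t \<partial>lborel)) \<longlonglongrightarrow> S0 + 2 * (\<integral>t. H t \<partial>lborel)"
    by (intro tendsto_intros lim)
  then have "exp (2 * (1 - L) * T) * (w k T)^2 / lam k \<le> S0 + 2 * (\<integral>t. H t \<partial>lborel)"
    by (rule LIMSEQ_le_const) (use step in \<open>auto intro!: exI[of _ "Suc k"]\<close>)
  then show ?thesis using Hle by simp
qed

end

section \<open>Uniqueness of the invariant measure\<close>


text \<open>Completing the square shows that the downward parabola is bounded above, so the supremum
  really is an upper bound. It is truncated below at 0 to obtain a nonnegative \<open>L\<close>, and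
  the mean value theorem concludes.\<close>

lemma cubic_one_sided_lipschitz:
  fixes a0 a1 a2 a3 :: real
  assumes a0: "0 < a0" and sup: "(SUP x::real. - (3 * a0 * x^2 + 2 * a1 * x + a2)) < 1"
  shows "\<exists>L. 0 \<le> L \<and> L < 1 \<and> (\<forall>x y. - L * (x - y)^2 \<le> (cubic a0 a1 a2 a3 x - cubic a0 a1 a2 a3 y) * (x - y))"
proof -
  let ?d = "\<lambda>x::real. 3 * a0 * x^2 + 2 * a1 * x + a2"
  define S where "S = (SUP x::real. - ?d x)"
  have bdd: "bdd_above (range (\<lambda>x. - ?d x))"
  proof (rule bdd_aboveI2)
    fix x :: real
    have "0 \<le> 3 * a0 * (x + a1 / (3 * a0))^2" using a0 by simp
    also have "\<dots> = 3 * a0 * x^2 + 2 * a1 * x + a1^2 / (3 * a0)" using a0 by (simp add: power2_eq_square field_simps)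
    finally show "- ?d x \<le> a1^2 / (3 * a0) - a2" by simp
  qed
  have le: "- ?d x \<le> S" for x unfolding S_def by (rule cSUP_upper[OF _ bdd]) simp
  define L where "L = max 0 S"
  have L: "0 \<le> L" "L < 1" "\<And>x. - L \<le> ?d x" using sup le unfolding L_def S_def[symmetric] by (auto simp: le_max_iff_disj intro: order_trans) (smt (verit) le)
  have der: "(cubic a0 a1 a2 a3 has_real_derivative ?d x) (at x)" for x
    unfolding cubic_def[abs_def] by (auto intro!: derivative_eq_intros)
  have lt: "- L * (x - y)^2 \<le> (cubic a0 a1 a2 a3 x - cubic a0 a1 a2 a3 y) * (x - y)" if yx: "y < x" for x y
  proof -
    obtain z where z: "cubic a0 a1 a2 a3 x - cubic a0 a1 a2 a3 y = (x - y) * ?d z"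
      using MVT2[OF yx, of "cubic a0 a1 a2 a3" ?d] der by blast
    have "- L * (x - y)^2 \<le> ?d z * (x - y)^2" using L(3)[of z] by (intro mult_right_mono) auto
    then show ?thesis unfolding z by (simp add: power2_eq_square ac_simps)
  qed
  have "- L * (x - y)^2 \<le> (cubic a0 a1 a2 a3 x - cubic a0 a1 a2 a3 y) * (x - y)" for x y
  proof (cases x y rule: linorder_cases)
    case less
    from lt[OF this] show ?thesis by (simp add: power2_commute[of x y] algebra_simps)
  next
    case greater
    then show ?thesis by (rule lt)
  qed simp
  with L(1,2) show ?thesis by blast
qed

text \<open>The noise bound has an exceptional set for each time horizon. With positive integers as
  horizons there are countably many, so one null set serves all of them and all modes; outside it
  the two paths form an instance of \<open>ch_pair\<close>.\<close>

lemma AE_contraction: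
  fixes M :: "'w measure" and \<beta> :: "nat \<Rightarrow> real \<Rightarrow> 'w \<Rightarrow> real"
  assumes M: "prob_space M" and a0: "0 < a0"
    and bm: "\<forall>j\<ge>1. std_brownian_motion M (\<beta> j)"
    and ms: "mild_solution M \<beta> \<sigma> (cubic a0 a1 a2 a3) u"
    and L: "0 \<le> L" "L < 1" "\<And>x y. - L * (x - y)^2 \<le> (cubic a0 a1 a2 a3 x - cubic a0 a1 a2 a3 y) * (x - y)"
    and v: "L2fun v1" "L2fun v2" "cf v1 0 = cf v2 0"
  shows "AE \<omega> in M. \<forall>N k. exp (2 * (1 - L) * real (Suc N)) * (cf (u v1 (real (Suc N)) \<omega>) k - cf (u v2 (real (Suc N)) \<omega>) k)^2 / lam k \<le> (\<integral>x. (v1 x - v2 x)^2 \<partial>lebI)"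
proof -
  have "AE \<omega> in M. \<forall>N. \<exists>\<Omega>. summable \<Omega> \<and> (\<forall>j\<ge>1. \<forall>t\<in>{0..real (Suc N)}. \<bar>wiener_conv ((lam j)^2) (\<beta> j) t \<omega>\<bar> \<le> \<Omega> j)"
    unfolding AE_all_countable using stochastic_convolution_summable[OF M bm] by blast
  moreover note ms[unfolded mild_solution_def, rule_format, OF v(1)] ms[unfolded mild_solution_def, rule_format, OF v(2)]
  ultimately show ?thesis
  proof eventually_elim
    case (elim \<omega>)
    show ?case
    proof (intro allI)
      fix N k
      define T where "T = real (Suc N)"
      have T: "0 < T" by (simp add: T_def)
      obtain \<Omega> where Om: "summable \<Omega>" "\<And>j t. j \<ge> 1 \<Longrightarrow> t \<in> {0..T} \<Longrightarrow> \<bar>wiener_conv ((lam j)^2) (\<beta> j) t \<omega>\<bar> \<le> \<Omega> j"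
        using spec[OF elim(1), of N, folded T_def] by (elim exE conjE) blast
      define noise where "noise j t = (if j = 0 then 0 else \<sigma> * wiener_conv ((lam j)^2) (\<beta> j) t \<omega>)" for j :: nat and t
      define Om' where "Om' j = (if j = 0 then 0 else \<bar>\<sigma>\<bar> * \<Omega> j)" for j :: nat
      have sOm: "summable Om'"
        using summable_mult[OF Om(1), of "\<bar>\<sigma>\<bar>"]
        by (subst summable_cong[of _ "\<lambda>j. \<bar>\<sigma>\<bar> * \<Omega> j"]) (auto simp: Om'_def eventually_sequentially intro!: exI[of _ 1])
      have nOm: "\<bar>noise j t\<bar> \<le> Om' j" if "0 \<le> t" "t \<le> T" for j t
        using Om(2)[of j t] that by (cases "j = 0") (auto simp: noise_def Om'_def abs_mult intro!: mult_left_mono)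
      have L2: "L2fun (u v1 t \<omega>)" "L2fun (u v2 t \<omega>)" if "0 \<le> t" for t using elim(2,3) that by blast+
      have ct: "((\<lambda>s. L2dist (u v1 s \<omega>) (u v1 t \<omega>)) \<longlongrightarrow> 0) (at t within {0..})"
        "((\<lambda>s. L2dist (u v2 s \<omega>) (u v2 t \<omega>)) \<longlongrightarrow> 0) (at t within {0..})" if "0 \<le> t" for t using elim(2,3) that by blast+
      obtain R1 where R1: "1 \<le> R1" "\<And>t. t \<in> {0..T} \<Longrightarrow> (\<integral>x. (u v1 t \<omega> x)^2 \<partial>lebI) \<le> R1"
        using L2_continuous_bounded[of "\<lambda>t. u v1 t \<omega>" T] L2(1) ct(1) T by (metis less_imp_le)
      obtain R2 where R2: "1 \<le> R2" "\<And>t. t \<in> {0..T} \<Longrightarrow> (\<integral>x. (u v2 t \<omega> x)^2 \<partial>lebI) \<le> R2"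
        using L2_continuous_bounded[of "\<lambda>t. u v2 t \<omega>" T] L2(2) ct(2) T by (metis less_imp_le)
      define R where "R = max R1 R2"
      have R: "1 \<le> R" "\<And>t. 0 \<le> t \<Longrightarrow> t \<le> T \<Longrightarrow> (\<integral>x. (u v1 t \<omega> x)^2 \<partial>lebI) \<le> R"
        "\<And>t. 0 \<le> t \<Longrightarrow> t \<le> T \<Longrightarrow> (\<integral>x. (u v2 t \<omega> x)^2 \<partial>lebI) \<le> R"
        unfolding R_def using R1 R2 by (auto simp: le_max_iff_disj)
      interpret U: ch_path T a0 a1 a2 a3 R "\<lambda>t. u v1 t \<omega>" "cf v1" noise Om'
      proof
        show "integrable lebI (\<lambda>x. cubic a0 a1 a2 a3 (u v1 t \<omega> x))" if "0 < t" for t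
          using elim(2) that unfolding set_integrable_lebI by blast
      qed (use T a0 R L2(1) ct(1) sOm nOm elim(2) in \<open>auto simp: noise_def\<close>)
      interpret V: ch_path T a0 a1 a2 a3 R "\<lambda>t. u v2 t \<omega>" "cf v2" noise Om'
      proof
        show "integrable lebI (\<lambda>x. cubic a0 a1 a2 a3 (u v2 t \<omega> x))" if "0 < t" for t
          using elim(3) that unfolding set_integrable_lebI by blast
      qed (use T a0 R L2(2) ct(2) sOm nOm elim(3) in \<open>auto simp: noise_def\<close>)
      interpret P: ch_pair T a0 a1 a2 a3 R "\<lambda>t. u v1 t \<omega>" "\<lambda>t. u v2 t \<omega>" v1 v2 noise Om' L
        by unfold_locales (rule v L)+
      have "max 0 T = T" using T by simp
      then show "exp (2 * (1 - L) * real (Suc N)) * (cf (u v1 (real (Suc N)) \<omega>) k - cf (u v2 (real (Suc N)) \<omega>) k)^2 / lam k \<le> (\<integral>x. (v1 x - v2 x)^2 \<partial>lebI)"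
        using P.contraction[of k] unfolding P.w_def P.S0_def T_def[symmetric] by simp
    qed
  qed
qed

section \<open>The L2 pseudometric, its Lipschitz functions and finite-mode projections\<close>

lemma HspaceD: "v \<in> Hspace \<alpha> \<Longrightarrow> L2fun v" by (simp add: Hspace_def)

lemma cf_zero_mean: "cf v 0 = sqrt pi * spatial_mean v"
proof -
  have "cf v 0 = 1 / sqrt pi * (\<integral>x. v x \<partial>lebI)" unfolding L2inner_lebI phi_def by simp
  moreover have "spatial_mean v = 1 / pi * (\<integral>x. v x \<partial>lebI)" unfolding spatial_mean_def set_integral_lebI ..
  moreover have "1 / sqrt pi = sqrt pi * (1 / pi)" by (simp add: real_div_sqrt field_simps)
  ultimately show ?thesis by (metis mult.assoc)
qed

lemma Hspace_cf: "v \<in> Hspace \<alpha> \<Longrightarrow> cf v 0 = sqrt pi * \<alpha>"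
  by (simp add: cf_zero_mean Hspace_def)

lemma HspaceI: "L2fun v \<Longrightarrow> cf v 0 = sqrt pi * \<alpha> \<Longrightarrow> v \<in> Hspace \<alpha>"
  using cf_zero_mean[of v] by (simp add: Hspace_def)

lemma L2_cauchy_schwarz:
  assumes "L2fun f" "L2fun g" shows "L2inner f g \<le> sqrt (L2inner f f) * sqrt (L2inner g g)"
proof -
  define A B C where "A = L2inner f f" and "B = L2inner g g" and "C = L2inner f g"
  have nn: "0 \<le> A" "0 \<le> B" unfolding A_def B_def L2inner_self by (auto intro: integral_nonneg_AE)
  have q: "0 \<le> A - 2 * t * C + t^2 * B" for t
  proof -
    have "0 \<le> (\<integral>x. (f x - t * g x)^2 \<partial>lebI)" by (intro integral_nonneg_AE) auto
    also have "\<dots> = (\<integral>x. f x * f x - 2 * t * (f x * g x) + t^2 * (g x * g x) \<partial>lebI)"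
      by (intro Bochner_Integration.integral_cong) (auto simp: power2_eq_square algebra_simps)
    also have "\<dots> = A - 2 * t * C + t^2 * B"
      unfolding A_def B_def C_def L2inner_lebI using assms by (simp add: L2fun_mult)
    finally show ?thesis .
  qed
  have "C^2 \<le> A * B"
  proof (cases "B = 0")
    case True
    have "C = 0"
    proof (rule ccontr)
      assume "C \<noteq> 0"
      \<comment> \<open>For \<open>B = 0\<close> the quadratic is affine in \<open>t\<close>, and
        this choice gives it the value -1.\<close>
      then show False using q[of "(A + 1) / (2 * C)"] True nn by (simp add: field_simps)
    qed
    then show ?thesis using True by simp
  next
    case False
    then have "0 < B" using nn by simp
    then show ?thesis using q[of "C / B"] by (simp add: power2_eq_square field_simps)
  qed
  then have "\<bar>C\<bar> \<le> sqrt (A * B)" by (simp add: real_le_rsqrt)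
  then show ?thesis unfolding A_def[symmetric] B_def[symmetric] C_def[symmetric] by (simp add: real_sqrt_mult)
qed

lemma L2dist_triangle:
  assumes "L2fun f" "L2fun g" "L2fun h" shows "L2dist f h \<le> L2dist f g + L2dist g h"
proof -
  let ?a = "\<lambda>x. f x - g x" and ?b = "\<lambda>x. g x - h x"
  have a: "L2fun ?a" "L2fun ?b" using assms by (auto intro: L2fun_diff)
  have d: "L2dist f g = sqrt (L2inner ?a ?a)" "L2dist g h = sqrt (L2inner ?b ?b)"
    unfolding L2dist_lebI L2inner_self by auto
  have "(\<integral>x. (f x - h x)^2 \<partial>lebI) = (\<integral>x. ?a x * ?a x + 2 * (?a x * ?b x) + ?b x * ?b x \<partial>lebI)"
    by (intro Bochner_Integration.integral_cong) (auto simp: power2_eq_square algebra_simps)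
  also have "\<dots> = L2inner ?a ?a + 2 * L2inner ?a ?b + L2inner ?b ?b"
    unfolding L2inner_lebI using L2fun_mult[OF a(1) a(1)] L2fun_mult[OF a(1) a(2)] L2fun_mult[OF a(2) a(2)] by simp
  also have "\<dots> \<le> L2inner ?a ?a + 2 * (sqrt (L2inner ?a ?a) * sqrt (L2inner ?b ?b)) + L2inner ?b ?b"
    using L2_cauchy_schwarz[OF a] by simp
  also have "\<dots> = (L2dist f g + L2dist g h)^2"
  proof -
    have "0 \<le> L2inner ?a ?a" "0 \<le> L2inner ?b ?b" unfolding L2inner_self by (auto intro: integral_nonneg_AE)
    then show ?thesis unfolding d by (simp add: power2_sum)
  qed
  finally show ?thesis unfolding L2dist_lebI[of f h]
    by (rule real_le_lsqrt[rotated]) (auto simp: L2dist_lebI)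
qed

lemma L2dist_commute: "L2dist f g = L2dist g f"
  unfolding L2dist_lebI by (simp add: power2_commute)

lemma L2dist_nonneg: "0 \<le> L2dist f g"
  unfolding L2dist_lebI by simp

lemma L2dist_self: "L2dist f f = 0"
  unfolding L2dist_lebI by simp

lemma space_Hmeas: "space (Hmeas \<alpha>) = Hspace \<alpha>"
  unfolding Hmeas_def by (subst space_measure_of) (auto simp: Hopen_def)

lemma sets_Hmeas: "sets (Hmeas \<alpha>) = sigma_sets (Hspace \<alpha>) {U. Hopen \<alpha> U}"
  unfolding Hmeas_def by (subst sets_measure_of) (auto simp: Hopen_def)

text \<open>Lipschitz for a pseudometric: such functions take equal values on representatives that
  agree almost everywhere, so they live on the quotient.\<close>

definition Hlip :: "real \<Rightarrow> real \<Rightarrow> ((real \<Rightarrow> real) \<Rightarrow> real) \<Rightarrow> bool" where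
  "Hlip \<alpha> K \<phi> \<longleftrightarrow> 0 \<le> K \<and> (\<forall>v\<in>Hspace \<alpha>. \<forall>w\<in>Hspace \<alpha>. \<bar>\<phi> v - \<phi> w\<bar> \<le> K * L2dist v w)"

lemma Hlip_measurable: assumes "Hlip \<alpha> K \<phi>" shows "\<phi> \<in> borel_measurable (Hmeas \<alpha>)"
  unfolding borel_measurable_iff_greater
proof
  fix c
  have "Hopen \<alpha> {v \<in> Hspace \<alpha>. c < \<phi> v}"
    unfolding Hopen_def
  proof (intro conjI ballI)
    fix v assume v: "v \<in> {v \<in> Hspace \<alpha>. c < \<phi> v}"
    have K: "0 \<le> K" using assms by (simp add: Hlip_def)
    define e where "e = (\<phi> v - c) / (K + 1)"
    have e: "0 < e" unfolding e_def using v K by simp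
    have "w \<in> {v \<in> Hspace \<alpha>. c < \<phi> v}" if w: "w \<in> Hspace \<alpha>" "L2dist v w < e" for w
    proof -
      have "\<bar>\<phi> v - \<phi> w\<bar> \<le> K * L2dist v w" using assms v w by (auto simp: Hlip_def)
      also have "\<dots> \<le> K * e" using K w by (intro mult_left_mono) auto
      also have "\<dots> < (K + 1) * e" using e by (simp add: distrib_right)
      also have "\<dots> = \<phi> v - c" unfolding e_def using K by simp
      finally show ?thesis using w by auto
    qed
    with e show "\<exists>e>0. \<forall>w\<in>Hspace \<alpha>. L2dist v w < e \<longrightarrow> w \<in> {v \<in> Hspace \<alpha>. c < \<phi> v}" by blast
  qed auto
  then show "{v \<in> space (Hmeas \<alpha>). c < \<phi> v} \<in> sets (Hmeas \<alpha>)"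
    unfolding space_Hmeas sets_Hmeas by auto
qed

definition proj :: "nat \<Rightarrow> (real \<Rightarrow> real) \<Rightarrow> real \<Rightarrow> real" where
  "proj m v x = (\<Sum>j<m. cf v j * phi j x)"

lemma L2fun_proj: "L2fun (proj m v)"
  unfolding proj_def[abs_def] by (intro L2fun_sum L2fun_scale L2fun_phi)

lemma cf_proj: "cf (proj m v) j = (if j < m then cf v j else 0)"
  unfolding proj_def[abs_def]
  by (subst L2inner_sum_left) (auto intro: L2fun_scale L2fun_phi simp: L2inner_scale_left integral_phi_phi if_distrib sum.delta cong: if_cong)

text \<open>A positive \<open>m\<close> keeps mode 0, which carries the spatial mean.\<close>

lemma proj_Hspace: assumes "v \<in> Hspace \<alpha>" "0 < m" shows "proj m v \<in> Hspace \<alpha>"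
  using assms by (intro HspaceI L2fun_proj) (simp add: cf_proj Hspace_cf)

lemma L2dist_proj:
  assumes "L2fun v" "L2fun w"
  shows "L2dist (proj m v) (proj m w) = sqrt (\<Sum>j<m. (cf v j - cf w j)^2)"
proof -
  have 1: "(\<lambda>j. (cf (\<lambda>x. proj m v x - proj m w x) j)^2) sums (\<integral>x. (proj m v x - proj m w x)^2 \<partial>lebI)"
    by (intro parseval L2fun_diff L2fun_proj)
  have 2: "(\<lambda>j. (cf (\<lambda>x. proj m v x - proj m w x) j)^2) = (\<lambda>j. if j \<in> {..<m} then (cf v j - cf w j)^2 else 0)"
    by (auto simp: L2inner_diff_left L2fun_proj L2fun_phi cf_proj)
  have 3: "(\<lambda>j. if j \<in> {..<m} then (cf v j - cf w j)^2 else 0) sums (\<Sum>j\<in>{..<m}. (cf v j - cf w j)^2)"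
    by (rule sums_If_finite_set) simp
  have "(\<integral>x. (proj m v x - proj m w x)^2 \<partial>lebI) = (\<Sum>j<m. (cf v j - cf w j)^2)"
    using 1 unfolding 2 by (rule sums_unique2) (rule 3)
  then show ?thesis unfolding L2dist_lebI by simp
qed

lemma L2dist_proj_le: assumes "L2fun v" "L2fun w" shows "L2dist (proj m v) (proj m w) \<le> L2dist v w"
proof -
  have "(\<Sum>j<m. (cf v j - cf w j)^2) \<le> (\<integral>x. (v x - w x)^2 \<partial>lebI)"
    using bessel[OF L2fun_diff[OF assms], of m] assms by (simp add: L2inner_diff_left L2fun_phi)
  then show ?thesis unfolding L2dist_proj[OF assms] unfolding L2dist_lebI by simp
qed

lemma L2dist_proj_lim: assumes "L2fun v" shows "(\<lambda>m. L2dist (proj m v) v) \<longlonglongrightarrow> 0"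
proof -
  have eq: "L2dist (proj m v) v = sqrt ((\<integral>x. (v x)^2 \<partial>lebI) - (\<Sum>j<m. (cf v j)^2))" for m
    unfolding L2dist_commute[of "proj m v" v] L2dist_lebI[of v] proj_def integral_diff_trig[OF assms] by simp
  have "(\<lambda>m. (\<integral>x. (v x)^2 \<partial>lebI) - (\<Sum>j<m. (cf v j)^2)) \<longlonglongrightarrow> (\<integral>x. (v x)^2 \<partial>lebI) - (\<integral>x. (v x)^2 \<partial>lebI)"
    using parseval[OF assms] unfolding sums_def by (intro tendsto_intros)
  then have "(\<lambda>m. sqrt ((\<integral>x. (v x)^2 \<partial>lebI) - (\<Sum>j<m. (cf v j)^2))) \<longlonglongrightarrow> sqrt 0"
    by (intro tendsto_real_sqrt) simp
  then show ?thesis unfolding eq by simp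
qed

lemma Hlip_proj: assumes "Hlip \<alpha> K \<phi>" "0 < m" shows "Hlip \<alpha> K (\<lambda>v. \<phi> (proj m v))"
  unfolding Hlip_def
proof (intro conjI ballI)
  show K: "0 \<le> K" using assms by (simp add: Hlip_def)
  fix v w assume v: "v \<in> Hspace \<alpha>" and w: "w \<in> Hspace \<alpha>"
  have "\<bar>\<phi> (proj m v) - \<phi> (proj m w)\<bar> \<le> K * L2dist (proj m v) (proj m w)"
    using assms v w by (auto simp: Hlip_def proj_Hspace)
  also have "\<dots> \<le> K * L2dist v w" using K v w by (intro mult_left_mono L2dist_proj_le HspaceD) auto
  finally show "\<bar>\<phi> (proj m v) - \<phi> (proj m w)\<bar> \<le> K * L2dist v w" .
qed

text \<open>Bounded Lipschitz functions determine a Borel measure on a metric space: approximate the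
indicator of an open set by truncated multiples of the distance to its complement.\<close>

lemma measure_eqI_Hlip:
  assumes \<mu>1: "prob_space \<mu>1" "sets \<mu>1 = sets (Hmeas \<alpha>)" and \<mu>2: "prob_space \<mu>2" "sets \<mu>2 = sets (Hmeas \<alpha>)"
    and eq: "\<And>\<phi> K. Hlip \<alpha> K \<phi> \<Longrightarrow> (\<And>v. v \<in> Hspace \<alpha> \<Longrightarrow> \<bar>\<phi> v\<bar> \<le> 1) \<Longrightarrow> (\<integral>v. \<phi> v \<partial>\<mu>1) = (\<integral>v. \<phi> v \<partial>\<mu>2)"
  shows "\<mu>1 = \<mu>2"
proof -
  interpret M1: prob_space \<mu>1 by fact
  interpret M2: prob_space \<mu>2 by fact
  have sp: "space \<mu>1 = Hspace \<alpha>" "space \<mu>2 = Hspace \<alpha>"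
    using sets_eq_imp_space_eq[OF \<mu>1(2)] sets_eq_imp_space_eq[OF \<mu>2(2)] by (auto simp: space_Hmeas)
  have open_eq: "emeasure \<mu>1 U = emeasure \<mu>2 U" if U: "Hopen \<alpha> U" for U
  proof (cases "Hspace \<alpha> - U = {}")
    \<comment> \<open>For the whole space the complement is empty and the infimum that defines the
      distance would be meaningless; both measures simply have mass 1.\<close>
    case True
    then have "U = Hspace \<alpha>" using U by (auto simp: Hopen_def)
    then show ?thesis using M1.emeasure_space_1 M2.emeasure_space_1 sp by simp
  next
    case False
    have Us: "U \<subseteq> Hspace \<alpha>" using U by (simp add: Hopen_def)
    have Um: "U \<in> sets \<mu>1" "U \<in> sets \<mu>2" using U unfolding \<mu>1(2) \<mu>2(2) sets_Hmeas by auto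
    define dU where "dU v = (INF w\<in>Hspace \<alpha> - U. L2dist v w)" for v
    have bdd: "bdd_below ((\<lambda>w. L2dist v w) ` A)" for v A by (rule bdd_belowI2[of _ 0]) (rule L2dist_nonneg)
    have d0: "0 \<le> dU v" for v unfolding dU_def using False by (intro cINF_greatest L2dist_nonneg) auto
    have dlip1: "dU v \<le> dU w + L2dist v w" if "v \<in> Hspace \<alpha>" "w \<in> Hspace \<alpha>" for v w
    proof -
      have "dU v - L2dist v w \<le> L2dist w y" if y: "y \<in> Hspace \<alpha> - U" for y
      proof -
        have "dU v \<le> L2dist v y" unfolding dU_def by (rule cINF_lower[OF bdd y])
        also have "\<dots> \<le> L2dist v w + L2dist w y" using that \<open>v \<in> _\<close> \<open>w \<in> _\<close> y by (intro L2dist_triangle HspaceD) auto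
        finally show ?thesis by simp
      qed
      then have "dU v - L2dist v w \<le> dU w" unfolding dU_def[of w] using False by (intro cINF_greatest) auto
      then show ?thesis by simp
    qed
    have dlip: "\<bar>dU v - dU w\<bar> \<le> L2dist v w" if "v \<in> Hspace \<alpha>" "w \<in> Hspace \<alpha>" for v w
      using dlip1[OF that] dlip1[OF that(2,1)] L2dist_commute[of v w] by linarith
    define \<phi> where "\<phi> k v = min 1 (real k * dU v)" for k v
    have lip: "Hlip \<alpha> (real k) (\<phi> k)" for k
      unfolding Hlip_def
    proof (intro conjI ballI)
      fix v w assume vw: "v \<in> Hspace \<alpha>" "w \<in> Hspace \<alpha>"
      have "\<bar>\<phi> k v - \<phi> k w\<bar> \<le> \<bar>real k * dU v - real k * dU w\<bar>" unfolding \<phi>_def by linarith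
      also have "\<dots> = real k * \<bar>dU v - dU w\<bar>" by (simp add: right_diff_distrib[symmetric] abs_mult)
      also have "\<dots> \<le> real k * L2dist v w" using dlip[OF vw] by (intro mult_left_mono) auto
      finally show "\<bar>\<phi> k v - \<phi> k w\<bar> \<le> real k * L2dist v w" .
    qed simp
    have b: "\<bar>\<phi> k v\<bar> \<le> 1" for k v unfolding \<phi>_def using d0[of v] by auto
    have pm: "\<phi> k \<in> borel_measurable \<mu>1" "\<phi> k \<in> borel_measurable \<mu>2" for k
      unfolding measurable_cong_sets[OF \<mu>1(2) refl] measurable_cong_sets[OF \<mu>2(2) refl]
      by (rule Hlip_measurable[OF lip])+
    have lim: "(\<lambda>k. \<phi> k v) \<longlonglongrightarrow> indicat_real U v" if v: "v \<in> Hspace \<alpha>" for v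
    proof (cases "v \<in> U")
      case True
      then obtain e where e: "e > 0" "\<And>w. w \<in> Hspace \<alpha> \<Longrightarrow> L2dist v w < e \<Longrightarrow> w \<in> U" using U unfolding Hopen_def by blast
      have "e \<le> dU v" unfolding dU_def using False e(2) by (intro cINF_greatest) (auto simp: not_less[symmetric])
      obtain n :: nat where n: "1 / e \<le> real n" using real_arch_simple by blast
      have "\<phi> k v = indicat_real U v" if "k \<ge> n" for k
      proof -
        have "1 \<le> real n * e" using n e(1) by (simp add: divide_le_eq)
        also have "\<dots> \<le> real k * dU v" using that e(1) \<open>e \<le> dU v\<close> by (intro mult_mono) auto
        finally show ?thesis using True by (simp add: \<phi>_def)
      qed
      then show ?thesis by (intro tendsto_eventually eventually_sequentiallyI[of n])
    next
      case False
      then have "dU v \<le> L2dist v v" unfolding dU_def using v by (intro cINF_lower bdd) auto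
      then have "dU v = 0" using d0[of v] by (simp add: L2dist_self)
      then show ?thesis using False by (simp add: \<phi>_def)
    qed
    have l1: "(\<lambda>k. \<integral>v. \<phi> k v \<partial>\<mu>1) \<longlonglongrightarrow> (\<integral>v. indicat_real U v \<partial>\<mu>1)"
      by (rule integral_dominated_convergence[where w="\<lambda>_. 1"]) (use pm Um b lim sp in auto)
    have l2: "(\<lambda>k. \<integral>v. \<phi> k v \<partial>\<mu>2) \<longlonglongrightarrow> (\<integral>v. indicat_real U v \<partial>\<mu>2)"
      by (rule integral_dominated_convergence[where w="\<lambda>_. 1"]) (use pm Um b lim sp in auto)
    have "(\<integral>v. \<phi> k v \<partial>\<mu>1) = (\<integral>v. \<phi> k v \<partial>\<mu>2)" for k using lip b by (intro eq)
    then have "(\<integral>v. indicat_real U v \<partial>\<mu>1) = (\<integral>v. indicat_real U v \<partial>\<mu>2)"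
      using l1 l2 LIMSEQ_unique by simp
    then have "measure \<mu>1 U = measure \<mu>2 U" using Um by simp
    then show ?thesis by (simp add: M1.emeasure_eq_measure M2.emeasure_eq_measure)
  qed
  show ?thesis
  proof (rule measure_eqI_generator_eq[where E="{U. Hopen \<alpha> U}" and \<Omega>="Hspace \<alpha>" and A="\<lambda>_. Hspace \<alpha>"])
    show "Int_stable {U. Hopen \<alpha> U}"
    proof (rule Int_stableI)
      fix a b assume "a \<in> {U. Hopen \<alpha> U}" "b \<in> {U. Hopen \<alpha> U}"
      then have ab: "Hopen \<alpha> a" "Hopen \<alpha> b" by auto
      have "\<exists>e>0. \<forall>w\<in>Hspace \<alpha>. L2dist v w < e \<longrightarrow> w \<in> a \<inter> b" if vab: "v \<in> a \<inter> b" for v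
      proof -
        have "\<exists>e>0. \<forall>w\<in>Hspace \<alpha>. L2dist v w < e \<longrightarrow> w \<in> a" using ab(1) vab unfolding Hopen_def by simp
        then obtain e1 where e1: "e1 > 0" "\<forall>w\<in>Hspace \<alpha>. L2dist v w < e1 \<longrightarrow> w \<in> a" by blast
        have "\<exists>e>0. \<forall>w\<in>Hspace \<alpha>. L2dist v w < e \<longrightarrow> w \<in> b" using ab(2) vab unfolding Hopen_def by simp
        then obtain e2 where e2: "e2 > 0" "\<forall>w\<in>Hspace \<alpha>. L2dist v w < e2 \<longrightarrow> w \<in> b" by blast
        show ?thesis by (rule exI[of _ "min e1 e2"]) (use e1 e2 in auto)
      qed
      then show "a \<inter> b \<in> {U. Hopen \<alpha> U}" using ab unfolding Hopen_def by auto
    qed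
    show "{U. Hopen \<alpha> U} \<subseteq> Pow (Hspace \<alpha>)" by (auto simp: Hopen_def)
    show "sets \<mu>1 = sigma_sets (Hspace \<alpha>) {U. Hopen \<alpha> U}" "sets \<mu>2 = sigma_sets (Hspace \<alpha>) {U. Hopen \<alpha> U}"
      using \<mu>1 \<mu>2 sets_Hmeas by auto
    show "range (\<lambda>_. Hspace \<alpha>) \<subseteq> {U. Hopen \<alpha> U}" by (auto simp: Hopen_def intro: exI[of _ 1])
    show "emeasure \<mu>1 U = emeasure \<mu>2 U" if "U \<in> {U. Hopen \<alpha> U}" for U using that open_eq by auto
  qed auto
qed

text \<open>By invariance the difference of the two integrals equals, for every \<open>n\<close>,
  the double integral of the difference of the semigroup at two starting points. This integrand is
  bounded and tends to 0.\<close>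

lemma invariant_integral_eq:
  fixes M :: "'w measure"
  assumes M: "prob_space M"
    and meas: "\<And>t. 0 \<le> t \<Longrightarrow> (\<lambda>(v, \<omega>). u v t \<omega>) \<in> Hmeas \<alpha> \<Otimes>\<^sub>M M \<rightarrow>\<^sub>M Hmeas \<alpha>"
    and conv: "\<And>v1 v2 k. v1 \<in> Hspace \<alpha> \<Longrightarrow> v2 \<in> Hspace \<alpha> \<Longrightarrow>
       AE \<omega> in M. (\<lambda>n. cf (u v1 (real (Suc n)) \<omega>) k - cf (u v2 (real (Suc n)) \<omega>) k) \<longlonglongrightarrow> 0"
    and i1: "invariant_measure M u \<alpha> \<mu>1" and i2: "invariant_measure M u \<alpha> \<mu>2"
    and lip: "Hlip \<alpha> K \<phi>" and b: "\<And>v. v \<in> Hspace \<alpha> \<Longrightarrow> \<bar>\<phi> v\<bar> \<le> 1"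
  shows "(\<integral>v. \<phi> v \<partial>\<mu>1) = (\<integral>v. \<phi> v \<partial>\<mu>2)"
proof -
  interpret prob_space M by (rule M)
  have p1: "prob_space \<mu>1" "sets \<mu>1 = sets (Hmeas \<alpha>)" and p2: "prob_space \<mu>2" "sets \<mu>2 = sets (Hmeas \<alpha>)"
    using i1 i2 unfolding invariant_measure_def by auto
  interpret M1: prob_space \<mu>1 by (rule p1)
  interpret M2: prob_space \<mu>2 by (rule p2)
  have sp: "space \<mu>1 = Hspace \<alpha>" "space \<mu>2 = Hspace \<alpha>"
    using sets_eq_imp_space_eq[OF p1(2)] sets_eq_imp_space_eq[OF p2(2)] by (auto simp: space_Hmeas)
  have mcong: "f \<in> borel_measurable \<mu>1" "f \<in> borel_measurable \<mu>2" if "f \<in> borel_measurable (Hmeas \<alpha>)" for f :: "(real \<Rightarrow> real) \<Rightarrow> real"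
    using that unfolding measurable_cong_sets[OF p1(2) refl] measurable_cong_sets[OF p2(2) refl] by auto
  have K: "0 \<le> K" using lip by (simp add: Hlip_def)
  have fin: "(\<integral>v. \<phi> (proj m v) \<partial>\<mu>1) = (\<integral>v. \<phi> (proj m v) \<partial>\<mu>2)" if m: "0 < m" for m
  proof -
    \<comment> \<open>Each coefficient converges separately, with no uniformity over the modes
      assumed in \<open>conv\<close>. The test function is therefore made to depend on the first
      \<open>m\<close> coefficients only.\<close>
    define \<psi> where "\<psi> v = \<phi> (proj m v)" for v
    have plip: "Hlip \<alpha> K \<psi>" unfolding \<psi>_def[abs_def] by (rule Hlip_proj[OF lip m])
    have pmeas: "\<psi> \<in> borel_measurable (Hmeas \<alpha>)" by (rule Hlip_measurable[OF plip])
    have pb: "\<bar>\<psi> v\<bar> \<le> 1" if "v \<in> Hspace \<alpha>" for v unfolding \<psi>_def using that m by (intro b proj_Hspace)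
    define g where "g n v = trans_sg M u (real (Suc n)) \<psi> v" for n v
    have jm: "(\<lambda>(v, \<omega>). \<psi> (u v (real (Suc n)) \<omega>)) \<in> borel_measurable (Hmeas \<alpha> \<Otimes>\<^sub>M M)" for n
      using measurable_compose[OF meas[of "real (Suc n)"] pmeas] by (simp add: case_prod_unfold)
    have gm: "g n \<in> borel_measurable (Hmeas \<alpha>)" for n
      unfolding g_def[abs_def] trans_sg_def by (rule borel_measurable_lebesgue_integral[OF jm])
    have um: "(\<lambda>\<omega>. u v (real (Suc n)) \<omega>) \<in> M \<rightarrow>\<^sub>M Hmeas \<alpha>" if v: "v \<in> Hspace \<alpha>" for v n
      using measurable_compose[OF measurable_Pair1'[of v "Hmeas \<alpha>" M] meas[of "real (Suc n)"]] v by (simp add: space_Hmeas)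
    have uH: "u v (real (Suc n)) \<omega> \<in> Hspace \<alpha>" if "v \<in> Hspace \<alpha>" "\<omega> \<in> space M" for v n \<omega>
      using measurable_space[OF um[OF that(1), of n] that(2)] by (simp add: space_Hmeas)
    have psm: "(\<lambda>\<omega>. \<psi> (u v (real (Suc n)) \<omega>)) \<in> borel_measurable M" if "v \<in> Hspace \<alpha>" for v n
      by (rule measurable_compose[OF um[OF that] pmeas])
    have psi: "integrable M (\<lambda>\<omega>. \<psi> (u v (real (Suc n)) \<omega>))" if "v \<in> Hspace \<alpha>" for v n
      by (rule integrable_const_bound[of _ 1]) (use that uH pb psm in \<open>auto intro!: AE_I2\<close>)
    have gb: "\<bar>g n v\<bar> \<le> 1" if v: "v \<in> Hspace \<alpha>" for n v
    proof -
      have "\<bar>g n v\<bar> \<le> (\<integral>\<omega>. \<bar>\<psi> (u v (real (Suc n)) \<omega>)\<bar> \<partial>M)" unfolding g_def trans_sg_def by (rule integral_abs_bound)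
      also have "\<dots> \<le> (\<integral>\<omega>. 1 \<partial>M)"
        using psi[OF v] uH[OF v] pb by (intro integral_mono) auto
      finally show ?thesis by (simp add: prob_space)
    qed
    have inv: "(\<integral>v. \<psi> v \<partial>\<mu>1) = (\<integral>v. g n v \<partial>\<mu>1)" "(\<integral>v. \<psi> v \<partial>\<mu>2) = (\<integral>v. g n v \<partial>\<mu>2)" for n
    proof -
      have bd: "\<exists>B. \<forall>v\<in>space (Hmeas \<alpha>). \<bar>\<psi> v\<bar> \<le> B" using pb by (intro exI[of _ 1]) (auto simp: space_Hmeas)
      show "(\<integral>v. \<psi> v \<partial>\<mu>1) = (\<integral>v. g n v \<partial>\<mu>1)" "(\<integral>v. \<psi> v \<partial>\<mu>2) = (\<integral>v. g n v \<partial>\<mu>2)"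
        using i1 i2 pmeas bd unfolding invariant_measure_def g_def by auto
    qed
    have gdiff: "(\<lambda>n. g n v - g n v') \<longlonglongrightarrow> 0" if v: "v \<in> Hspace \<alpha>" "v' \<in> Hspace \<alpha>" for v v'
    proof -
      have eq: "g n v - g n v' = (\<integral>\<omega>. \<psi> (u v (real (Suc n)) \<omega>) - \<psi> (u v' (real (Suc n)) \<omega>) \<partial>M)" for n
        unfolding g_def trans_sg_def using psi v by (intro Bochner_Integration.integral_diff[symmetric])
      have "(\<lambda>n. \<integral>\<omega>. \<psi> (u v (real (Suc n)) \<omega>) - \<psi> (u v' (real (Suc n)) \<omega>) \<partial>M) \<longlonglongrightarrow> (\<integral>\<omega>. 0 \<partial>M)"
      proof (rule integral_dominated_convergence[where w="\<lambda>_. 2"])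
        show "(\<lambda>\<omega>. \<psi> (u v (real (Suc n)) \<omega>) - \<psi> (u v' (real (Suc n)) \<omega>)) \<in> borel_measurable M" for n
          using psm v by (intro borel_measurable_diff)
        show "AE \<omega> in M. norm (\<psi> (u v (real (Suc n)) \<omega>) - \<psi> (u v' (real (Suc n)) \<omega>)) \<le> 2" for n
        proof (rule AE_I2)
          fix \<omega> assume "\<omega> \<in> space M"
          then have "\<bar>\<psi> (u v (real (Suc n)) \<omega>)\<bar> \<le> 1" "\<bar>\<psi> (u v' (real (Suc n)) \<omega>)\<bar> \<le> 1" using uH v by (auto intro!: pb)
          then show "norm (\<psi> (u v (real (Suc n)) \<omega>) - \<psi> (u v' (real (Suc n)) \<omega>)) \<le> 2" by simp
        qed
        have "AE \<omega> in M. \<forall>k. (\<lambda>n. cf (u v (real (Suc n)) \<omega>) k - cf (u v' (real (Suc n)) \<omega>) k) \<longlonglongrightarrow> 0"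
          unfolding AE_all_countable using conv[OF v] by blast
        then show "AE \<omega> in M. (\<lambda>n. \<psi> (u v (real (Suc n)) \<omega>) - \<psi> (u v' (real (Suc n)) \<omega>)) \<longlonglongrightarrow> 0"
          using AE_space
        proof eventually_elim
          case (elim \<omega>)
          have le: "norm (\<psi> (u v (real (Suc n)) \<omega>) - \<psi> (u v' (real (Suc n)) \<omega>)) \<le>
              K * sqrt (\<Sum>j<m. (cf (u v (real (Suc n)) \<omega>) j - cf (u v' (real (Suc n)) \<omega>) j)^2)" for n
          proof -
            have H: "u v (real (Suc n)) \<omega> \<in> Hspace \<alpha>" "u v' (real (Suc n)) \<omega> \<in> Hspace \<alpha>" using uH v elim(2) by auto
            have "norm (\<psi> (u v (real (Suc n)) \<omega>) - \<psi> (u v' (real (Suc n)) \<omega>)) \<le>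
              K * L2dist (proj m (u v (real (Suc n)) \<omega>)) (proj m (u v' (real (Suc n)) \<omega>))"
              using lip proj_Hspace[OF H(1) m] proj_Hspace[OF H(2) m] unfolding \<psi>_def Hlip_def by simp
            then show ?thesis unfolding L2dist_proj[OF HspaceD[OF H(1)] HspaceD[OF H(2)]] .
          qed
          have "(\<lambda>n. K * sqrt (\<Sum>j<m. (cf (u v (real (Suc n)) \<omega>) j - cf (u v' (real (Suc n)) \<omega>) j)^2)) \<longlonglongrightarrow> K * sqrt (\<Sum>j<m. 0^2)"
            using elim(1) by (intro tendsto_intros) blast
          then have "(\<lambda>n. K * sqrt (\<Sum>j<m. (cf (u v (real (Suc n)) \<omega>) j - cf (u v' (real (Suc n)) \<omega>) j)^2)) \<longlonglongrightarrow> 0" by simp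
          then show ?case by (rule Lim_null_comparison[OF always_eventually[OF allI[OF le]]])
        qed
      qed auto
      then show ?thesis unfolding eq by simp
    qed
    have gi: "integrable \<mu>1 (g n)" "integrable \<mu>2 (g n)" for n
      by (rule M1.integrable_const_bound[of _ 1] M2.integrable_const_bound[of _ 1];
          use mcong[OF gm] gb sp in \<open>auto intro!: AE_I2\<close>)+
    \<comment> \<open>Averaging over \<open>v'\<close> first and over \<open>v\<close> afterwards,
      each time by dominated convergence, avoids the product of the two measures.\<close>
    have h: "(\<lambda>n. g n v - (\<integral>v'. g n v' \<partial>\<mu>2)) \<longlonglongrightarrow> 0" if v: "v \<in> Hspace \<alpha>" for v
    proof -
      have "(\<lambda>n. \<integral>v'. g n v - g n v' \<partial>\<mu>2) \<longlonglongrightarrow> (\<integral>v'. 0 \<partial>\<mu>2)"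
      proof (rule integral_dominated_convergence[where w="\<lambda>_. 2"])
        show "(\<lambda>v'. g n v - g n v') \<in> borel_measurable \<mu>2" for n using mcong(2)[OF gm] by measurable
        show "AE v' in \<mu>2. (\<lambda>n. g n v - g n v') \<longlonglongrightarrow> 0" using gdiff[OF v] sp by (intro AE_I2) auto
        show "AE v' in \<mu>2. norm (g n v - g n v') \<le> 2" for n
        proof (rule AE_I2)
          fix v' assume "v' \<in> space \<mu>2"
          then show "norm (g n v - g n v') \<le> 2" using gb[OF v, of n] gb[of v' n] sp by auto
        qed
      qed auto
      moreover have "(\<integral>v'. g n v - g n v' \<partial>\<mu>2) = g n v - (\<integral>v'. g n v' \<partial>\<mu>2)" for n
        using gi by (simp add: M2.prob_space)
      ultimately show ?thesis by simp
    qed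
    have "(\<lambda>n. \<integral>v. g n v - (\<integral>v'. g n v' \<partial>\<mu>2) \<partial>\<mu>1) \<longlonglongrightarrow> (\<integral>v. 0 \<partial>\<mu>1)"
    proof (rule integral_dominated_convergence[where w="\<lambda>_. 2"])
      show "(\<lambda>v. g n v - (\<integral>v'. g n v' \<partial>\<mu>2)) \<in> borel_measurable \<mu>1" for n using mcong(1)[OF gm] by measurable
      show "AE v in \<mu>1. (\<lambda>n. g n v - (\<integral>v'. g n v' \<partial>\<mu>2)) \<longlonglongrightarrow> 0" using h sp by (intro AE_I2) auto
      have c: "\<bar>\<integral>v'. g n v' \<partial>\<mu>2\<bar> \<le> 1" for n
      proof -
        have "\<bar>\<integral>v'. g n v' \<partial>\<mu>2\<bar> \<le> (\<integral>v'. \<bar>g n v'\<bar> \<partial>\<mu>2)" by (rule integral_abs_bound)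
        also have "\<dots> \<le> (\<integral>v'. 1 \<partial>\<mu>2)" using gi gb sp by (intro integral_mono) auto
        finally show ?thesis by (simp add: M2.prob_space)
      qed
      show "AE v in \<mu>1. norm (g n v - (\<integral>v'. g n v' \<partial>\<mu>2)) \<le> 2" for n
      proof (rule AE_I2)
        fix v assume "v \<in> space \<mu>1"
        then show "norm (g n v - (\<integral>v'. g n v' \<partial>\<mu>2)) \<le> 2" using gb[of v n] c[of n] sp by auto
      qed
    qed auto
    moreover have "(\<integral>v. g n v - (\<integral>v'. g n v' \<partial>\<mu>2) \<partial>\<mu>1) = (\<integral>v. \<psi> v \<partial>\<mu>1) - (\<integral>v. \<psi> v \<partial>\<mu>2)" for n
      unfolding inv[of n] using gi by (simp add: M1.prob_space)
    ultimately have "(\<integral>v. \<psi> v \<partial>\<mu>1) - (\<integral>v. \<psi> v \<partial>\<mu>2) = 0" by (simp add: LIMSEQ_const_iff)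
    then show ?thesis unfolding \<psi>_def by simp
  qed
  \<comment> \<open>Removal of the projection, by Lipschitz continuity and convergence of the
    partial sums. The index \<open>Suc m\<close> keeps the mean unchanged.\<close>
  have plim: "(\<lambda>m. \<phi> (proj (Suc m) v)) \<longlonglongrightarrow> \<phi> v" if v: "v \<in> Hspace \<alpha>" for v
  proof -
    have z: "(\<lambda>m. K * L2dist (proj (Suc m) v) v) \<longlonglongrightarrow> K * 0"
      by (intro tendsto_intros LIMSEQ_Suc L2dist_proj_lim HspaceD[OF v])
    have le: "norm (\<phi> (proj (Suc m) v) - \<phi> v) \<le> K * L2dist (proj (Suc m) v) v" for m
      using lip v proj_Hspace[OF v, of "Suc m"] unfolding Hlip_def by simp
    have "(\<lambda>m. \<phi> (proj (Suc m) v) - \<phi> v) \<longlonglongrightarrow> 0"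
      by (rule Lim_null_comparison[OF always_eventually[OF allI[OF le]]]) (use z in simp)
    then show ?thesis by (simp add: LIM_zero_iff)
  qed
  have pm: "(\<lambda>v. \<phi> (proj (Suc m) v)) \<in> borel_measurable \<mu>1" "(\<lambda>v. \<phi> (proj (Suc m) v)) \<in> borel_measurable \<mu>2" for m
    using Hlip_measurable[OF Hlip_proj[OF lip, of "Suc m"]] by (auto intro: mcong)
  have fm: "\<phi> \<in> borel_measurable \<mu>1" "\<phi> \<in> borel_measurable \<mu>2" using Hlip_measurable[OF lip] by (auto intro: mcong)
  have pb: "\<bar>\<phi> (proj (Suc m) v)\<bar> \<le> 1" if "v \<in> Hspace \<alpha>" for m v using that by (intro b proj_Hspace) auto
  have "(\<lambda>m. \<integral>v. \<phi> (proj (Suc m) v) \<partial>\<mu>1) \<longlonglongrightarrow> (\<integral>v. \<phi> v \<partial>\<mu>1)"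
    by (rule integral_dominated_convergence[where w="\<lambda>_. 1"]) (use pm fm pb plim sp in auto)
  moreover have "(\<lambda>m. \<integral>v. \<phi> (proj (Suc m) v) \<partial>\<mu>2) \<longlonglongrightarrow> (\<integral>v. \<phi> v \<partial>\<mu>2)"
    by (rule integral_dominated_convergence[where w="\<lambda>_. 1"]) (use pm fm pb plim sp in auto)
  moreover have "(\<integral>v. \<phi> (proj (Suc m) v) \<partial>\<mu>1) = (\<integral>v. \<phi> (proj (Suc m) v) \<partial>\<mu>2)" for m by (rule fin) simp
  ultimately show ?thesis using LIMSEQ_unique by simp
qed

theorem theorem3p3:
  fixes M :: "'w measure"
    and \<beta> :: "nat \<Rightarrow> real \<Rightarrow> 'w \<Rightarrow> real"
    and a0 a1 a2 a3 \<sigma> :: real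
    and u :: "(real \<Rightarrow> real) \<Rightarrow> real \<Rightarrow> 'w \<Rightarrow> (real \<Rightarrow> real)"
  assumes "prob_space M"
    and "a0 > 0"
    and "(SUP x::real. - (3 * a0 * x^2 + 2 * a1 * x + a2)) < 1"
    and "\<forall>j\<ge>1. std_brownian_motion M (\<beta> j)"
    and "prob_space.indep_vars M (\<lambda>_. Pi\<^sub>M UNIV (\<lambda>_. borel)) (\<lambda>j \<omega>. \<lambda>t. \<beta> j t \<omega>) {1..}"
    and "mild_solution M \<beta> \<sigma> (cubic a0 a1 a2 a3) u"
    and "\<forall>\<alpha> t. 0 \<le> t \<longrightarrow> (\<lambda>(v, \<omega>). u v t \<omega>) \<in> Hmeas \<alpha> \<Otimes>\<^sub>M M \<rightarrow>\<^sub>M Hmeas \<alpha>"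
  shows "\<forall>\<alpha> \<mu>1 \<mu>2. invariant_measure M u \<alpha> \<mu>1 \<and> invariant_measure M u \<alpha> \<mu>2 \<longrightarrow> \<mu>1 = \<mu>2"
proof (intro allI impI, elim conjE)
  fix \<alpha> and \<mu>1 \<mu>2 :: "(real \<Rightarrow> real) measure"
  assume i1: "invariant_measure M u \<alpha> \<mu>1" and i2: "invariant_measure M u \<alpha> \<mu>2"
  obtain L where L: "0 \<le> L" "L < 1"
    "\<And>x y. - L * (x - y)^2 \<le> (cubic a0 a1 a2 a3 x - cubic a0 a1 a2 a3 y) * (x - y)"
    using cubic_one_sided_lipschitz[OF assms(2,3)] by blast
  have meas: "(\<lambda>(v, \<omega>). u v t \<omega>) \<in> Hmeas \<alpha> \<Otimes>\<^sub>M M \<rightarrow>\<^sub>M Hmeas \<alpha>" if "0 \<le> t" for t using assms(7) that by blast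
  have conv: "AE \<omega> in M. (\<lambda>n. cf (u v1 (real (Suc n)) \<omega>) k - cf (u v2 (real (Suc n)) \<omega>) k) \<longlonglongrightarrow> 0"
    if v: "v1 \<in> Hspace \<alpha>" "v2 \<in> Hspace \<alpha>" for v1 v2 k
  proof -
    have uH: "u v (real (Suc n)) \<omega> \<in> Hspace \<alpha>" if "v \<in> Hspace \<alpha>" "\<omega> \<in> space M" for v n \<omega>
      using measurable_space[OF meas[of "real (Suc n)"], of "(v, \<omega>)"] that by (simp add: space_pair_measure space_Hmeas)
    have "AE \<omega> in M. \<forall>N k. exp (2 * (1 - L) * real (Suc N)) * (cf (u v1 (real (Suc N)) \<omega>) k - cf (u v2 (real (Suc N)) \<omega>) k)^2 / lam k \<le> (\<integral>x. (v1 x - v2 x)^2 \<partial>lebI)"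
      using v by (intro AE_contraction[OF assms(1,2,4,6) L]) (auto intro: HspaceD simp: Hspace_cf)
    then show ?thesis
      using AE_space
    proof eventually_elim
      case (elim \<omega>)
      define d where "d n = cf (u v1 (real (Suc n)) \<omega>) k - cf (u v2 (real (Suc n)) \<omega>) k" for n
      show ?case
      proof (cases "k = 0")
        \<comment> \<open>For \<open>k = 0\<close> the contraction estimate is void, since division
          by \<open>lam 0 = 0\<close> gives 0. Instead, both solutions stay in
          \<open>Hspace \<alpha>\<close>, which fixes this coefficient.\<close>
        case True
        then have "d n = 0" for n
          unfolding d_def using Hspace_cf[OF uH[OF v(1) elim(2)], of n] Hspace_cf[OF uH[OF v(2) elim(2)], of n] by simp
        then show ?thesis unfolding d_def by simp
      next
        case False
        then have l: "0 < lam k" by (simp add: lam_def)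
        define S where "S = (\<integral>x. (v1 x - v2 x)^2 \<partial>lebI)"
        have le: "(d n)^2 \<le> lam k * S * (exp (- (2 * (1 - L))))^Suc n" for n
        proof -
          have "exp (2 * (1 - L) * real (Suc n)) * (d n)^2 / lam k \<le> S" unfolding d_def S_def using elim(1) by blast
          then have "exp (2 * (1 - L) * real (Suc n)) * (d n)^2 \<le> lam k * S" using l by (simp add: divide_le_eq mult.commute)
          then have "exp (- (2 * (1 - L) * real (Suc n))) * (exp (2 * (1 - L) * real (Suc n)) * (d n)^2) \<le>
              exp (- (2 * (1 - L) * real (Suc n))) * (lam k * S)" by (rule mult_left_mono) simp
          then have "(d n)^2 \<le> lam k * S * exp (- (2 * (1 - L) * real (Suc n)))"
            by (simp only: mult.assoc[symmetric] exp_add[symmetric]) (simp add: mult.commute)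
          also have "exp (- (2 * (1 - L) * real (Suc n))) = (exp (- (2 * (1 - L))))^Suc n"
            by (subst exp_of_nat_mult[symmetric]) (simp add: algebra_simps)
          finally show ?thesis .
        qed
        have z: "(\<lambda>n. lam k * S * (exp (- (2 * (1 - L))))^Suc n) \<longlonglongrightarrow> lam k * S * 0"
          using L(2) by (intro tendsto_intros LIMSEQ_Suc LIMSEQ_realpow_zero) auto
        have le': "norm ((d n)^2) \<le> lam k * S * (exp (- (2 * (1 - L))))^Suc n" for n using le[of n] by simp
        have "(\<lambda>n. (d n)^2) \<longlonglongrightarrow> 0"
          by (rule Lim_null_comparison[OF always_eventually[OF allI[OF le']]]) (use z in simp)
        then have "(\<lambda>n. sqrt ((d n)^2)) \<longlonglongrightarrow> sqrt 0" by (rule tendsto_real_sqrt)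
        then show ?thesis unfolding d_def[symmetric] by (simp add: tendsto_rabs_zero_iff)
      qed
    qed
  qed
  show "\<mu>1 = \<mu>2"
  proof (rule measure_eqI_Hlip)
    show "prob_space \<mu>1" "sets \<mu>1 = sets (Hmeas \<alpha>)" "prob_space \<mu>2" "sets \<mu>2 = sets (Hmeas \<alpha>)"
      using i1 i2 unfolding invariant_measure_def by auto
    show "(\<integral>v. \<phi> v \<partial>\<mu>1) = (\<integral>v. \<phi> v \<partial>\<mu>2)"
      if "Hlip \<alpha> K \<phi>" "\<And>v. v \<in> Hspace \<alpha> \<Longrightarrow> \<bar>\<phi> v\<bar> \<le> 1" for \<phi> K
      by (rule invariant_integral_eq[OF assms(1) meas conv i1 i2 that])
  qed
qed

end
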